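(* Let $a>0$ and let $\gamma$ satisfy $\gamma^2>\frac{1}{2a}$. Consider the attitude kinematics $\dot R=R[\omega]_\times$ on $SO(3)$ coupled with the attitude observer $$\dot{\hat R}=\hat R[\omega_y]_\times-[\sigma]_\times\hat R,\qquad \hat R(0)\in SO(3),\qquad \omega_y=\omega+n_\omega,$$ let $\tilde R=R\hat R^\top$, and assume that $\tilde R(0)\in SO(3)\setminus\Pi$. Then the innovation term $$\sigma=-\frac{\psi(A\tilde R)}{1-|\tilde R|_I^2}\quad\text{with } A=aI$$ minimizes the cost functional $$J(\sigma)=\sup_{n_\omega\in\mathcal{N}}\Big\{\lim_{t\to+\infty}\Big[2\ln(1+\|\mathcal{Z}(\tilde R(t))\|^2)+\int_0^t\Big(\big(2a-\tfrac1{\gamma^2}\big)\mathcal{Z}(\tilde R)^\top\mathcal{Z}(\tilde R)+\tfrac1{2a}\sigma^\top\sigma-\gamma^2n_\omega^\top n_\omega\Big)d\tau\Big]\Big\},$$ where $\mathcal{N}$ is the set of locally bounded disturbances, with value function $J^*=2\ln(1+\|\mathcal{Z}(\tilde R(0))\|^2)$. Moreover, with this innovation term, the achieved disturbance attenuation level is $$\big(4a-\tfrac{1}{\gamma^2}\big)\int_0^\infty\mathcal{Z}(\tilde R(t))^\top\mathcal{Z}(\tilde R(t))\,dt\le\gamma^2\int_0^\infty n_\omega(t)^\top n_\omega(t)\,dt+2\ln(1+\|\mathcal{Z}(\tilde R(0))\|^2).$$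
   Context: $SO(3)=\{R\in\mathbb{R}^{3\times3}: \det R=1,\ RR^\top=I\}$. $[x]_\times$ is the skew-symmetric matrix with $[x]_\times y=x\times y$ for $x,y\in\mathbb{R}^3$; $\mathrm{vex}$ is the inverse of $x\mapsto[x]_\times$ on skew-symmetric matrices. For $M\in\mathbb{R}^{3\times3}$, $\psi(M)=\mathrm{vex}\big((M-M^\top)/2\big)$. For $R\in SO(3)$, $|R|_I\in[0,1]$ is defined by $|R|_I^2=\frac14\mathrm{tr}(I-R)$, and $\Pi=\{R\in SO(3): |R|_I=1\}$. For $R\in SO(3)\setminus\Pi$, the Rodrigues vector is $\mathcal{Z}(R)=\mathrm{vex}\big((R-I)(R+I)^{-1}\big)=\frac{\psi(R)}{2(1-|R|_I^2)}$. Attitude measurements are perfect ($R$ is available to the observer), while the angular velocity measurement $\omega_y$ is corrupted by the disturbance $n_\omega$. For a general innovation term $\sigma$, the Rodrigues vector of the error evolves (as long as $\tilde R\notin\Pi$) according to $\frac{d}{dt}\mathcal{Z}(\tilde R)=\frac12\big(I+[\mathcal{Z}(\tilde R)]_\times+\mathcal{Z}(\tilde R)\mathcal{Z}(\tilde R)^\top\big)(\sigma-\hat Rn_\omega)$; $J(\sigma)$ is evaluated along these trajectories, and the minimization is over innovation terms $\sigma$ for which $J(\sigma)$ is well defined. *)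

theory Defs
  imports "HOL-Analysis.Analysis"
begin

definition SO3 :: "(real^3^3) set" where
  "SO3 = {R. det R = 1 \<and> R ** transpose R = mat 1}"

definition skew :: "real^3 \<Rightarrow> real^3^3" where
  "skew x = matrix (cross3 x)"

(* skew is a bijection onto the skew-symmetric matrices; vex is only meaningful there. *)
definition vex :: "real^3^3 \<Rightarrow> real^3" where
  "vex = inv skew"

definition psi :: "real^3^3 \<Rightarrow> real^3" where
  "psi M = vex ((1/2) *\<^sub>R (M - transpose M))"

definition att_norm :: "real^3^3 \<Rightarrow> real" where
  "att_norm R = sqrt (trace (mat 1 - R) / 4)"

definition Pi_set :: "(real^3^3) set" where
  "Pi_set = {R \<in> SO3. att_norm R = 1}"

definition rodrigues :: "real^3^3 \<Rightarrow> real^3" where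
  "rodrigues R = vex ((R - mat 1) ** matrix_inv (R + mat 1))"

(* Disturbances are measurable but need not be continuous, so differential equations are
   understood in the sense of Caratheodory: x' = v on [0,T] means that v is Lebesgue
   integrable on [0,T] and x is its indefinite integral, i.e. x is absolutely continuous
   with x'(t) = v(t) for almost every t. *)
definition has_rate_on :: "real \<Rightarrow> (real \<Rightarrow> 'a::euclidean_space) \<Rightarrow> (real \<Rightarrow> 'a) \<Rightarrow> bool" where
  "has_rate_on T x v \<longleftrightarrow>
     v absolutely_integrable_on {0..T} \<and> (\<forall>t\<in>{0..T}. x t = x 0 + integral {0..t} v)"

definition attitude_kinematics :: "(real \<Rightarrow> real^3) \<Rightarrow> (real \<Rightarrow> real^3^3) \<Rightarrow> bool" where
  "attitude_kinematics \<omega> R \<longleftrightarrow>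
     (\<forall>t\<ge>0. R t \<in> SO3) \<and> (\<forall>T\<ge>0. has_rate_on T R (\<lambda>t. R t ** skew (\<omega> t)))"

definition disturbances :: "(real \<Rightarrow> real^3) set" where
  "disturbances = {n. n \<in> borel_measurable (lebesgue_on {0..}) \<and> (\<forall>T\<ge>0. bounded (n ` {0..T}))}"

definition att_err :: "(real \<Rightarrow> real^3^3) \<Rightarrow> (real \<Rightarrow> real^3^3) \<Rightarrow> real \<Rightarrow> real^3^3" where
  "att_err R Rh t = R t ** transpose (Rh t)"

(* An innovation term is an operator producing sigma(t) from the signals available to the
   observer: the attitude R, the estimate Rh and the measured angular velocity wy.
   Static, time-varying and dynamic feedback laws are all of this form. *)
type_synonym innovation =
  "(real \<Rightarrow> real^3^3) \<Rightarrow> (real \<Rightarrow> real^3^3) \<Rightarrow> (real \<Rightarrow> real^3) \<Rightarrow> real \<Rightarrow> real^3"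

definition causal :: "innovation \<Rightarrow> bool" where
  "causal \<sigma> \<longleftrightarrow>
     (\<forall>t\<ge>0. \<forall>R R' Rh Rh' wy wy'.
        (\<forall>s\<in>{0..t}. R s = R' s \<and> Rh s = Rh' s \<and> wy s = wy' s) \<longrightarrow>
        \<sigma> R Rh wy t = \<sigma> R' Rh' wy' t)"

definition sigma_signal ::
  "innovation \<Rightarrow> (real \<Rightarrow> real^3) \<Rightarrow> (real \<Rightarrow> real^3^3) \<Rightarrow> (real \<Rightarrow> real^3) \<Rightarrow>
   (real \<Rightarrow> real^3^3) \<Rightarrow> real \<Rightarrow> real^3" where
  "sigma_signal \<sigma> \<omega> R n Rh = \<sigma> R Rh (\<lambda>t. \<omega> t + n t)"

(* Rh is a trajectory of the observer on [0,T] from Rh0 under the disturbance n,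
   with the attitude error staying outside Pi_set. *)
definition observer_on ::
  "real \<Rightarrow> innovation \<Rightarrow> (real \<Rightarrow> real^3) \<Rightarrow> (real \<Rightarrow> real^3^3) \<Rightarrow> real^3^3 \<Rightarrow>
   (real \<Rightarrow> real^3) \<Rightarrow> (real \<Rightarrow> real^3^3) \<Rightarrow> bool" where
  "observer_on T \<sigma> \<omega> R Rh0 n Rh \<longleftrightarrow>
     Rh 0 = Rh0 \<and>
     (\<forall>t\<in>{0..T}. Rh t \<in> SO3 \<and> att_err R Rh t \<notin> Pi_set) \<and>
     has_rate_on T Rh
       (\<lambda>t. Rh t ** skew (\<omega> t + n t) - skew (sigma_signal \<sigma> \<omega> R n Rh t) ** Rh t)"

definition observer ::
  "innovation \<Rightarrow> (real \<Rightarrow> real^3) \<Rightarrow> (real \<Rightarrow> real^3^3) \<Rightarrow> real^3^3 \<Rightarrow>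
   (real \<Rightarrow> real^3) \<Rightarrow> (real \<Rightarrow> real^3^3) \<Rightarrow> bool" where
  "observer \<sigma> \<omega> R Rh0 n Rh \<longleftrightarrow> (\<forall>T\<ge>0. observer_on T \<sigma> \<omega> R Rh0 n Rh)"

definition running_cost ::
  "real \<Rightarrow> real \<Rightarrow> innovation \<Rightarrow> (real \<Rightarrow> real^3) \<Rightarrow> (real \<Rightarrow> real^3^3) \<Rightarrow>
   (real \<Rightarrow> real^3) \<Rightarrow> (real \<Rightarrow> real^3^3) \<Rightarrow> real \<Rightarrow> real" where
  "running_cost a \<gamma> \<sigma> \<omega> R n Rh t =
     (let z = rodrigues (att_err R Rh t); s = sigma_signal \<sigma> \<omega> R n Rh t
      in (2 * a - 1 / \<gamma>^2) * (z \<bullet> z) + 1 / (2 * a) * (s \<bullet> s) - \<gamma>^2 * (n t \<bullet> n t))"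

definition cost_upto ::
  "real \<Rightarrow> real \<Rightarrow> innovation \<Rightarrow> (real \<Rightarrow> real^3) \<Rightarrow> (real \<Rightarrow> real^3^3) \<Rightarrow>
   (real \<Rightarrow> real^3) \<Rightarrow> (real \<Rightarrow> real^3^3) \<Rightarrow> real \<Rightarrow> real" where
  "cost_upto a \<gamma> \<sigma> \<omega> R n Rh t =
     2 * ln (1 + (norm (rodrigues (att_err R Rh t)))^2)
     + integral {0..t} (running_cost a \<gamma> \<sigma> \<omega> R n Rh)"

(* For a law satisfying J_well_defined every disturbance has exactly one trajectory (on t >= 0),
   so the inner supremum has a single value. Limits and suprema are in the extended reals. *)
definition J ::
  "real \<Rightarrow> real \<Rightarrow> (real \<Rightarrow> real^3) \<Rightarrow> (real \<Rightarrow> real^3^3) \<Rightarrow> real^3^3 \<Rightarrow> innovation \<Rightarrow> ereal" where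
  "J a \<gamma> \<omega> R Rh0 \<sigma> =
     (SUP n\<in>disturbances. SUP Rh\<in>{Rh. observer \<sigma> \<omega> R Rh0 n Rh}.
        Lim at_top (\<lambda>t. ereal (cost_upto a \<gamma> \<sigma> \<omega> R n Rh t)))"

(* Each disturbance must determine a unique global trajectory, along which the cost has a
   locally integrable integrand and a (possibly infinite) limit. Local integrability rules out
   the convention that the integral of a non-integrable function is 0. *)
definition J_well_defined ::
  "real \<Rightarrow> real \<Rightarrow> (real \<Rightarrow> real^3) \<Rightarrow> (real \<Rightarrow> real^3^3) \<Rightarrow> real^3^3 \<Rightarrow> innovation \<Rightarrow> bool" where
  "J_well_defined a \<gamma> \<omega> R Rh0 \<sigma> \<longleftrightarrow>
     causal \<sigma> \<and>
     (\<forall>n\<in>disturbances.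
        (\<exists>Rh. observer \<sigma> \<omega> R Rh0 n Rh) \<and>
        (\<forall>T\<ge>0. \<forall>Rh Rh'. observer_on T \<sigma> \<omega> R Rh0 n Rh \<longrightarrow> observer_on T \<sigma> \<omega> R Rh0 n Rh' \<longrightarrow>
           (\<forall>t\<in>{0..T}. Rh t = Rh' t)) \<and>
        (\<forall>Rh. observer \<sigma> \<omega> R Rh0 n Rh \<longrightarrow>
           (\<forall>T\<ge>0. running_cost a \<gamma> \<sigma> \<omega> R n Rh absolutely_integrable_on {0..T}) \<and>
           (\<exists>L::ereal. ((\<lambda>t. ereal (cost_upto a \<gamma> \<sigma> \<omega> R n Rh t)) \<longlongrightarrow> L) at_top)))"

definition innov :: "real^3^3 \<Rightarrow> innovation" where
  "innov A R Rh wy t =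
     - (psi (A ** att_err R Rh t) /\<^sub>R (1 - (att_norm (att_err R Rh t))^2))"

end

theory Submission
  imports Defs
begin

text \<open>
  Write \<open>Q\<close> for the attitude error, \<open>z\<close> for its Rodrigues vector and \<open>u = \<sigma> - Rh n\<close>. The
  error obeys \<open>Q' = Q [u]\<close>, and the whole argument runs through the scalar
  \<open>m = (1 + tr Q) / 4 = 1 / (1 + |z|\<^sup>2)\<close>: its rate is \<open>- m (z \<bullet> u)\<close>, so the terminal cost
  \<open>V = 2 ln (1 + |z|\<^sup>2) = - 2 ln m\<close> has the rate \<open>2 (z \<bullet> u)\<close>. Adding the running cost and
  completing two squares gives

  \<open>cost (t) = V (0) + \<integral> |\<sigma> + 2 a z|\<^sup>2 / (2 a) - \<gamma>\<^sup>2 |n + Rh\<^sup>T z / \<gamma>\<^sup>2|\<^sup>2\<close>.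

  The innovation term of the theorem is exactly \<open>\<sigma> = - 2 a z\<close>. For it the cost never increases along
  a trajectory, so its limit exists and is at most \<open>V (0)\<close>; the bound on the
  \<open>L\<^sup>2\<close> gain is the same inequality with the running cost written out and \<open>V \<ge> 0\<close>.

  The harder half is that no admissible \<open>\<sigma>\<close> does better than \<open>V (0)\<close>. The obvious adversary
  \<open>n = - Rh\<^sup>T z / \<gamma>\<^sup>2\<close> need not be a disturbance: it is a feedback, while disturbances are
  chosen in open loop and have to be locally bounded, and a law \<open>\<sigma>\<close> that reacts to the size of
  \<open>n\<close> may drive \<open>z\<close> to infinity in finite time against precisely this feedback. Two devices
  repair it.

  \<^item> \<^emph>\<open>Truncation.\<close> The adversary uses \<open>\<zeta> = \<psi> (Q) / (2 max m \<mu>)\<close> with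
    \<open>\<mu> = m (0)\<close> in place of \<open>z = \<psi> (Q) / (2 m)\<close>. This field is bounded, and \<open>2 (\<zeta> \<bullet> u)\<close> is the
    rate of the convex function of \<open>m\<close> that continues \<open>- 2 ln m\<close> below \<open>\<mu>\<close> by its tangent. That
    function never exceeds \<open>V\<close> and starts at \<open>V (0)\<close>; since \<open>|\<zeta>| \<le> |z|\<close> and
    \<open>2 a > 1 / \<gamma>\<^sup>2\<close>, the squares still have the right sign (\<open>game_identity\<close>,
    \<open>cost_lower_bound\<close>).
  \<^item> \<^emph>\<open>Almost fixed points.\<close> The feedback is realised by an open-loop disturbance only up to a
    small error: \<open>n\<close> is held constant until the feedback has moved by \<open>\<epsilon> (t)\<close>. The sampling
    times cannot accumulate, because at an accumulation point the trajectory of the limiting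
    disturbance would be discontinuous (\<open>approximate_fixed_point_of_causal_operator\<close>). An
    \<open>\<epsilon>\<close> with small \<open>L\<^sup>2\<close> norm costs the adversary arbitrarily little.

  That \<open>- 2 a z\<close> is itself admissible needs global existence and uniqueness for the closed loop
  \<open>Q' = Q [- 2 a z] - [R n] Q\<close> with a bounded measurable forcing term. A clipped and truncated
  version is globally Lipschitz and is solved by Picard iteration; it preserves \<open>SO(3)\<close>, and the
  truncated potential grows at most linearly in time, which keeps \<open>m\<close> above the truncation level,
  so that clipping and truncation are never active.
\<close>

section \<open>Rotations, Rodrigues vectors and the half-angle cosine\<close>

text \<open>
  For the rotation by the angle \<open>\<theta>\<close> this is \<open>cos\<^sup>2 (\<theta> / 2)\<close>. The other scalar invariants are
  expressed through it: \<open>|R|\<^sub>I\<^sup>2 = 1 - cos2_half R\<close>, the set \<open>\<Pi>\<close> is its zero set, and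
  \<open>1 + |z|\<^sup>2\<close> is its reciprocal. Being affine in \<open>R\<close>, it is easy to differentiate along a trajectory.
\<close>

definition cos2_half :: "real^3^3 \<Rightarrow> real" where
  "cos2_half R = (1 + trace R) / 4"

lemma bounded_bilinear_matrix_mult:
  "bounded_bilinear ((**) :: real^'n^'m \<Rightarrow> real^'p^'n \<Rightarrow> real^'p^'m)"
  unfolding bilinear_conv_bounded_bilinear[symmetric] bilinear_def
  by (auto intro!: linearI simp: vec_eq_iff matrix_matrix_mult_def algebra_simps sum.distrib sum_distrib_left)

interpretation matrix_mult: bounded_bilinear "(**) :: real^'n^'m \<Rightarrow> real^'p^'n \<Rightarrow> real^'p^'m"
  by (rule bounded_bilinear_matrix_mult)

lemma skew_entries:
  "skew x $ 1 $ 1 = 0" "skew x $ 1 $ 2 = - x $ 3" "skew x $ 1 $ 3 = x $ 2"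
  "skew x $ 2 $ 1 = x $ 3" "skew x $ 2 $ 2 = 0" "skew x $ 2 $ 3 = - x $ 1"
  "skew x $ 3 $ 1 = - x $ 2" "skew x $ 3 $ 2 = x $ 1" "skew x $ 3 $ 3 = 0"
  by (simp_all add: skew_def matrix_def cross_components axis_def)

lemmas matrix3_simps = vec_eq_iff forall_3 sum_3 matrix_matrix_mult_def matrix_vector_mult_def
  transpose_def mat_def skew_entries

lemma linear_skew: "linear skew"
  by (rule linearI) (simp_all add: matrix3_simps)

lemma skew_mult_vec: "skew x *v y = cross3 x y"
  by (simp add: skew_def matrix_works bounded_linear.linear bilinear_cross[unfolded bilinear_def])

lemma vex_skew: "vex (skew x) = x"
proof -
  have "inj skew"
    by (rule injI) (simp add: matrix3_simps)
  then show ?thesis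
    by (simp add: vex_def)
qed

lemma skew_psi: "skew (psi M) = (1/2) *\<^sub>R (M - transpose M)"
proof -
  define w :: "real^3" where
    "w = vector [(M$3$2 - M$2$3)/2, (M$1$3 - M$3$1)/2, (M$2$1 - M$1$2)/2]"
  have "skew w = (1/2) *\<^sub>R (M - transpose M)"
    by (simp add: matrix3_simps w_def field_simps)
  then show ?thesis
    by (metis psi_def vex_skew)
qed

lemma psi_entries:
  "psi M $ 1 = (M$3$2 - M$2$3)/2" "psi M $ 2 = (M$1$3 - M$3$1)/2" "psi M $ 3 = (M$2$1 - M$1$2)/2"
proof -
  have *: "skew (psi M) $ i $ j = (M $ i $ j - M $ j $ i) / 2" for i j
    by (simp add: skew_psi transpose_def)
  show "psi M $ 1 = (M$3$2 - M$2$3)/2" "psi M $ 2 = (M$1$3 - M$3$1)/2" "psi M $ 3 = (M$2$1 - M$1$2)/2"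
    using *[of 3 2] *[of 1 3] *[of 2 1] by (simp_all add: skew_entries)
qed

lemma linear_psi: "linear psi"
  by (rule linearI) (simp_all add: vec_eq_iff forall_3 psi_entries field_simps)

lemma trace_mult_skew: "trace (M ** skew u) = - 2 * (psi M \<bullet> u)"
  by (simp add: trace_def inner_vec_def matrix3_simps psi_entries field_simps)

lemma SO3_trans_mult: "Q \<in> SO3 \<Longrightarrow> transpose Q ** Q = mat 1"
  by (simp add: SO3_def matrix_left_right_inverse)

lemma SO3_mult_trans: "Q \<in> SO3 \<Longrightarrow> Q ** transpose Q = mat 1"
  by (simp add: SO3_def)

lemma transpose_SO3: "Q \<in> SO3 \<Longrightarrow> transpose Q \<in> SO3"
  using SO3_trans_mult[of Q] by (simp add: SO3_def transpose_transpose)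

lemma mult_SO3: "P \<in> SO3 \<Longrightarrow> Q \<in> SO3 \<Longrightarrow> P ** Q \<in> SO3"
  unfolding SO3_def
  by (auto simp: det_mul matrix_transpose_mul matrix_mul_assoc)
     (metis matrix_mul_assoc matrix_mul_rid)

lemma SO3_orthogonal: "Q \<in> SO3 \<Longrightarrow> orthogonal_matrix Q"
  by (simp add: orthogonal_matrix_def SO3_trans_mult SO3_mult_trans)

lemma norm_SO3_mult: "Q \<in> SO3 \<Longrightarrow> norm (Q *v x) = norm x"
  using SO3_orthogonal[of Q] orthogonal_transformation_matrix[of "(*v) Q"]
  by (simp add: orthogonal_transformation)

lemma inner_SO3_mult: "Q \<in> SO3 \<Longrightarrow> (Q *v x) \<bullet> y = x \<bullet> (transpose Q *v y)"
  by (metis dot_lmul_matrix inner_commute transpose_matrix_vector)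

lemma SO3_conj_skew:
  assumes "Q \<in> SO3"
  shows "Q ** skew x ** transpose Q = skew (Q *v x)"
proof -
  have "rotation_matrix Q"
    using assms SO3_orthogonal by (simp add: rotation_matrix_def SO3_def)
  have "(Q ** skew x ** transpose Q) *v y = skew (Q *v x) *v y" for y
  proof -
    have "skew (Q *v x) *v y = cross3 (Q *v x) (Q *v (transpose Q *v y))"
      by (simp add: skew_mult_vec matrix_vector_mul_assoc SO3_mult_trans assms
          del: transpose_matrix_vector)
    also have "\<dots> = Q *v (cross3 x (transpose Q *v y))"
      using \<open>rotation_matrix Q\<close> by (rule cross_rotation_matrix)
    also have "\<dots> = (Q ** skew x ** transpose Q) *v y"
      by (simp add: skew_mult_vec[symmetric] matrix_vector_mul_assoc matrix_mul_assoc
          del: transpose_matrix_vector)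
    finally show ?thesis by simp
  qed
  then show ?thesis
    by (simp add: matrix_eq)
qed

text \<open>
  A rotation is its own cofactor matrix, because it preserves the cross products of the standard
  basis. The polynomial identities for rotations below rest on these nine equations.
\<close>

lemma SO3_entry_eq_cofactor:
  assumes "Q \<in> SO3"
  shows "Q$1$1 = Q$2$2*Q$3$3 - Q$2$3*Q$3$2" "Q$1$2 = Q$2$3*Q$3$1 - Q$2$1*Q$3$3"
    "Q$1$3 = Q$2$1*Q$3$2 - Q$2$2*Q$3$1" "Q$2$1 = Q$1$3*Q$3$2 - Q$1$2*Q$3$3"
    "Q$2$2 = Q$1$1*Q$3$3 - Q$1$3*Q$3$1" "Q$2$3 = Q$1$2*Q$3$1 - Q$1$1*Q$3$2"
    "Q$3$1 = Q$1$2*Q$2$3 - Q$1$3*Q$2$2" "Q$3$2 = Q$1$3*Q$2$1 - Q$1$1*Q$2$3"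
    "Q$3$3 = Q$1$1*Q$2$2 - Q$1$2*Q$2$1"
proof -
  have r: "rotation_matrix Q"
    using assms SO3_orthogonal by (simp add: rotation_matrix_def SO3_def)
  note c = cross_rotation_matrix[OF r, of "axis i 1" "axis j 1" for i j]
  show "Q$1$1 = Q$2$2*Q$3$3 - Q$2$3*Q$3$2" "Q$2$1 = Q$1$3*Q$3$2 - Q$1$2*Q$3$3"
     "Q$3$1 = Q$1$2*Q$2$3 - Q$1$3*Q$2$2"
    using c[of 2 3] by (simp_all add: vec_eq_iff forall_3 cross_components matrix_vector_mult_def sum_3 axis_def
        mult.commute)
  show "Q$1$2 = Q$2$3*Q$3$1 - Q$2$1*Q$3$3" "Q$2$2 = Q$1$1*Q$3$3 - Q$1$3*Q$3$1"
    "Q$3$2 = Q$1$3*Q$2$1 - Q$1$1*Q$2$3"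
    using c[of 3 1] by (simp_all add: vec_eq_iff forall_3 cross_components matrix_vector_mult_def sum_3 axis_def
        mult.commute)
  show "Q$1$3 = Q$2$1*Q$3$2 - Q$2$2*Q$3$1" "Q$2$3 = Q$1$2*Q$3$1 - Q$1$1*Q$3$2"
    "Q$3$3 = Q$1$1*Q$2$2 - Q$1$2*Q$2$1"
    using c[of 1 2] by (simp_all add: vec_eq_iff forall_3 cross_components matrix_vector_mult_def sum_3 axis_def
        mult.commute)
qed

text \<open>
  Cayley-Hamilton in dimension three, in the division-free form with the adjugate. For a rotation
  the adjugate is the transpose, so the square becomes a combination of \<open>Q\<close>, \<open>I\<close> and \<open>Q\<^sup>T\<close>.
\<close>

lemma matrix_square_3:
  fixes Q :: "real^3^3"
  defines "adj \<equiv> (\<chi> i j. if i = 1 then (if j = 1 then Q$2$2*Q$3$3 - Q$2$3*Q$3$2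
        else if j = 2 then Q$1$3*Q$3$2 - Q$1$2*Q$3$3 else Q$1$2*Q$2$3 - Q$1$3*Q$2$2)
      else if i = 2 then (if j = 1 then Q$2$3*Q$3$1 - Q$2$1*Q$3$3
        else if j = 2 then Q$1$1*Q$3$3 - Q$1$3*Q$3$1 else Q$1$3*Q$2$1 - Q$1$1*Q$2$3)
      else (if j = 1 then Q$2$1*Q$3$2 - Q$2$2*Q$3$1
        else if j = 2 then Q$1$2*Q$3$1 - Q$1$1*Q$3$2 else Q$1$1*Q$2$2 - Q$1$2*Q$2$1))"
  shows "Q ** Q = trace Q *\<^sub>R Q - trace adj *\<^sub>R mat 1 + adj"
  by (simp add: matrix3_simps adj_def trace_def algebra_simps)

lemma SO3_square:
  assumes "Q \<in> SO3"
  shows "Q ** Q = trace Q *\<^sub>R (Q - mat 1) + transpose Q"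
proof -
  note c = SO3_entry_eq_cofactor[OF assms, symmetric]
  have t: "trace (transpose Q) = trace Q"
    by (simp add: trace_def transpose_def)
  have "Q ** Q = trace Q *\<^sub>R Q - trace (transpose Q) *\<^sub>R mat 1 + transpose Q"
    unfolding matrix_square_3[of Q] c
    by (simp add: vec_eq_iff forall_3 transpose_def trace_def sum_3 mat_def)
  then show ?thesis
    by (simp add: t scaleR_diff_right)
qed

text \<open>
  The principal minors of order two of a rotation sum to its trace, so the characteristic
  polynomial at \<open>- 1\<close> is, up to sign, \<open>2 + 2 tr Q\<close>. Outside \<open>\<Pi>\<close> this makes the Cayley transform well defined.
\<close>

lemma det_plus_id:
  assumes "Q \<in> SO3"
  shows "det (Q + mat 1) = 8 * cos2_half Q"
proof -
  have eq: "det (Q + mat 1) = det Q + trace Q + 1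
     + (Q$2$2*Q$3$3 - Q$2$3*Q$3$2) + (Q$1$1*Q$3$3 - Q$1$3*Q$3$1) + (Q$1$1*Q$2$2 - Q$1$2*Q$2$1)"
    by (simp add: det_3 trace_def sum_3 mat_def) (simp add: algebra_simps)
  have "det Q = 1" using assms by (simp add: SO3_def)
  then show ?thesis
    unfolding eq SO3_entry_eq_cofactor(1,5,9)[OF assms, symmetric] by (simp add: cos2_half_def trace_def sum_3)
qed

text \<open>
  In terms of the rotation angle: \<open>sin\<^sup>2 \<theta> = 4 cos\<^sup>2 (\<theta> / 2) sin\<^sup>2 (\<theta> / 2)\<close>.
\<close>

lemma norm_psi_sq:
  assumes "Q \<in> SO3"
  shows "(norm (psi Q))\<^sup>2 = 4 * cos2_half Q * (1 - cos2_half Q)"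
proof -
  have "(Q ** transpose Q) $ i $ i = 1" for i
    using SO3_mult_trans[OF assms] by (simp add: mat_def)
  from this[of 1] this[of 2] this[of 3]
  have "(Q$1$1)\<^sup>2 + (Q$1$2)\<^sup>2 + (Q$1$3)\<^sup>2 = 1" "(Q$2$1)\<^sup>2 + (Q$2$2)\<^sup>2 + (Q$2$3)\<^sup>2 = 1"
    "(Q$3$1)\<^sup>2 + (Q$3$2)\<^sup>2 + (Q$3$3)\<^sup>2 = 1"
    by (simp_all add: matrix3_simps power2_eq_square)
  moreover have "4 * ((norm (psi Q))\<^sup>2 - 4 * cos2_half Q * (1 - cos2_half Q))
     = ((Q$1$1)\<^sup>2 + (Q$1$2)\<^sup>2 + (Q$1$3)\<^sup>2) + ((Q$2$1)\<^sup>2 + (Q$2$2)\<^sup>2 + (Q$2$3)\<^sup>2)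
       + ((Q$3$1)\<^sup>2 + (Q$3$2)\<^sup>2 + (Q$3$3)\<^sup>2) - 3
       + 2 * ((Q$2$2*Q$3$3 - Q$2$3*Q$3$2 - Q$1$1) + (Q$1$1*Q$3$3 - Q$1$3*Q$3$1 - Q$2$2)
          + (Q$1$1*Q$2$2 - Q$1$2*Q$2$1 - Q$3$3))"
    unfolding power2_norm_eq_inner inner_vec_def psi_entries sum_3 trace_def cos2_half_def
    by (simp add: power2_eq_square field_simps)
  ultimately have "4 * ((norm (psi Q))\<^sup>2 - 4 * cos2_half Q * (1 - cos2_half Q)) = 0"
    unfolding SO3_entry_eq_cofactor(1,5,9)[OF assms, symmetric] by simp
  then show ?thesis by simp
qed

text \<open>
  Nonnegativity of \<open>|\<psi> (Q)|\<^sup>2\<close> says \<open>m (1 - m) \<ge> 0\<close>, which gives both bounds at once.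
\<close>

lemma cos2_half_bounds:
  assumes "Q \<in> SO3"
  shows "0 \<le> cos2_half Q" "cos2_half Q \<le> 1"
proof -
  have "0 \<le> cos2_half Q * (1 - cos2_half Q)"
    using norm_psi_sq[OF assms] zero_le_power2[of "norm (psi Q)"] by linarith
  then show "0 \<le> cos2_half Q" "cos2_half Q \<le> 1"
    by (auto simp: zero_le_mult_iff)
qed

lemma att_norm_sq: "Q \<in> SO3 \<Longrightarrow> (att_norm Q)\<^sup>2 = 1 - cos2_half Q"
  using cos2_half_bounds(2)[of Q]
  by (simp add: att_norm_def cos2_half_def trace_sub trace_I field_simps)

lemma Pi_set_iff: "Q \<in> Pi_set \<longleftrightarrow> Q \<in> SO3 \<and> cos2_half Q = 0"
proof -
  have "att_norm Q = 1 \<longleftrightarrow> (att_norm Q)\<^sup>2 = 1" if "Q \<in> SO3"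
    using cos2_half_bounds(2)[OF that]
    by (simp add: att_norm_def cos2_half_def trace_sub trace_I)
  then show ?thesis
    by (auto simp: Pi_set_def att_norm_sq)
qed

lemma cos2_half_pos: "Q \<in> SO3 \<Longrightarrow> Q \<notin> Pi_set \<Longrightarrow> 0 < cos2_half Q"
  using cos2_half_bounds(1)[of Q] by (auto simp: Pi_set_iff)

text \<open>
  By the formula for \<open>Q ** Q\<close>, multiplying \<open>[\<psi> (Q)]\<close> by \<open>Q + I\<close> gives \<open>2 m (Q - I)\<close>; so
  \<open>[\<psi> (Q) / (2 m)]\<close> is the Cayley transform of \<open>Q\<close>.
\<close>

lemma rodrigues_eq:
  assumes "Q \<in> SO3" "Q \<notin> Pi_set"
  shows "rodrigues Q = psi Q /\<^sub>R (2 * cos2_half Q)"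
proof -
  define m where "m = cos2_half Q"
  have m: "m > 0" using cos2_half_pos[OF assms] by (simp add: m_def)
  have tr: "trace Q = 4 * m - 1" by (simp add: m_def cos2_half_def add_divide_distrib)
  have "invertible (Q + mat 1)"
    using det_plus_id[OF assms(1)] m by (simp add: invertible_det_nz m_def)
  then have inv: "(Q + mat 1) ** matrix_inv (Q + mat 1) = mat 1"
    unfolding invertible_def matrix_inv_def by (metis (mono_tags, lifting) someI_ex)
  have "skew (psi Q) ** (Q + mat 1)
      = (1/2) *\<^sub>R (Q ** Q + Q - transpose Q ** Q - transpose Q)"
    by (simp add: skew_psi matrix_mult.scaleR_left matrix_mult.add_right matrix_mult.diff_left
        scaleR_add_right scaleR_diff_right)
  also have "\<dots> = (2 * m) *\<^sub>R (Q - mat 1)"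
    unfolding SO3_square[OF assms(1)] SO3_trans_mult[OF assms(1)] tr
    by (simp add: vec_eq_iff) (simp add: field_simps)
  finally have *: "Q - mat 1 = skew (psi Q /\<^sub>R (2 * m)) ** (Q + mat 1)"
    using m by (simp add: linear_cmul[OF linear_skew] matrix_mult.scaleR_left)
  show ?thesis
    unfolding rodrigues_def by (subst *) (simp add: vex_skew inv m_def flip: matrix_mul_assoc)
qed

lemma norm_rodrigues_sq:
  assumes "Q \<in> SO3" "Q \<notin> Pi_set"
  shows "1 + (norm (rodrigues Q))\<^sup>2 = 1 / cos2_half Q"
  using cos2_half_pos[OF assms] norm_psi_sq[OF assms(1)]
  by (simp add: rodrigues_eq[OF assms] power_mult_distrib) (simp add: field_simps power2_eq_square)

lemma innov_scaled_id:
  assumes "att_err R Rh t \<in> SO3" "att_err R Rh t \<notin> Pi_set"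
  shows "innov (a *\<^sub>R mat 1) R Rh wy t = - (2 * a) *\<^sub>R rodrigues (att_err R Rh t)"
  using cos2_half_pos[OF assms]
  by (simp add: innov_def att_norm_sq assms rodrigues_eq linear_cmul[OF linear_psi]
      matrix_mult.scaleR_left)

section \<open>Indefinite integrals: product rule and chain rule\<close>

lemma has_rate_on_integrable:
  "has_rate_on T x v \<Longrightarrow> v absolutely_integrable_on {0..T}"
  unfolding has_rate_on_def by blast

lemma has_rate_on_initial:
  "has_rate_on T x v \<Longrightarrow> t \<in> {0..T} \<Longrightarrow> x t = x 0 + integral {0..t} v"
  unfolding has_rate_on_def by blast

lemma has_rate_onI:
  "v absolutely_integrable_on {0..T} \<Longrightarrow> (\<And>t. t \<in> {0..T} \<Longrightarrow> x t = x 0 + integral {0..t} v)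
    \<Longrightarrow> has_rate_on T x v"
  unfolding has_rate_on_def by blast

lemma has_rate_on_cong:
  assumes "has_rate_on T x v" "\<And>t. t \<in> {0..T} \<Longrightarrow> y t = x t" "\<And>t. t \<in> {0..T} \<Longrightarrow> w t = v t"
  shows "has_rate_on T y w"
proof (rule has_rate_onI)
  show "w absolutely_integrable_on {0..T}"
    using has_rate_on_integrable[OF assms(1)]
    by (rule absolutely_integrable_spike[of _ _ "{}"]) (auto simp: assms(3))
  fix t assume t: "t \<in> {0..T}"
  then have "integral {0..t} w = integral {0..t} v"
    by (intro integral_cong) (auto intro: assms(3))
  moreover have "y 0 = x 0" using t by (intro assms(2)) auto
  ultimately show "y t = y 0 + integral {0..t} w"
    using has_rate_on_initial[OF assms(1) t] assms(2)[OF t] by simp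
qed

text \<open>
  A change of the rate at the final time is invisible. This is what upgrades causality of an
  innovation term (dependence on the past including the present) to strict causality of the map
  from disturbances to trajectories.
\<close>

lemma has_rate_on_cong_initial:
  assumes "has_rate_on T x v" "\<And>t. 0 \<le> t \<Longrightarrow> t < T \<Longrightarrow> w t = v t"
  shows "has_rate_on T x w"
proof (rule has_rate_onI)
  show "w absolutely_integrable_on {0..T}"
    using has_rate_on_integrable[OF assms(1)]
    by (rule absolutely_integrable_spike[of _ _ "{T}"]) (auto simp: assms(2))
  fix t assume t: "t \<in> {0..T}"
  then have "integral {0..t} w = integral {0..t} v"
    by (intro integral_spike[of "{T}"]) (auto intro!: assms(2)[symmetric])
  then show "x t = x 0 + integral {0..t} w"
    using has_rate_on_initial[OF assms(1) t] by simp
qed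

lemma has_rate_on_subinterval:
  assumes "has_rate_on T x v" "S \<le> T"
  shows "has_rate_on S x v"
proof (rule has_rate_onI)
  show "v absolutely_integrable_on {0..S}"
    using has_rate_on_integrable[OF assms(1)] assms(2)
    by (auto intro: absolutely_integrable_on_subinterval)
qed (use assms in \<open>auto intro: has_rate_on_initial\<close>)

lemma has_rate_on_const: "has_rate_on T (\<lambda>t. c) (\<lambda>t. 0)"
  by (rule has_rate_onI) auto

lemma has_rate_on_linear:
  fixes h :: "'a::euclidean_space \<Rightarrow> 'b::euclidean_space"
  assumes h: "bounded_linear h" and x: "has_rate_on T x v"
  shows "has_rate_on T (\<lambda>t. h (x t)) (\<lambda>t. h (v t))"
proof (rule has_rate_onI)
  interpret h: bounded_linear h by (rule h)
  show "(\<lambda>t. h (v t)) absolutely_integrable_on {0..T}"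
    using absolutely_integrable_linear[OF has_rate_on_integrable[OF x] h] by (simp add: o_def)
  fix t assume t: "t \<in> {0..T}"
  have "integral {0..t} (h \<circ> v) = h (integral {0..t} v)"
    using t has_rate_on_integrable[OF has_rate_on_subinterval[OF x, of t]]
    by (intro integral_linear h) (auto simp: absolutely_integrable_on_def)
  then show "h (x t) = h (x 0) + integral {0..t} (\<lambda>t. h (v t))"
    by (simp add: has_rate_on_initial[OF x t] o_def h.add)
qed

lemma has_rate_on_add:
  assumes "has_rate_on T x v" "has_rate_on T y w"
  shows "has_rate_on T (\<lambda>t. x t + y t) (\<lambda>t. v t + w t)"
proof (rule has_rate_onI)
  show "(\<lambda>t. v t + w t) absolutely_integrable_on {0..T}"
    using assms by (intro set_integral_add has_rate_on_integrable)
  fix t assume t: "t \<in> {0..T}"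
  have "integral {0..t} (\<lambda>s. v s + w s) = integral {0..t} v + integral {0..t} w"
    using t has_rate_on_integrable[OF has_rate_on_subinterval[OF assms(1), of t]]
      has_rate_on_integrable[OF has_rate_on_subinterval[OF assms(2), of t]]
    by (intro integral_add) (auto simp: absolutely_integrable_on_def)
  then show "x t + y t = x 0 + y 0 + integral {0..t} (\<lambda>t. v t + w t)"
    by (simp add: has_rate_on_initial[OF assms(1) t] has_rate_on_initial[OF assms(2) t])
qed

lemma integral_increment:
  fixes f :: "real \<Rightarrow> 'b::euclidean_space"
  assumes "f integrable_on {0..T}" "0 \<le> s" "s \<le> t" "t \<le> T"
  shows "integral {0..t} f - integral {0..s} f = integral {s..t} f"
proof -
  have "integral {0..s} f + integral {s..t} f = integral {0..t} f"
    using assms integrable_on_subinterval[OF assms(1), of 0 t]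
    by (intro Henstock_Kurzweil_Integration.integral_combine) auto
  then show ?thesis by (simp add: eq_diff_eq diff_eq_eq add.commute)
qed

lemma has_rate_on_increment:
  assumes "has_rate_on T x v" "0 \<le> s" "s \<le> t" "t \<le> T"
  shows "x t - x s = integral {s..t} v"
proof -
  have "v integrable_on {0..T}"
    using has_rate_on_integrable[OF assms(1)] by (simp add: absolutely_integrable_on_def)
  note integral_increment[OF this assms(2-4)]
  moreover have "x t = x 0 + integral {0..t} v" "x s = x 0 + integral {0..s} v"
    using assms by (auto intro!: has_rate_on_initial[OF assms(1)])
  ultimately show ?thesis by simp
qed

lemma has_rate_on_continuous:
  assumes "has_rate_on T x v"
  shows "continuous_on {0..T} x"
proof -
  have "continuous_on {0..T} (\<lambda>t. x 0 + integral {0..t} v)"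
    using has_rate_on_integrable[OF assms]
    by (intro continuous_intros indefinite_integral_continuous_1) (simp add: absolutely_integrable_on_def)
  then show ?thesis
    by (subst continuous_on_cong[OF refl has_rate_on_initial[OF assms]]) auto
qed

lemma absolutely_integrable_bilinear_continuous:
  fixes h :: "'a::euclidean_space \<Rightarrow> 'b::euclidean_space \<Rightarrow> 'c::euclidean_space"
  assumes h: "bounded_bilinear h" and x: "continuous_on {0..T::real} x"
    and v: "v absolutely_integrable_on {0..T}"
  shows "(\<lambda>t. h (x t) (v t)) absolutely_integrable_on {0..T}"
proof (rule absolutely_integrable_bounded_measurable_product[where h = h and f = x and g = v])
  show "bilinear h" using h by (simp add: bilinear_conv_bounded_bilinear)
  show "x \<in> borel_measurable (lebesgue_on {0..T})"
    using x by (rule continuous_imp_measurable_on_sets_lebesgue) auto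
  show "bounded (x ` {0..T})"
    using x by (intro compact_imp_bounded compact_continuous_image) auto
qed (use v in auto)

text \<open>
  A calculus without derivatives: a function whose increments over short intervals are
  arbitrarily small relative to those of some fixed function is constant, as summing over a
  fine partition shows. Applied with \<open>A\<close> the integral of the norms of the rates, it replaces
  almost-everywhere differentiability of absolutely continuous functions.
\<close>

lemma eq_initial_if_small_increments:
  fixes D :: "real \<Rightarrow> 'b::real_normed_vector" and A :: "real \<Rightarrow> real"
  assumes small: "\<And>\<epsilon>. 0 < \<epsilon> \<Longrightarrow> \<exists>\<delta>>0. \<forall>s t. 0 \<le> s \<longrightarrow> s \<le> t \<longrightarrow> t \<le> T \<longrightarrow> t - s < \<delta> \<longrightarrow>
        norm (D t - D s) \<le> \<epsilon> * (A t - A s)"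
    and t: "t \<in> {0..T}"
  shows "D t = D 0"
proof -
  have *: "norm (D t - D 0) \<le> \<epsilon> * (A t - A 0)" if e: "\<epsilon> > 0" for \<epsilon>
  proof -
    obtain \<delta> where \<delta>: "\<delta> > 0" "\<And>s t. \<lbrakk>0 \<le> s; s \<le> t; t \<le> T; t - s < \<delta>\<rbrakk> \<Longrightarrow>
        norm (D t - D s) \<le> \<epsilon> * (A t - A s)"
      using small[OF e] by blast
    have "\<exists>n. (0::nat) < n \<and> t / real n < \<delta>"
    proof -
      obtain n :: nat where "t / \<delta> < n" using reals_Archimedean2 by blast
      then have "t < real n * \<delta>" using \<delta>(1) by (simp add: field_simps)
      also have "\<dots> \<le> real (Suc n) * \<delta>" using \<delta>(1) by simp
      finally have "t / real (Suc n) < \<delta>"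
        by (simp add: divide_less_eq mult.commute del: of_nat_Suc)
      then show ?thesis by (intro exI[of _ "Suc n"]) simp
    qed
    then obtain n :: nat where n: "n > 0" "t / n < \<delta>" by blast
    have "norm (D (real k * (t / n)) - D 0) \<le> \<epsilon> * (A (real k * (t / n)) - A 0)" if "k \<le> n" for k
      using that
    proof (induction k)
      case (Suc k)
      let ?s = "real k * (t / n)" and ?t = "real (Suc k) * (t / n)"
      have "real (Suc k) * t \<le> real n * t"
        using Suc.prems t by (intro mult_right_mono) auto
      then have "?t \<le> t" using n by (simp add: field_simps)
      moreover have d: "?t - ?s = t / n" by (simp add: distrib_right add_divide_distrib)
      moreover have "t / n \<ge> 0" "?s \<ge> 0" "t \<le> T" using t by auto
      ultimately have "norm (D ?t - D ?s) \<le> \<epsilon> * (A ?t - A ?s)"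
        using n by (intro \<delta>(2)) linarith+
      moreover have "norm (D ?s - D 0) \<le> \<epsilon> * (A ?s - A 0)"
        using Suc by simp
      moreover have "norm (D ?t - D 0) \<le> norm (D ?t - D ?s) + norm (D ?s - D 0)"
        using norm_triangle_ineq[of "D ?t - D ?s" "D ?s - D 0"] by simp
      moreover have "\<epsilon> * (A ?t - A ?s) + \<epsilon> * (A ?s - A 0) = \<epsilon> * (A ?t - A 0)"
        by (simp add: right_diff_distrib)
      ultimately show ?case by linarith
    qed simp
    from this[of n] show ?thesis using n by simp
  qed
  have "norm (D t - D 0) \<le> 0 + e" if "e > 0" for e
  proof (cases "A t - A 0 > 0")
    case True
    then show ?thesis using *[of "e / (A t - A 0)"] that by simp
  next
    case False
    then show ?thesis using *[of 1] that by simp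
  qed
  then have "norm (D t - D 0) \<le> 0" by (rule field_le_epsilon)
  then show ?thesis by simp
qed

lemma uniform_modulus:
  fixes x :: "real \<Rightarrow> 'a::metric_space"
  assumes "continuous_on {0..T} x" "0 < \<epsilon>"
  obtains \<delta> where "\<delta> > 0"
    "\<And>s t. \<lbrakk>0 \<le> s; s \<le> T; 0 \<le> t; t \<le> T; \<bar>t - s\<bar> < \<delta>\<rbrakk> \<Longrightarrow> dist (x t) (x s) < \<epsilon>"
proof -
  have "uniformly_continuous_on {0..T} x"
    using assms(1) by (rule compact_uniformly_continuous) auto
  then show thesis
    using assms(2) that unfolding uniformly_continuous_on_def
    by (metis atLeastAtMost_iff dist_real_def)
qed

text \<open>
  On a short interval \<open>x\<close> and \<open>y\<close> are almost constant, so the increment of the product differs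
  from the integral of the claimed rate by a small multiple of \<open>\<integral> |v| + |w|\<close>.
\<close>

lemma has_rate_on_bilinear:
  fixes h :: "'a::euclidean_space \<Rightarrow> 'b::euclidean_space \<Rightarrow> 'c::euclidean_space"
  assumes h: "bounded_bilinear h" and x: "has_rate_on T x v" and y: "has_rate_on T y w"
  shows "has_rate_on T (\<lambda>t. h (x t) (y t)) (\<lambda>t. h (v t) (y t) + h (x t) (w t))"
proof -
  interpret h: bounded_bilinear h by (rule h)
  obtain K where K: "K > 0" "\<And>a b. norm (h a b) \<le> norm a * norm b * K"
    using h.pos_bounded by blast
  let ?r = "\<lambda>t. h (v t) (y t) + h (x t) (w t)"
  note cx = has_rate_on_continuous[OF x] and cy = has_rate_on_continuous[OF y]
  note iv = has_rate_on_integrable[OF x] and iw = has_rate_on_integrable[OF y]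
  have i1: "(\<lambda>t. h (v t) (y t)) absolutely_integrable_on {0..T}"
    using absolutely_integrable_bilinear_continuous[OF h.flip cy iv] by simp
  have i2: "(\<lambda>t. h (x t) (w t)) absolutely_integrable_on {0..T}"
    using absolutely_integrable_bilinear_continuous[OF h cx iw] .
  have ir: "?r absolutely_integrable_on {0..T}"
    using i1 i2 by (rule set_integral_add)
  let ?D = "\<lambda>t. h (x t) (y t) - integral {0..t} ?r"
  let ?A = "\<lambda>t. integral {0..t} (\<lambda>s. norm (v s) + norm (w s))"
  have ia: "(\<lambda>s. norm (v s) + norm (w s)) integrable_on {0..T}"
    using iv iw by (auto simp: absolutely_integrable_on_def intro: integrable_add)
  have "?D t = ?D 0" if "t \<in> {0..T}" for t
  proof (rule eq_initial_if_small_increments[where A = ?A, OF _ that])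
    fix \<epsilon> :: real assume "\<epsilon> > 0"
    then have "\<epsilon> / K > 0" using K by simp
    obtain \<delta>1 where \<delta>1: "\<delta>1 > 0"
      "\<And>s t. \<lbrakk>0 \<le> s; s \<le> T; 0 \<le> t; t \<le> T; \<bar>t - s\<bar> < \<delta>1\<rbrakk> \<Longrightarrow> dist (x t) (x s) < \<epsilon> / K"
      using uniform_modulus[OF cx \<open>\<epsilon> / K > 0\<close>] by blast
    obtain \<delta>2 where \<delta>2: "\<delta>2 > 0"
      "\<And>s t. \<lbrakk>0 \<le> s; s \<le> T; 0 \<le> t; t \<le> T; \<bar>t - s\<bar> < \<delta>2\<rbrakk> \<Longrightarrow> dist (y t) (y s) < \<epsilon> / K"
      using uniform_modulus[OF cy \<open>\<epsilon> / K > 0\<close>] by blast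
    show "\<exists>\<delta>>0. \<forall>s t. 0 \<le> s \<longrightarrow> s \<le> t \<longrightarrow> t \<le> T \<longrightarrow> t - s < \<delta> \<longrightarrow>
        norm (?D t - ?D s) \<le> \<epsilon> * (?A t - ?A s)"
    proof (intro exI[of _ "min \<delta>1 \<delta>2"] conjI allI impI)
      fix s t assume st: "0 \<le> s" "s \<le> t" "t \<le> T" "t - s < min \<delta>1 \<delta>2"
      then have sub: "{s..t} \<subseteq> {0..T}" by auto
      have int: "f integrable_on {s..t}" if "f absolutely_integrable_on {0..T}" for f :: "real \<Rightarrow> 'd::euclidean_space"
        using absolutely_integrable_on_subinterval[OF that sub] by (simp add: absolutely_integrable_on_def)
      have bl: "integral {s..t} (\<lambda>r. h (v r) (y t)) = h (integral {s..t} v) (y t)"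
        using integral_linear[OF int[OF iv] h.bounded_linear_left[of "y t"]] by (simp add: o_def)
      have br: "integral {s..t} (\<lambda>r. h (x s) (w r)) = h (x s) (integral {s..t} w)"
        using integral_linear[OF int[OF iw] h.bounded_linear_right[of "x s"]] by (simp add: o_def)
      have il: "(\<lambda>r. h (v r) (y t)) integrable_on {s..t}"
        using integrable_linear[OF int[OF iv] h.bounded_linear_left[of "y t"]] by (simp add: o_def)
      have irr: "(\<lambda>r. h (x s) (w r)) integrable_on {s..t}"
        using integrable_linear[OF int[OF iw] h.bounded_linear_right[of "x s"]] by (simp add: o_def)
      have "h (x t) (y t) - h (x s) (y s) = h (x t - x s) (y t) + h (x s) (y t - y s)"
        by (simp add: h.diff_left h.diff_right)
      also have "\<dots> = integral {s..t} (\<lambda>r. h (v r) (y t) + h (x s) (w r))"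
        using st by (simp add: has_rate_on_increment[OF x] has_rate_on_increment[OF y] bl br
            integral_add[OF il irr])
      finally have inc: "h (x t) (y t) - h (x s) (y s)
          = integral {s..t} (\<lambda>r. h (v r) (y t) + h (x s) (w r))" .
      have "?D t - ?D s = (h (x t) (y t) - h (x s) (y s)) - (integral {0..t} ?r - integral {0..s} ?r)"
        by simp
      also have "\<dots> = integral {s..t} (\<lambda>r. h (v r) (y t) + h (x s) (w r)) - integral {s..t} ?r"
        unfolding inc
        using integral_increment[of ?r, OF _ st(1-3)] ir
        by (simp add: absolutely_integrable_on_def)
      also have "\<dots> = integral {s..t} (\<lambda>r. (h (v r) (y t) + h (x s) (w r)) - ?r r)"
        by (rule integral_diff[OF integrable_add[OF il irr] int[OF ir], symmetric])
      also have "norm \<dots> \<le> integral {s..t} (\<lambda>r. \<epsilon> * (norm (v r) + norm (w r)))"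
      proof (rule integral_norm_bound_integral)
        show "(\<lambda>r. (h (v r) (y t) + h (x s) (w r)) - ?r r) integrable_on {s..t}"
          by (rule integrable_diff[OF integrable_add[OF il irr] int[OF ir]])
        show "(\<lambda>r. \<epsilon> * (norm (v r) + norm (w r))) integrable_on {s..t}"
          using integrable_on_subinterval[OF ia sub] by (intro integrable_on_mult_right)
        fix r assume r: "r \<in> {s..t}"
        have e: "(h (v r) (y t) + h (x s) (w r)) - ?r r = h (v r) (y t - y r) + h (x s - x r) (w r)"
          by (simp add: h.diff_left h.diff_right)
        have "norm (h (v r) (y t - y r)) \<le> norm (v r) * norm (y t - y r) * K" by (rule K)
        also have "\<dots> \<le> norm (v r) * (\<epsilon> / K) * K"
          using less_imp_le[OF \<delta>2(2)[of r t]] r st K(1)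
          by (intro mult_right_mono mult_left_mono) (simp_all add: dist_norm)
        finally have a: "norm (h (v r) (y t - y r)) \<le> \<epsilon> * norm (v r)"
          using K(1) by (simp add: mult.commute)
        have "norm (h (x s - x r) (w r)) \<le> norm (x s - x r) * norm (w r) * K" by (rule K)
        also have "\<dots> \<le> (\<epsilon> / K) * norm (w r) * K"
          using less_imp_le[OF \<delta>1(2)[of r s]] r st K(1)
          by (intro mult_right_mono) (simp_all add: dist_norm)
        finally have b: "norm (h (x s - x r) (w r)) \<le> \<epsilon> * norm (w r)"
          using K(1) by simp
        show "norm ((h (v r) (y t) + h (x s) (w r)) - ?r r) \<le> \<epsilon> * (norm (v r) + norm (w r))"
          unfolding e using norm_triangle_ineq[of "h (v r) (y t - y r)" "h (x s - x r) (w r)"] a b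
          by (simp add: algebra_simps)
      qed
      also have "\<dots> = \<epsilon> * (?A t - ?A s)"
        using integral_increment[OF ia st(1-3)] by simp
      finally show "norm (?D t - ?D s) \<le> \<epsilon> * (?A t - ?A s)" .
    qed (use \<delta>1 \<delta>2 in auto)
  qed
  note const = this
  show ?thesis
  proof (rule has_rate_onI[OF ir])
    fix t assume "t \<in> {0..T}"
    from const[OF this] show "h (x t) (y t) = h (x 0) (y 0) + integral {0..t} ?r"
      by (simp only: diff_eq_eq) simp
  qed
qed

text \<open>
  As for products, with the mean value theorem providing the increment of \<open>f\<close>.
\<close>

lemma has_rate_on_chain:
  fixes x :: "real \<Rightarrow> real"
  assumes x: "has_rate_on T x v"
    and f: "\<And>u. (f has_real_derivative f' u) (at u)" and f': "continuous_on UNIV f'"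
  shows "has_rate_on T (\<lambda>t. f (x t)) (\<lambda>t. f' (x t) * v t)"
proof -
  let ?r = "\<lambda>t. f' (x t) * v t"
  note cx = has_rate_on_continuous[OF x] and iv = has_rate_on_integrable[OF x]
  have cf: "continuous_on {0..T} (\<lambda>t. f' (x t))"
    using continuous_on_compose2[OF f' cx] by simp
  have ir: "?r absolutely_integrable_on {0..T}"
    by (rule absolutely_integrable_bilinear_continuous[OF bounded_bilinear_mult cf iv])
  let ?D = "\<lambda>t. f (x t) - integral {0..t} ?r"
  let ?A = "\<lambda>t. integral {0..t} (\<lambda>s. \<bar>v s\<bar>)"
  have ia: "(\<lambda>s. \<bar>v s\<bar>) integrable_on {0..T}"
    using iv by (auto simp: absolutely_integrable_on_def)
  have "?D t = ?D 0" if "t \<in> {0..T}" for t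
  proof (rule eq_initial_if_small_increments[where A = ?A, OF _ that])
    fix \<epsilon> :: real assume "\<epsilon> > 0"
    obtain \<delta> where \<delta>: "\<delta> > 0"
      "\<And>s t. \<lbrakk>0 \<le> s; s \<le> T; 0 \<le> t; t \<le> T; \<bar>t - s\<bar> < \<delta>\<rbrakk> \<Longrightarrow> dist (f' (x t)) (f' (x s)) < \<epsilon>"
      using uniform_modulus[OF cf \<open>\<epsilon> > 0\<close>] by blast
    show "\<exists>\<delta>>0. \<forall>s t. 0 \<le> s \<longrightarrow> s \<le> t \<longrightarrow> t \<le> T \<longrightarrow> t - s < \<delta> \<longrightarrow>
        norm (?D t - ?D s) \<le> \<epsilon> * (?A t - ?A s)"
    proof (intro exI[of _ \<delta>] conjI allI impI)
      fix s t assume st: "0 \<le> s" "s \<le> t" "t \<le> T" "t - s < \<delta>"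
      then have sub: "{s..t} \<subseteq> {0..T}" by auto
      have int: "g integrable_on {s..t}" if "g absolutely_integrable_on {0..T}" for g :: "real \<Rightarrow> real"
        using absolutely_integrable_on_subinterval[OF that sub] by (simp add: absolutely_integrable_on_def)
      \<comment> \<open>The intermediate point of the mean value theorem is itself a value of \<open>x\<close> on \<open>{s..t}\<close>.\<close>
      have "\<exists>c\<in>{s..t}. f (x t) - f (x s) = f' (x c) * (x t - x s)"
      proof (cases "x s = x t")
        case True
        then show ?thesis using st by (intro bexI[of _ s]) auto
      next
        case False
        have "\<exists>z. z \<in> closed_segment (x s) (x t) \<and> f (x t) - f (x s) = f' z * (x t - x s)"
        proof (cases "x s < x t")
          case True
          then obtain z where "x s < z" "z < x t" "f (x t) - f (x s) = (x t - x s) * f' z"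
            using MVT2[of "x s" "x t" f f'] f by blast
          then show ?thesis
            by (intro exI[of _ z]) (auto simp: closed_segment_eq_real_ivl)
        next
          case False
          then have "x t < x s" using \<open>x s \<noteq> x t\<close> by simp
          then obtain z where "x t < z" "z < x s" "f (x s) - f (x t) = (x s - x t) * f' z"
            using MVT2[of "x t" "x s" f f'] f by blast
          then show ?thesis
            by (intro exI[of _ z]) (auto simp: closed_segment_eq_real_ivl algebra_simps)
        qed
        then obtain z where z: "z \<in> closed_segment (x s) (x t)"
          "f (x t) - f (x s) = f' z * (x t - x s)" by blast
        have "connected (x ` {s..t})"
          using continuous_on_subset[OF cx sub] by (intro connected_continuous_image) auto
        then have "closed_segment (x s) (x t) \<subseteq> x ` {s..t}"
          using st by (intro closed_segment_subset) (auto simp flip: is_interval_convex_1 simp: is_interval_connected_1)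
        then show ?thesis using z by auto
      qed
      then obtain c where c: "c \<in> {s..t}" "f (x t) - f (x s) = f' (x c) * (x t - x s)" by blast
      have "f' (x c) * (x t - x s) = integral {s..t} (\<lambda>r. f' (x c) * v r)"
        using st by (simp add: has_rate_on_increment[OF x])
      then have inc: "f (x t) - f (x s) = integral {s..t} (\<lambda>r. f' (x c) * v r)"
        using c by simp
      have "?D t - ?D s = (f (x t) - f (x s)) - (integral {0..t} ?r - integral {0..s} ?r)"
        by simp
      also have "\<dots> = integral {s..t} (\<lambda>r. f' (x c) * v r) - integral {s..t} ?r"
        unfolding inc using integral_increment[of ?r, OF _ st(1-3)] ir
        by (simp add: absolutely_integrable_on_def)
      also have "\<dots> = integral {s..t} (\<lambda>r. f' (x c) * v r - ?r r)"
        by (rule integral_diff[OF integrable_on_mult_right[OF int[OF iv]] int[OF ir], symmetric])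
      also have "norm \<dots> \<le> integral {s..t} (\<lambda>r. \<epsilon> * \<bar>v r\<bar>)"
      proof (rule integral_norm_bound_integral)
        show "(\<lambda>r. f' (x c) * v r - ?r r) integrable_on {s..t}"
          by (rule integrable_diff[OF integrable_on_mult_right[OF int[OF iv]] int[OF ir]])
        show "(\<lambda>r. \<epsilon> * \<bar>v r\<bar>) integrable_on {s..t}"
          using integrable_on_subinterval[OF ia sub] by (intro integrable_on_mult_right)
        fix r assume r: "r \<in> {s..t}"
        have "\<bar>c - r\<bar> < \<delta>" using r c(1) st by auto
        then have "\<bar>f' (x c) - f' (x r)\<bar> \<le> \<epsilon>"
          using \<delta>(2)[of r c] r c(1) st by (auto simp: dist_real_def)
        then show "norm (f' (x c) * v r - ?r r) \<le> \<epsilon> * \<bar>v r\<bar>"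
          by (simp add: abs_mult mult_right_mono flip: left_diff_distrib)
      qed
      also have "\<dots> = \<epsilon> * (?A t - ?A s)"
        using integral_increment[OF ia st(1-3)] by simp
      finally show "norm (?D t - ?D s) \<le> \<epsilon> * (?A t - ?A s)" .
    qed (use \<delta> in auto)
  qed
  note const = this
  show ?thesis
  proof (rule has_rate_onI[OF ir])
    fix t assume "t \<in> {0..T}"
    from const[OF this] show "f (x t) = f (x 0) + integral {0..t} ?r"
      by simp
  qed
qed

section \<open>Differential equations in the sense of Caratheodory\<close>

text \<open>
  With \<open>U\<close> the integral of \<open>u\<close>, the function \<open>exp (- K t) U (t)\<close> is nonincreasing, and it starts at \<open>0\<close>.
\<close>

lemma gronwall_nonpos:
  fixes u :: "real \<Rightarrow> real"
  assumes u: "continuous_on {0..T} u" and K: "K \<ge> 0"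
    and le: "\<And>t. t \<in> {0..T} \<Longrightarrow> u t \<le> K * integral {0..t} u" and t: "t \<in> {0..T}"
  shows "u t \<le> 0"
proof -
  let ?U = "\<lambda>t. integral {0..t} u"
  let ?E = "\<lambda>t. exp (- K * t) * ?U t"
  have dU: "(?U has_vector_derivative u s) (at s within {0..T})" if "s \<in> {0..T}" for s
    using integral_has_vector_derivative[OF u that] .
  have "?E t \<le> ?E 0"
  proof (rule DERIV_nonpos_imp_decreasing_open[of 0 t ?E])
    show "continuous_on {0..t} ?E"
    proof -
      have "u integrable_on {0..T}" using u by (rule integrable_continuous_real)
      then have "continuous_on {0..T} ?U" by (rule indefinite_integral_continuous_1)
      then have "continuous_on {0..t} ?U" using t by (auto elim: continuous_on_subset)
      then show ?thesis by (intro continuous_intros)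
    qed
    fix s assume s: "0 < s" "s < t"
    then have "(?U has_vector_derivative u s) (at s)"
      using dU[of s] t at_within_interior[of s "{0..T}"] by (auto simp: interior_atLeastAtMost_real)
    then have "(?U has_real_derivative u s) (at s)"
      by (simp add: has_real_derivative_iff_has_vector_derivative)
    then have "(?E has_real_derivative exp (- K * s) * (u s - K * ?U s)) (at s)"
      by (auto intro!: derivative_eq_intros simp: algebra_simps)
    moreover have "exp (- K * s) * (u s - K * ?U s) \<le> 0"
      using le[of s] s t by (intro mult_nonneg_nonpos) auto
    ultimately show "\<exists>y. DERIV ?E s :> y \<and> y \<le> 0" by blast
  qed (use t in auto)
  then have "?U t \<le> 0" by (simp add: mult_le_0_iff)
  then have "K * ?U t \<le> 0" using K by (rule mult_nonneg_nonpos[rotated])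
  then show ?thesis using le[OF t] by linarith
qed

text \<open>
  The Lipschitz estimate is only asked along the two given curves, so vector fields with
  singularities are covered as long as the curves stay away from them.
\<close>

lemma has_rate_on_unique:
  fixes x y :: "real \<Rightarrow> 'a::euclidean_space"
  assumes x: "has_rate_on T x v" and y: "has_rate_on T y w" and "x 0 = y 0" and K: "K \<ge> 0"
    and lip: "\<And>t. t \<in> {0..T} \<Longrightarrow> norm (v t - w t) \<le> K * norm (x t - y t)"
    and t: "t \<in> {0..T}"
  shows "x t = y t"
proof -
  let ?u = "\<lambda>t. norm (x t - y t)"
  note c = has_rate_on_continuous[OF x] has_rate_on_continuous[OF y]
  have u: "continuous_on {0..T} ?u"
    using c by (intro continuous_intros)
  have "?u t \<le> 0"
  proof (rule gronwall_nonpos[OF u K _ t])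
    fix s assume s: "s \<in> {0..T}"
    have i: "v integrable_on {0..s}" "w integrable_on {0..s}"
      using s has_rate_on_integrable[OF has_rate_on_subinterval[OF x, of s]]
        has_rate_on_integrable[OF has_rate_on_subinterval[OF y, of s]]
      by (auto simp: absolutely_integrable_on_def)
    have us: "?u integrable_on {0..s}"
      using s by (intro integrable_continuous_real continuous_on_subset[OF u]) auto
    have "x s - y s = integral {0..s} (\<lambda>r. v r - w r)"
      using has_rate_on_initial[OF x s] has_rate_on_initial[OF y s] \<open>x 0 = y 0\<close> integral_diff[OF i]
      by simp
    also have "norm \<dots> \<le> integral {0..s} (\<lambda>r. K * ?u r)"
      using s us by (intro integral_norm_bound_integral integrable_diff i integrable_on_mult_right lip) auto
    finally show "?u s \<le> K * integral {0..s} ?u" by simp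
  qed
  then show ?thesis by simp
qed

text \<open>
  Picard iteration; consecutive iterates differ by at most \<open>C (K t)^n / n!\<close>, so they converge
  uniformly on the whole of \<open>{0..T}\<close> and no gluing of short solutions is needed.
\<close>

lemma picard_lindelof_caratheodory:
  fixes f :: "real \<Rightarrow> 'a::euclidean_space \<Rightarrow> 'a"
  assumes T: "T \<ge> 0" and K: "K \<ge> 0"
    and lip: "\<And>t a b. t \<in> {0..T} \<Longrightarrow> norm (f t a - f t b) \<le> K * norm (a - b)"
    and int: "\<And>x. continuous_on {0..T} x \<Longrightarrow> (\<lambda>t. f t (x t)) absolutely_integrable_on {0..T}"
  obtains x where "x 0 = x0" "has_rate_on T x (\<lambda>t. f t (x t))"
proof -
  define \<Phi> where "\<Phi> x t = x0 + integral {0..t} (\<lambda>s. f s (x s))" for x t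
  define X where "X n = (\<Phi> ^^ n) (\<lambda>_. x0)" for n
  have X_Suc: "X (Suc n) = \<Phi> (X n)" for n by (simp add: X_def)
  have int': "(\<lambda>s. f s (x s)) integrable_on {0..t}" if "continuous_on {0..T} x" "t \<in> {0..T}" for x t
    using absolutely_integrable_on_subinterval[OF int[OF that(1)], of 0 t] that(2)
    by (auto simp: absolutely_integrable_on_def)
  have cX: "continuous_on {0..T} (X n)" for n
  proof (induction n)
    case (Suc n)
    then show ?case
      unfolding X_Suc \<Phi>_def using int'[OF Suc, of T] T
      by (intro continuous_intros indefinite_integral_continuous_1) auto
  qed (simp add: X_def)
  have \<Phi>_diff: "norm (\<Phi> x t - \<Phi> y t) \<le> integral {0..t} (\<lambda>s. K * b s)"
    if "continuous_on {0..T} x" "continuous_on {0..T} y" "t \<in> {0..T}" "b integrable_on {0..t}"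
      and b: "\<And>s. s \<in> {0..t} \<Longrightarrow> norm (x s - y s) \<le> b s" for x y t b
  proof -
    have "\<Phi> x t - \<Phi> y t = integral {0..t} (\<lambda>s. f s (x s) - f s (y s))"
      using that by (simp add: \<Phi>_def integral_diff int')
    also have "norm \<dots> \<le> integral {0..t} (\<lambda>s. K * b s)"
    proof (rule integral_norm_bound_integral)
      show "norm (f s (x s) - f s (y s)) \<le> K * b s" if s: "s \<in> {0..t}" for s
      proof -
        have "norm (f s (x s) - f s (y s)) \<le> K * norm (x s - y s)"
          using s \<open>t \<in> {0..T}\<close> by (intro lip) auto
        also have "\<dots> \<le> K * b s"
          using K b[OF s] by (rule mult_left_mono[rotated])
        finally show ?thesis .
      qed
    qed (use that in \<open>auto intro!: integrable_diff int' integrable_on_mult_right\<close>)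
    finally show ?thesis .
  qed
  have "bounded ((\<lambda>t. norm (X 1 t - X 0 t)) ` {0..T})"
    using cX by (intro compact_imp_bounded compact_continuous_image continuous_intros) auto
  then obtain C where "\<forall>t\<in>{0..T}. norm (X 1 t - X 0 t) \<le> C"
    by (auto simp: bounded_iff)
  then have C: "norm (X 1 t - X 0 t) \<le> C" if "t \<in> {0..T}" for t
    using that by blast
  have bound: "norm (X (Suc n) t - X n t) \<le> C * (K ^ n * t ^ n / fact n)" if "t \<in> {0..T}" for n t
    using that
  proof (induction n arbitrary: t)
    case 0
    then show ?case using C[OF 0] by simp
  next
    case (Suc n)
    have I: "((\<lambda>s. C * (K ^ n * s ^ n / fact n)) has_integral
        C * (K ^ n * t ^ Suc n / fact (Suc n)) - C * (K ^ n * 0 ^ Suc n / fact (Suc n))) {0..t}"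
    proof (rule fundamental_theorem_of_calculus)
      fix s
      have "((\<lambda>s. (C * K ^ n / fact (Suc n)) * s ^ Suc n) has_real_derivative
          (C * K ^ n / fact (Suc n)) * (real (Suc n) * s ^ n)) (at s within {0..t})"
        by (rule DERIV_cmult, rule DERIV_cong[OF DERIV_power[OF DERIV_ident]]) (simp del: power_Suc)
      moreover have "(C * K ^ n / fact (Suc n)) * (real (Suc n) * s ^ n) = C * (K ^ n * s ^ n / fact n)"
        by (simp add: fact_Suc)
      ultimately show "((\<lambda>s. C * (K ^ n * s ^ Suc n / fact (Suc n))) has_vector_derivative
          C * (K ^ n * s ^ n / fact n)) (at s within {0..t})"
        unfolding has_real_derivative_iff_has_vector_derivative[symmetric] by (simp add: mult.assoc)
    qed (use Suc.prems in auto)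
    have "norm (\<Phi> (X (Suc n)) t - \<Phi> (X n) t) \<le> integral {0..t} (\<lambda>s. K * (C * (K ^ n * s ^ n / fact n)))"
    proof (rule \<Phi>_diff[OF cX cX Suc.prems has_integral_integrable[OF I]])
      fix s assume "s \<in> {0..t}"
      then show "norm (X (Suc n) s - X n s) \<le> C * (K ^ n * s ^ n / fact n)"
        using Suc.prems by (intro Suc.IH) simp
    qed
    also have "\<dots> = C * (K ^ Suc n * t ^ Suc n / fact (Suc n))"
      using integral_unique[OF has_integral_mult_right[OF I, of K]] by (simp add: mult_ac)
    finally show ?case unfolding X_Suc[symmetric] .
  qed
  have C0: "C \<ge> 0" using order_trans[OF norm_ge_zero C[of 0]] T by simp
  have "uniform_limit {0..T} (\<lambda>n t. \<Sum>i<n. X (Suc i) t - X i t) (\<lambda>t. suminf (\<lambda>i. X (Suc i) t - X i t)) sequentially"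
  proof (rule Weierstrass_m_test)
    show "norm (X (Suc n) t - X n t) \<le> C * ((K * T) ^ n / fact n)" if "t \<in> {0..T}" for n t
    proof -
      have "norm (X (Suc n) t - X n t) \<le> C * (K ^ n * t ^ n / fact n)" by (rule bound[OF that])
      also have "\<dots> \<le> C * (K ^ n * T ^ n / fact n)"
        using that K C0 by (intro mult_left_mono divide_right_mono power_mono) auto
      finally show ?thesis by (simp add: power_mult_distrib)
    qed
    show "summable (\<lambda>n. C * ((K * T) ^ n / fact n))"
      using summable_exp[of "K * T"] by (intro summable_mult) (simp only: divide_inverse mult.commute)
  qed
  moreover have "(\<Sum>i<n. X (Suc i) t - X i t) = X n t - x0" for n t
    using sum_lessThan_telescope[of "\<lambda>i. X i t" n] by (simp add: X_def)
  ultimately have "uniform_limit {0..T} (\<lambda>n t. X n t - x0) (\<lambda>t. suminf (\<lambda>i. X (Suc i) t - X i t)) sequentially"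
    by simp
  note lim = uniform_limit_add[OF this uniform_limit_const[where c = "\<lambda>t. x0"]]
  define x where "x t = suminf (\<lambda>i. X (Suc i) t - X i t) + x0" for t
  have x: "uniform_limit {0..T} X x sequentially"
    using lim by (simp add: x_def[abs_def])
  have cx: "continuous_on {0..T} x"
    using cX by (intro uniform_limit_theorem[OF _ x]) auto
  have fixp: "x t = \<Phi> x t" if t: "t \<in> {0..T}" for t
  proof -
    have "(\<lambda>n. X (Suc n) t) \<longlonglongrightarrow> x t"
      using tendsto_uniform_limitI[OF x t] by (rule LIMSEQ_Suc)
    moreover have "(\<lambda>n. X (Suc n) t) \<longlonglongrightarrow> \<Phi> x t"
    proof (rule metric_LIMSEQ_I)
      fix e :: real assume "e > 0"
      then have e': "e / (K * T + 1) > 0" using K T by (simp add: add_nonneg_pos)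
      obtain N where N: "\<And>n s. n \<ge> N \<Longrightarrow> s \<in> {0..T} \<Longrightarrow> dist (X n s) (x s) < e / (K * T + 1)"
        using uniform_limitD[OF x e'] unfolding eventually_sequentially by blast
      show "\<exists>N. \<forall>n\<ge>N. dist (X (Suc n) t) (\<Phi> x t) < e"
      proof (intro exI[of _ N] allI impI)
        fix n assume "n \<ge> N"
        have "norm (\<Phi> (X n) t - \<Phi> x t) \<le> integral {0..t} (\<lambda>s. K * (e / (K * T + 1)))"
          using t less_imp_le[OF N[OF \<open>n \<ge> N\<close>]] by (intro \<Phi>_diff cX cx) (auto simp: dist_norm)
        also have "\<dots> = (K * t) * (e / (K * T + 1))"
          using t by simp
        also have "\<dots> \<le> (K * T) * (e / (K * T + 1))"
          using t K e' by (intro mult_right_mono mult_left_mono) auto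
        also have "\<dots> < e"
          using \<open>e > 0\<close> mult_nonneg_nonneg[OF K T] by (simp add: divide_less_eq algebra_simps)
        finally show "dist (X (Suc n) t) (\<Phi> x t) < e"
          by (simp add: X_Suc dist_norm)
      qed
    qed
    ultimately show ?thesis by (rule LIMSEQ_unique)
  qed
  have init: "x 0 = x0" using fixp[of 0] T by (simp add: \<Phi>_def)
  have "x t = x 0 + integral {0..t} (\<lambda>s. f s (x s))" if "t \<in> {0..T}" for t
    using fixp[OF that] unfolding \<Phi>_def init .
  then have "has_rate_on T x (\<lambda>t. f t (x t))"
    by (rule has_rate_onI[OF int[OF cx]])
  with init show thesis by (rule that)
qed

section \<open>Almost fixed points of strictly causal operators\<close>

lemma borel_measurable_switch:
  assumes n: "n \<in> borel_measurable (lebesgue_on {0::real..})" and m: "m \<in> borel_measurable (lebesgue_on {0..})"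
  shows "(\<lambda>t. if t < T then n t else m t) \<in> borel_measurable (lebesgue_on {0..})"
proof -
  have "{t \<in> space (lebesgue_on {0..}). t < T} = {0..<T}"
    by auto
  moreover have "{0..<T} \<in> sets (lebesgue_on {0..})"
    by (subst sets_restrict_space_iff) auto
  ultimately show ?thesis
    using n m by (intro measurable_If) auto
qed

lemma hold_in_disturbances:
  assumes "n \<in> disturbances"
  shows "(\<lambda>t. if t < T then n t else c) \<in> disturbances"
proof -
  have "bounded ((\<lambda>t. if t < T then n t else c) ` {0..S})" if "S \<ge> 0" for S
  proof -
    have "bounded (insert c (n ` {0..S}))"
      using assms that by (auto simp: disturbances_def)
    then show ?thesis by (rule bounded_subset) auto
  qed
  then show ?thesis
    using assms borel_measurable_switch[of n "\<lambda>_. c" T] by (auto simp: disturbances_def)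
qed

text \<open>
  The length of a holding interval is capped by \<open>1\<close> in order to have a definite next sampling
  time also when \<open>e\<close> never vanishes.
\<close>

lemma first_exit_time:
  fixes e :: "real \<Rightarrow> real"
  assumes c: "continuous_on {T..T+1} e" and T: "e T > 0"
  obtains S where "T < S" "S \<le> T + 1" "\<And>t. t \<in> {T..<S} \<Longrightarrow> e t > 0" "S = T + 1 \<or> e S = 0"
proof (cases "\<exists>t\<in>{T..T+1}. e t \<le> 0")
  case False
  then show thesis by (intro that[of "T + 1"]) (auto simp: not_le)
next
  case True
  let ?Z = "{t\<in>{T..T+1}. e t \<le> 0}"
  have "closed ?Z"
    using continuous_on_closed_Collect_le[OF c continuous_on_const[of _ 0]] by simp
  then have "compact ?Z"
    by (auto simp: compact_eq_bounded_closed intro: bounded_subset[of "{T..T+1}"])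
  then obtain S where S: "S \<in> ?Z" "\<And>t. t \<in> ?Z \<Longrightarrow> S \<le> t"
    using True compact_attains_inf[of ?Z] by blast
  have pos: "e t > 0" if "t \<in> {T..<S}" for t
    using S(2)[of t] that S(1) by force
  have "T < S" using S(1) T by (cases "T = S") auto
  have "continuous_on {T..S} e" using S(1) by (intro continuous_on_subset[OF c]) auto
  then obtain t where t: "T \<le> t" "t \<le> S" "e t = 0"
    using IVT2'[of e S 0 T] S(1) T by auto
  then have "t = S" using pos[of t] by fastforce
  then show thesis
    using t S(1) pos \<open>T < S\<close> by (intro that[of S]) auto
qed

text \<open>
  A feedback law \<open>n = \<G> n\<close> that depends on the strict past can be realised up to an error
  \<open>\<epsilon> (t)\<close> by sample and hold: keep the sampled value of \<open>\<G> n\<close> until \<open>\<G> n\<close> has moved by \<open>\<epsilon>\<close>,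
  then sample again. Exact fixed points may fail to exist, since \<open>\<G> n\<close> need not
  depend continuously on \<open>n\<close>.
\<close>

lemma approximate_fixed_point_of_causal_operator:
  fixes \<G> :: "(real \<Rightarrow> real^3) \<Rightarrow> real \<Rightarrow> real^3" and \<epsilon> :: "real \<Rightarrow> real"
  assumes cont: "\<And>n. n \<in> disturbances \<Longrightarrow> continuous_on {0..} (\<G> n)"
    and bound: "\<And>n t. n \<in> disturbances \<Longrightarrow> t \<ge> 0 \<Longrightarrow> norm (\<G> n t) \<le> B"
    and caus: "\<And>n n' t. \<lbrakk>n \<in> disturbances; n' \<in> disturbances; t \<ge> 0; \<And>s. 0 \<le> s \<Longrightarrow> s < t \<Longrightarrow> n s = n' s\<rbrakk>
        \<Longrightarrow> \<G> n t = \<G> n' t"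
    and eps: "continuous_on {0..} \<epsilon>" "\<And>t. t \<ge> 0 \<Longrightarrow> \<epsilon> t > 0"
  obtains n where "n \<in> disturbances" "\<And>t. t \<ge> 0 \<Longrightarrow> norm (n t - \<G> n t) \<le> \<epsilon> t"
proof -
  \<comment> \<open>A state is a disturbance with the time \<open>T\<close> up to which it already follows \<open>\<G>\<close>; its values
    after \<open>T\<close> are provisional. The bound is \<open>max B 0\<close> because the first disturbance is \<open>0\<close>.\<close>
  define P where "P = (\<lambda>(n, T). n \<in> disturbances \<and> 0 \<le> T \<and> (\<forall>t\<ge>0. norm (n t) \<le> max B 0)
      \<and> (\<forall>t. 0 \<le> t \<and> t < T \<longrightarrow> norm (n t - \<G> n t) \<le> \<epsilon> t))"
  define Q where "Q = (\<lambda>(n :: real \<Rightarrow> real^3, T :: real) (n', T'). T < T' \<and> (\<forall>t<T. n' t = n t)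
      \<and> (T' = T + 1 \<or> norm (\<G> n' T - \<G> n' T') = \<epsilon> T'))"
  have step: "\<exists>y. P y \<and> Q x y" if "P x" for x
  proof -
    obtain n T where x: "x = (n, T)" by (cases x)
    have n: "n \<in> disturbances" "0 \<le> T" "\<And>t. t \<ge> 0 \<Longrightarrow> norm (n t) \<le> max B 0"
      and good: "\<And>t. 0 \<le> t \<Longrightarrow> t < T \<Longrightarrow> norm (n t - \<G> n t) \<le> \<epsilon> t"
      using that by (auto simp: P_def x)
    define n' where "n' = (\<lambda>t. if t < T then n t else \<G> n T)"
    have n': "n' \<in> disturbances" unfolding n'_def by (rule hold_in_disturbances[OF n(1)])
    have same: "\<G> n' t = \<G> n t" if "0 \<le> t" "t \<le> T" for t
      using that by (intro caus n' n(1)) (auto simp: n'_def)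
    have "continuous_on {T..T+1} (\<lambda>t. \<epsilon> t - norm (\<G> n' T - \<G> n' t))"
      using n(2) by (intro continuous_intros continuous_on_subset[OF cont[OF n']] continuous_on_subset[OF eps(1)]) auto
    then obtain S where S: "T < S" "S \<le> T + 1"
      "\<And>t. t \<in> {T..<S} \<Longrightarrow> \<epsilon> t - norm (\<G> n' T - \<G> n' t) > 0"
      "S = T + 1 \<or> \<epsilon> S - norm (\<G> n' T - \<G> n' S) = 0"
      using first_exit_time[of T "\<lambda>t. \<epsilon> t - norm (\<G> n' T - \<G> n' t)"] eps(2)[OF n(2)] by auto
    have "P (n', S)"
      unfolding P_def prod.case
    proof (intro conjI allI impI)
      show "norm (n' t) \<le> max B 0" if "t \<ge> 0" for t
        using n(3)[OF that] bound[OF n(1,2)] by (auto simp: n'_def)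
      show "norm (n' t - \<G> n' t) \<le> \<epsilon> t" if "0 \<le> t \<and> t < S" for t
      proof (cases "t < T")
        case True
        then show ?thesis using good[of t] same[of t] that by (simp add: n'_def)
      next
        case False
        then show ?thesis using S(3)[of t] same[of T] that n(2) by (auto simp: n'_def)
      qed
    qed (use n' S n in auto)
    moreover have "Q x (n', S)"
      unfolding Q_def x prod.case using S by (auto simp: n'_def)
    ultimately show ?thesis by blast
  qed
  have start: "P (\<lambda>_. 0, 0)"
    by (auto simp: P_def disturbances_def bounded_iff)
  have "\<exists>F. \<forall>k. P (F k) \<and> Q (F k) (F (Suc k))"
    by (rule dependent_nat_choice) (use start step in blast)+
  then obtain F where F: "\<And>k. P (F k)" "\<And>k. Q (F k) (F (Suc k))"
    by blast
  define N where "N k = fst (F k)" for k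
  define \<tau> where "\<tau> k = snd (F k)" for k
  have PF: "P (N k, \<tau> k)" and QF: "Q (N k, \<tau> k) (N (Suc k), \<tau> (Suc k))" for k
    using F[of k] by (simp_all add: N_def \<tau>_def)
  have N: "N k \<in> disturbances" and \<tau>0: "0 \<le> \<tau> k" and Nb: "\<And>t. t \<ge> 0 \<Longrightarrow> norm (N k t) \<le> max B 0"
    and good: "\<And>t. 0 \<le> t \<Longrightarrow> t < \<tau> k \<Longrightarrow> norm (N k t - \<G> (N k) t) \<le> \<epsilon> t" for k
    using PF[of k] unfolding P_def prod.case by blast+
  have \<tau>_less: "\<tau> k < \<tau> (Suc k)" and agree: "\<And>t. t < \<tau> k \<Longrightarrow> N (Suc k) t = N k t"
    and exit: "\<tau> (Suc k) = \<tau> k + 1 \<or> norm (\<G> (N (Suc k)) (\<tau> k) - \<G> (N (Suc k)) (\<tau> (Suc k))) = \<epsilon> (\<tau> (Suc k))" for k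
    using QF[of k] unfolding Q_def prod.case by blast+
  have mono: "\<tau> k \<le> \<tau> j" if "k \<le> j" for k j
    using less_imp_le[OF \<tau>_less] that by (rule lift_Suc_mono_le)
  have agree': "N j t = N k t" if "k \<le> j" "t < \<tau> k" for j k t
    using that
  proof (induction j rule: dec_induct)
    case (step j)
    then show ?case using agree[of t j] mono[of k j] by auto
  qed simp
  \<comment> \<open>The value \<open>0\<close> beyond all sampling times makes \<open>M\<close> a disturbance also in the case, refuted
    below, that these times accumulate.\<close>
  define M where "M = (\<lambda>t. if \<exists>k. t < \<tau> k then N (LEAST k. t < \<tau> k) t else 0)"
  have M: "M t = N k t" if "t < \<tau> k" for k t
  proof -
    have "(LEAST k. t < \<tau> k) \<le> k" "t < \<tau> (LEAST k. t < \<tau> k)"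
      using that by (auto intro: Least_le LeastI)
    then have "N k t = N (LEAST k. t < \<tau> k) t" by (rule agree')
    then show ?thesis using that by (auto simp: M_def)
  qed
  have M0: "M t = 0" if "\<And>k. \<not> t < \<tau> k" for t
    using that by (simp add: M_def)
  have Mb: "norm (M t) \<le> max B 0" if "t \<ge> 0" for t
  proof (cases "\<exists>k. t < \<tau> k")
    case True
    then show ?thesis using M Nb that by auto
  qed (simp add: M0)
  have "M \<in> borel_measurable (lebesgue_on {0..})"
  proof (rule borel_measurable_LIMSEQ_metric)
    show "(\<lambda>t. if t < \<tau> k then N k t else 0) \<in> borel_measurable (lebesgue_on {0..})" for k
      using N[of k] by (intro borel_measurable_switch) (auto simp: disturbances_def)
    show "(\<lambda>k. if t < \<tau> k then N k t else 0) \<longlonglongrightarrow> M t" for t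
    proof (cases "\<exists>k. t < \<tau> k")
      case True
      then obtain k where k: "t < \<tau> k" by blast
      have "eventually (\<lambda>j. (if t < \<tau> j then N j t else 0) = M t) sequentially"
        using eventually_ge_at_top[of k]
      proof eventually_elim
        case (elim j)
        then show ?case using M[of t j] k mono[of k j] by auto
      qed
      then show ?thesis by (rule tendsto_eventually)
    qed (simp add: M0)
  qed
  then have Md: "M \<in> disturbances"
    using Mb by (auto simp: disturbances_def bounded_iff intro!: exI[of _ "max B 0"])
  have GM: "\<G> (N k) t = \<G> M t" if "0 \<le> t" "t \<le> \<tau> k" for k t
    using that by (intro caus N Md M[symmetric]) auto
  \<comment> \<open>At an accumulation point \<open>L\<close> the increments of \<open>\<G> M\<close> between consecutive sampling times
    would tend to \<open>0\<close> by continuity and to \<open>\<epsilon> L > 0\<close> by the choice of these times.\<close>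
  have unbounded: "\<exists>k. t < \<tau> k" for t
  proof (rule ccontr)
    assume "\<not> (\<exists>k. t < \<tau> k)"
    then have le: "\<tau> k \<le> t" for k by (auto simp: not_less)
    have "incseq \<tau>" using mono by (simp add: incseq_def)
    then obtain L where L: "\<tau> \<longlonglongrightarrow> L" "\<And>k. \<tau> k \<le> L"
      using incseq_convergent[of \<tau> t] le by blast
    have L0: "L \<ge> 0" using \<tau>0[of 0] L(2)[of 0] by linarith
    have conv: "(\<lambda>k. f (\<tau> k)) \<longlonglongrightarrow> f L" if "continuous_on {0..} f" for f :: "real \<Rightarrow> 'c::topological_space"
      using continuous_on_tendsto_compose[OF that L(1)] L0 \<tau>0 by auto
    note conv' = LIMSEQ_Suc[OF conv]
    have "(\<lambda>k. \<tau> (Suc k) - \<tau> k) \<longlonglongrightarrow> L - L"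
      by (intro tendsto_diff L(1) LIMSEQ_Suc[OF L(1)])
    then have "eventually (\<lambda>k. \<tau> (Suc k) - \<tau> k < 1) sequentially"
      by (rule order_tendstoD) simp
    then have "eventually (\<lambda>k. norm (\<G> M (\<tau> k) - \<G> M (\<tau> (Suc k))) = \<epsilon> (\<tau> (Suc k))) sequentially"
    proof eventually_elim
      case (elim k)
      then show ?case
        using exit[of k] GM[of "\<tau> k" "Suc k"] GM[of "\<tau> (Suc k)" "Suc k"] \<tau>0 \<tau>_less[of k] by auto
    qed
    then have "(\<lambda>k. norm (\<G> M (\<tau> k) - \<G> M (\<tau> (Suc k)))) \<longlonglongrightarrow> \<epsilon> L"
      using conv'[OF eps(1)] tendsto_cong by force
    moreover have "(\<lambda>k. norm (\<G> M (\<tau> k) - \<G> M (\<tau> (Suc k)))) \<longlonglongrightarrow> norm (\<G> M L - \<G> M L)"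
      by (intro tendsto_norm tendsto_diff conv conv' cont Md)
    ultimately have "\<epsilon> L = norm (\<G> M L - \<G> M L)"
      by (rule LIMSEQ_unique)
    then show False using eps(2)[OF L0] by simp
  qed
  show thesis
  proof (rule that[OF Md])
    fix t :: real assume t: "t \<ge> 0"
    obtain k where "t < \<tau> k" using unbounded by blast
    then show "norm (M t - \<G> M t) \<le> \<epsilon> t"
      using good[of t k] M[of t k] GM[of t k] t by simp
  qed
qed

section \<open>The attitude error and its potential\<close>

lemma bounded_linear_transpose: "bounded_linear (transpose :: real^'n^'m \<Rightarrow> real^'m^'n)"
  unfolding linear_conv_bounded_linear[symmetric]
  by (rule linearI) (simp_all add: transpose_def vec_eq_iff)

lemma bounded_linear_skew: "bounded_linear skew"
  using linear_skew by (simp add: linear_conv_bounded_linear)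

lemma bounded_linear_psi: "bounded_linear psi"
  using linear_psi by (simp add: linear_conv_bounded_linear)

lemma bounded_linear_trace: "bounded_linear (trace :: real^3^3 \<Rightarrow> real)"
  unfolding linear_conv_bounded_linear[symmetric]
  by (rule linearI) (simp_all add: trace_def sum.distrib sum_distrib_left)

lemmas skew_add = linear_add[OF bounded_linear.linear[OF bounded_linear_skew]]
  and skew_diff = linear_diff[OF bounded_linear.linear[OF bounded_linear_skew]]
  and transpose_add = linear_add[OF bounded_linear.linear[OF bounded_linear_transpose]]
  and transpose_diff = linear_diff[OF bounded_linear.linear[OF bounded_linear_transpose]]

lemma transpose_skew: "transpose (skew x) = - skew x"
  by (simp add: vec_eq_iff forall_3 transpose_def skew_entries)

lemma SO3_mult_skew:
  assumes "Q \<in> SO3"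
  shows "Q ** skew x = skew (Q *v x) ** Q"
proof -
  have "skew (Q *v x) ** Q = Q ** skew x ** (transpose Q ** Q)"
    by (simp add: SO3_conj_skew[OF assms, symmetric] matrix_mul_assoc)
  then show ?thesis by (simp add: SO3_trans_mult[OF assms])
qed

lemma att_err_SO3: "R t \<in> SO3 \<Longrightarrow> Rh t \<in> SO3 \<Longrightarrow> att_err R Rh t \<in> SO3"
  by (simp add: att_err_def mult_SO3 transpose_SO3)

text \<open>
  The true angular velocity cancels: only the innovation and the disturbance, rotated into the
  frame of the error, drive the error.
\<close>

lemma att_err_rate:
  assumes R: "has_rate_on T R (\<lambda>t. R t ** skew (\<omega> t))"
    and Rh: "has_rate_on T Rh (\<lambda>t. Rh t ** skew (\<omega> t + n t) - skew (s t) ** Rh t)"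
    and SO3: "\<And>t. t \<in> {0..T} \<Longrightarrow> Rh t \<in> SO3"
  shows "has_rate_on T (att_err R Rh) (\<lambda>t. att_err R Rh t ** skew (s t - Rh t *v n t))"
proof (rule has_rate_on_cong[OF has_rate_on_bilinear[OF bounded_bilinear_matrix_mult R
        has_rate_on_linear[OF bounded_linear_transpose Rh]]])
  fix t assume t: "t \<in> {0..T}"
  have "att_err R Rh t ** skew (Rh t *v n t) = R t ** (transpose (Rh t) ** (skew (Rh t *v n t)))"
    by (simp add: att_err_def matrix_mul_assoc)
  also have "\<dots> = R t ** (transpose (Rh t) ** Rh t ** skew (n t) ** transpose (Rh t))"
    by (simp add: SO3_conj_skew[OF SO3[OF t], symmetric] matrix_mul_assoc)
  finally have "att_err R Rh t ** skew (Rh t *v n t) = R t ** skew (n t) ** transpose (Rh t)"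
    by (simp add: SO3_trans_mult[OF SO3[OF t]] matrix_mul_assoc)
  then show "att_err R Rh t ** skew (s t - Rh t *v n t) =
     R t ** skew (\<omega> t) ** transpose (Rh t) +
     R t ** transpose (Rh t ** skew (\<omega> t + n t) - skew (s t) ** Rh t)"
    by (simp add: skew_diff skew_add matrix_mult.diff_right matrix_mult.add_right matrix_transpose_mul
        transpose_diff transpose_add transpose_skew matrix_mult.minus_left matrix_mult.minus_right
        matrix_mul_assoc att_err_def)
qed (simp add: att_err_def)

lemma cos2_half_rate:
  assumes "has_rate_on T Q (\<lambda>t. Q t ** skew (u t))"
  shows "has_rate_on T (\<lambda>t. cos2_half (Q t)) (\<lambda>t. - (psi (Q t) \<bullet> u t) / 2)"
proof -
  have "bounded_linear (\<lambda>X :: real^3^3. trace X / 4)"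
    using bounded_linear_compose[OF bounded_linear_divide bounded_linear_trace] .
  from has_rate_on_add[OF has_rate_on_const[of T "1/4"] has_rate_on_linear[OF this assms]]
  show ?thesis
    by (rule has_rate_on_cong) (simp_all add: cos2_half_def trace_mult_skew add_divide_distrib)
qed

text \<open>
  For \<open>m \<ge> \<mu>\<close> this is \<open>- 2 ln m\<close>; below \<open>\<mu>\<close> it continues along the tangent at \<open>\<mu>\<close>. The result is
  continuously differentiable on all of \<open>\<real>\<close>, so the chain rule applies to it before
  anything is known about the sign of \<open>m\<close>.
\<close>

definition trunc_potential :: "real \<Rightarrow> real \<Rightarrow> real" where
  "trunc_potential \<mu> m = - 2 * ln (max m \<mu>) + 2 - 2 * m / max m \<mu>"

text \<open>
  Half the body-frame gradient of \<open>trunc_potential \<mu> (cos2_half Q)\<close>: the Rodrigues vector as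
  long as \<open>cos2_half Q \<ge> \<mu>\<close>, and a bounded continuous extension of it beyond.
\<close>

definition trunc_rodrigues :: "real \<Rightarrow> real^3^3 \<Rightarrow> real^3" where
  "trunc_rodrigues \<mu> Q = psi Q /\<^sub>R (2 * max (cos2_half Q) \<mu>)"

lemma trunc_potential_deriv:
  assumes "\<mu> > 0"
  shows "(trunc_potential \<mu> has_real_derivative - 2 / max m \<mu>) (at m)"
proof -
  have l: "(trunc_potential \<mu> has_real_derivative - 2 / \<mu>) (at m within {..\<mu>})" if "m \<le> \<mu>"
  proof (rule has_field_derivative_transform_within[of _ _ _ _ 1])
    show "((\<lambda>m. - 2 * ln \<mu> + 2 - 2 * m / \<mu>) has_real_derivative - 2 / \<mu>) (at m within {..\<mu>})"
      using assms by (auto intro!: derivative_eq_intros)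
  qed (use that assms in \<open>auto simp: trunc_potential_def max_def\<close>)
  have r: "(trunc_potential \<mu> has_real_derivative - 2 / m) (at m within {\<mu>..})" if "\<mu> \<le> m"
  proof (rule has_field_derivative_transform_within[of _ _ _ _ 1])
    show "((\<lambda>m. - 2 * ln m) has_real_derivative - 2 / m) (at m within {\<mu>..})"
      using assms that by (auto intro!: derivative_eq_intros)
  qed (use that assms in \<open>auto simp: trunc_potential_def max_def\<close>)
  consider "m < \<mu>" | "m = \<mu>" | "\<mu> < m" by linarith
  then show ?thesis
  proof cases
    case 1
    then have "at m within {..\<mu>} = at m"
      by (intro at_within_interior) simp
    then show ?thesis using l 1 by simp
  next
    case 2
    have "(trunc_potential \<mu> has_real_derivative - 2 / \<mu>) (at m within {..\<mu>} \<union> {\<mu>..})"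
      using l r 2 unfolding has_field_derivative_iff
      by (subst at_within_union) (intro filterlim_sup; simp)
    moreover have "{..\<mu>} \<union> {\<mu>..} = UNIV" by auto
    ultimately show ?thesis using 2 by simp
  next
    case 3
    then have "at m within {\<mu>..} = at m"
      by (intro at_within_interior) simp
    then show ?thesis using r 3 by simp
  qed
qed

lemma trunc_potential_eq: "\<mu> \<le> m \<Longrightarrow> 0 < \<mu> \<Longrightarrow> trunc_potential \<mu> m = - 2 * ln m"
  by (simp add: trunc_potential_def max_def)

text \<open>
  The logarithm lies below its tangent.
\<close>

lemma trunc_potential_le:
  assumes "0 < \<mu>" "0 < m"
  shows "trunc_potential \<mu> m \<le> - 2 * ln m"
proof (cases "\<mu> \<le> m")
  case False
  have "ln (m / \<mu>) \<le> m / \<mu> - 1"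
    using assms by (intro ln_le_minus_one) simp
  then show ?thesis
    using False assms by (simp add: trunc_potential_def ln_div max_def)
qed (simp add: trunc_potential_eq assms)

lemma trunc_potential_rate:
  assumes Q: "has_rate_on T Q (\<lambda>t. Q t ** skew (u t))" and \<mu>: "\<mu> > 0"
  shows "has_rate_on T (\<lambda>t. trunc_potential \<mu> (cos2_half (Q t))) (\<lambda>t. 2 * (trunc_rodrigues \<mu> (Q t) \<bullet> u t))"
proof (rule has_rate_on_cong[OF has_rate_on_chain[OF cos2_half_rate[OF Q] trunc_potential_deriv[OF \<mu>]]])
  show "continuous_on UNIV (\<lambda>m. - 2 / max m \<mu>)"
    using \<mu> by (intro continuous_intros) (auto simp: max_def)
  fix t
  have "max (cos2_half (Q t)) \<mu> > 0" using \<mu> by simp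
  then show "2 * (trunc_rodrigues \<mu> (Q t) \<bullet> u t)
      = - 2 / max (cos2_half (Q t)) \<mu> * (- (psi (Q t) \<bullet> u t) / 2)"
    by (simp add: trunc_rodrigues_def field_simps)
qed simp

lemma log_cost_eq:
  assumes "Q \<in> SO3" "Q \<notin> Pi_set"
  shows "2 * ln (1 + (norm (rodrigues Q))\<^sup>2) = - 2 * ln (cos2_half Q)"
  unfolding norm_rodrigues_sq[OF assms] using cos2_half_pos[OF assms] by (simp add: ln_div)

lemma trunc_rodrigues_eq:
  assumes "Q \<in> SO3" "Q \<notin> Pi_set" "\<mu> \<le> cos2_half Q"
  shows "trunc_rodrigues \<mu> Q = rodrigues Q"
  using assms by (simp add: rodrigues_eq trunc_rodrigues_def max_def)

lemma norm_trunc_rodrigues_le: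
  assumes "Q \<in> SO3" "Q \<notin> Pi_set" "\<mu> > 0"
  shows "norm (trunc_rodrigues \<mu> Q) \<le> norm (rodrigues Q)"
  using cos2_half_pos[OF assms(1,2)] assms(3)
  by (simp add: rodrigues_eq[OF assms(1,2)] trunc_rodrigues_def mult_right_mono le_imp_inverse_le)

lemma norm_trunc_rodrigues_bound:
  assumes "Q \<in> SO3" "\<mu> > 0"
  shows "norm (trunc_rodrigues \<mu> Q) \<le> 1 / (2 * \<mu>)"
proof -
  have "cos2_half Q * (1 - cos2_half Q) \<le> 1 / 4"
    using zero_le_power2[of "cos2_half Q - 1/2"] by (simp add: power2_eq_square algebra_simps)
  then have "(norm (psi Q))\<^sup>2 \<le> 1\<^sup>2"
    using norm_psi_sq[OF assms(1)] by simp
  then have p: "norm (psi Q) \<le> 1" by (rule power2_le_imp_le) simp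
  have "norm (trunc_rodrigues \<mu> Q) = norm (psi Q) / (2 * max (cos2_half Q) \<mu>)"
    using assms(2) by (simp add: trunc_rodrigues_def field_simps)
  also have "\<dots> \<le> 1 / (2 * \<mu>)"
    using p assms(2) by (intro frac_le) auto
  finally show ?thesis .
qed

lemma continuous_on_cos2_half [continuous_intros]:
  "continuous_on S f \<Longrightarrow> continuous_on S (\<lambda>t. cos2_half (f t))"
  unfolding cos2_half_def by (intro continuous_intros bounded_linear.continuous_on[OF bounded_linear_trace]) auto

lemma continuous_on_trunc_rodrigues [continuous_intros]:
  assumes "continuous_on S f" "\<mu> > 0"
  shows "continuous_on S (\<lambda>t. trunc_rodrigues \<mu> (f t))"
proof -
  have "max (cos2_half (f t)) \<mu> \<noteq> 0" for t using assms(2) by (simp add: max_def)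
  then show ?thesis
    unfolding trunc_rodrigues_def using assms(1)
    by (intro continuous_intros bounded_linear.continuous_on[OF bounded_linear_psi]) auto
qed

lemma cos2_half_uniformly_pos:
  fixes Q :: "real \<Rightarrow> real^3^3"
  assumes "continuous_on {0..T} Q" "\<And>t. t \<in> {0..T} \<Longrightarrow> Q t \<in> SO3" "\<And>t. t \<in> {0..T} \<Longrightarrow> Q t \<notin> Pi_set"
  obtains \<mu> where "\<mu> > 0" "\<And>t. t \<in> {0..T} \<Longrightarrow> \<mu> \<le> cos2_half (Q t)"
proof (cases "T \<ge> 0")
  case True
  have "\<exists>x\<in>{0..T}. \<forall>y\<in>{0..T}. cos2_half (Q x) \<le> cos2_half (Q y)"
    using True assms(1) by (intro continuous_attains_inf continuous_intros) auto
  then show thesis using that cos2_half_pos assms(2,3) by metis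
qed (use that[of 1] in auto)

lemma continuous_on_rodrigues:
  fixes Q :: "real \<Rightarrow> real^3^3"
  assumes "continuous_on {0..T} Q" "\<And>t. t \<in> {0..T} \<Longrightarrow> Q t \<in> SO3" "\<And>t. t \<in> {0..T} \<Longrightarrow> Q t \<notin> Pi_set"
  shows "continuous_on {0..T} (\<lambda>t. rodrigues (Q t))"
proof -
  obtain \<mu> where \<mu>: "\<mu> > 0" "\<And>t. t \<in> {0..T} \<Longrightarrow> \<mu> \<le> cos2_half (Q t)"
    using cos2_half_uniformly_pos[OF assms] by blast
  have "continuous_on {0..T} (\<lambda>t. trunc_rodrigues \<mu> (Q t))"
    using assms(1) \<mu>(1) by (rule continuous_on_trunc_rodrigues)
  then show ?thesis
    by (rule continuous_on_eq) (simp add: trunc_rodrigues_eq assms \<mu>)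
qed

text \<open>
  On a compact interval \<open>cos2_half\<close> has a positive minimum, and with this minimum as \<open>\<mu>\<close> the
  truncation is not felt.
\<close>

lemma log_cost_rate:
  assumes Q: "has_rate_on T Q (\<lambda>t. Q t ** skew (u t))"
    and SO3: "\<And>t. t \<in> {0..T} \<Longrightarrow> Q t \<in> SO3" "\<And>t. t \<in> {0..T} \<Longrightarrow> Q t \<notin> Pi_set"
  shows "has_rate_on T (\<lambda>t. 2 * ln (1 + (norm (rodrigues (Q t)))\<^sup>2)) (\<lambda>t. 2 * (rodrigues (Q t) \<bullet> u t))"
proof -
  obtain \<mu> where \<mu>: "\<mu> > 0" "\<And>t. t \<in> {0..T} \<Longrightarrow> \<mu> \<le> cos2_half (Q t)"
    using cos2_half_uniformly_pos[OF has_rate_on_continuous[OF Q] SO3] by blast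
  show ?thesis
    by (rule has_rate_on_cong[OF trunc_potential_rate[OF Q \<mu>(1)]])
      (simp_all add: log_cost_eq trunc_potential_eq trunc_rodrigues_eq SO3 \<mu>)
qed

text \<open>
  Completion of squares. With \<open>\<zeta> = z\<close> the middle term vanishes and the two players are decoupled.
  With \<open>|\<zeta>| \<le> |z|\<close> the first two terms are nonnegative, so a disturbance close to
  \<open>- Rh\<^sup>T \<zeta> / \<gamma>\<^sup>2\<close> prevents the sum from being very negative, whatever \<open>s\<close> is.
\<close>

lemma game_identity:
  fixes z \<zeta> s n :: "real^3"
  assumes "a > 0" "\<gamma> \<noteq> 0" "Rh \<in> SO3"
  shows "2 * (\<zeta> \<bullet> (s - Rh *v n)) + ((2 * a - 1 / \<gamma>\<^sup>2) * (z \<bullet> z) + 1 / (2 * a) * (s \<bullet> s) - \<gamma>\<^sup>2 * (n \<bullet> n))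
    = 1 / (2 * a) * (norm (s + (2 * a) *\<^sub>R \<zeta>))\<^sup>2 + (2 * a - 1 / \<gamma>\<^sup>2) * ((norm z)\<^sup>2 - (norm \<zeta>)\<^sup>2)
      - \<gamma>\<^sup>2 * (norm (n + (1 / \<gamma>\<^sup>2) *\<^sub>R (transpose Rh *v \<zeta>)))\<^sup>2"
proof -
  define w where "w = transpose Rh *v \<zeta>"
  have w: "\<zeta> \<bullet> (Rh *v n) = n \<bullet> w"
    using inner_SO3_mult[OF assms(3), of n \<zeta>] by (simp add: w_def inner_commute)
  have ww: "w \<bullet> w = \<zeta> \<bullet> \<zeta>"
    using norm_SO3_mult[OF transpose_SO3[OF assms(3)], of \<zeta>]
    by (simp add: w_def dot_square_norm del: transpose_matrix_vector)
  show ?thesis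
    unfolding power2_norm_eq_inner w_def[symmetric]
    using assms(1,2)
    by (simp add: inner_simps w ww inner_commute) (simp add: field_simps power2_eq_square power4_eq_xxxx inner_commute)
qed

lemma continuous_on_atLeastI:
  fixes f :: "real \<Rightarrow> 'a::topological_space"
  assumes "\<And>T. T \<ge> 0 \<Longrightarrow> continuous_on {0..T} f"
  shows "continuous_on {0..} f"
  unfolding continuous_on_def
proof
  fix x :: real assume x: "x \<in> {0..}"
  have "at x within {0..} = at x within {0..x+1}"
    by (rule at_within_nhd[of x "{..<x+1}"]) auto
  then show "(f \<longlongrightarrow> f x) (at x within {0..})"
    using assms[of "x+1"] x by (auto simp: continuous_on_def)
qed

lemma disturbance_integrable:
  assumes "n \<in> disturbances"
  shows "n absolutely_integrable_on {0..T}"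
proof (cases "T \<ge> 0")
  case True
  then obtain B where B: "\<forall>t\<in>{0..T}. norm (n t) \<le> B"
    using assms by (auto simp: disturbances_def bounded_iff)
  show ?thesis
  proof (rule measurable_bounded_by_integrable_imp_absolutely_integrable[where g = "\<lambda>_. B"])
    have "n \<in> borel_measurable (lebesgue_on {0..})"
      using assms by (simp add: disturbances_def)
    then show "n \<in> borel_measurable (lebesgue_on {0..T})"
      by (rule measurable_restrict_mono) auto
  qed (use B in auto)
qed simp

lemma disturbance_square_integrable:
  assumes "n \<in> disturbances"
  shows "(\<lambda>t. n t \<bullet> n t) absolutely_integrable_on {0..T}"
proof (cases "T \<ge> 0")
  case True
  have "(\<lambda>t. n t \<bullet> n t) absolutely_integrable_on {0..T}"
  proof (rule absolutely_integrable_bounded_measurable_product[where h = "(\<bullet>)" and f = n and g = n])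
    show "bilinear (inner :: real^3 \<Rightarrow> _)"
      by (simp add: bilinear_conv_bounded_bilinear bounded_bilinear_inner)
    show "bounded (n ` {0..T})" using assms True by (simp add: disturbances_def)
    show "n absolutely_integrable_on {0..T}" by (rule disturbance_integrable[OF assms])
    then show "n \<in> borel_measurable (lebesgue_on {0..T})"
      by (rule absolutely_integrable_measurable[THEN iffD1, THEN conjunct1, rotated]) auto
  qed auto
  then show ?thesis .
qed simp

section \<open>The closed loop under the optimal innovation term\<close>

text \<open>
  A Lipschitz retraction onto the ball of radius \<open>3\<close>, which contains all rotations. It is radial so
  that \<open>clip X ** skew w\<close> is still of the form \<open>X ** skew w'\<close>; this form is what preserves \<open>SO(3)\<close>.
\<close>

definition clip :: "real^3^3 \<Rightarrow> real^3^3" where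
  "clip X = X /\<^sub>R max 1 (norm X / 3)"

text \<open>
  A globally Lipschitz extension of \<open>Q \<mapsto> Q ** skew (- 2 a z)\<close> from the rotations with
  \<open>cos2_half Q \<ge> \<mu>\<close>.
\<close>

definition closed_loop_field :: "real \<Rightarrow> real \<Rightarrow> real^3^3 \<Rightarrow> real^3^3" where
  "closed_loop_field a \<mu> X = clip X ** skew (- (2 * a) *\<^sub>R trunc_rodrigues \<mu> (clip X))"

lemma norm_SO3_le:
  assumes "Q \<in> SO3"
  shows "norm Q \<le> 3"
proof -
  have "norm (Q $ i) = 1" for i
  proof -
    have "(Q ** transpose Q) $ i $ i = 1"
      using SO3_mult_trans[OF assms] by (simp add: mat_def)
    then have "Q $ i \<bullet> Q $ i = 1"
      by (simp add: matrix_matrix_mult_def transpose_def inner_vec_def)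
    then show ?thesis by (simp add: norm_eq_1)
  qed
  then have "(\<Sum>i\<in>UNIV. norm (Q $ i)) = 3" by (simp add: sum_3)
  moreover have "norm Q \<le> (\<Sum>i\<in>UNIV. norm (Q $ i))"
    unfolding norm_vec_def by (rule L2_set_le_sum) simp
  ultimately show ?thesis by simp
qed

lemma clip_SO3: "Q \<in> SO3 \<Longrightarrow> clip Q = Q"
  using norm_SO3_le[of Q] by (simp add: clip_def max_def)

lemma norm_clip_le: "norm (clip X) \<le> 3"
proof -
  define p where "p = max 1 (norm X / 3)"
  have p: "p \<ge> 1" "norm X \<le> 3 * p" by (auto simp: p_def max_def)
  have "norm (clip X) = norm X / p"
    unfolding clip_def p_def[symmetric] using p(1) by (simp add: divide_inverse_commute)
  also have "\<dots> \<le> 3"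
    using p by (subst pos_divide_le_eq) auto
  finally show ?thesis .
qed

text \<open>
  With \<open>p\<close> and \<open>q\<close> the two normalising factors, \<open>x / p - y / q\<close> splits into \<open>(x - y) / p\<close> and a multiple
  of \<open>clip y\<close> by \<open>(q - p) / p\<close>.
\<close>

lemma clip_lipschitz: "2-lipschitz_on UNIV clip"
proof (rule lipschitz_onI)
  fix x y :: "real^3^3"
  define p q where "p = max 1 (norm x / 3)" and "q = max 1 (norm y / 3)"
  have pq: "p \<ge> 1" "q \<ge> 1" by (auto simp: p_def q_def)
  have "\<bar>norm x - norm y\<bar> \<le> norm (x - y)" by (rule norm_triangle_ineq3)
  moreover have "\<bar>q - p\<bar> \<le> \<bar>norm y / 3 - norm x / 3\<bar>"
    by (simp add: p_def q_def max_def)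
  moreover have "\<bar>norm y / 3 - norm x / 3\<bar> = \<bar>norm x - norm y\<bar> / 3"
    by (cases "norm x \<le> norm y") auto
  ultimately have qp: "\<bar>q - p\<bar> \<le> norm (x - y) / 3"
    by linarith
  have c: "clip x = (1 / p) *\<^sub>R x" "clip y = (1 / q) *\<^sub>R y"
    unfolding clip_def p_def q_def by (simp_all only: inverse_eq_divide)
  have "(q - p) / p * (1 / q) = 1 / p - 1 / q"
    using pq by (simp add: field_simps)
  then have "((q - p) / p) *\<^sub>R clip y = (1 / p) *\<^sub>R y - (1 / q) *\<^sub>R y"
    unfolding c scaleR_scaleR by (simp only: scaleR_diff_left)
  then have e: "clip x - clip y = (1 / p) *\<^sub>R (x - y) + ((q - p) / p) *\<^sub>R clip y"
    by (simp only: c(1) scaleR_diff_right) (simp add: c(2))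
  have "norm ((1 / p) *\<^sub>R (x - y)) = norm (x - y) / p"
    using pq by simp
  also have "\<dots> \<le> norm (x - y) / 1"
    using pq by (intro divide_left_mono) auto
  finally have "norm ((1 / p) *\<^sub>R (x - y)) \<le> norm (x - y)"
    by simp
  moreover have "norm (((q - p) / p) *\<^sub>R clip y) \<le> norm (x - y)"
  proof -
    have "\<bar>q - p\<bar> / p \<le> \<bar>q - p\<bar> / 1"
      using pq by (intro divide_left_mono) auto
    then have "\<bar>q - p\<bar> / p \<le> norm (x - y) / 3"
      using qp unfolding div_by_1 by (rule order_trans)
    then have "(\<bar>q - p\<bar> / p) * norm (clip y) \<le> (norm (x - y) / 3) * 3"
      using norm_clip_le[of y] pq by (intro mult_mono) auto
    moreover have "norm (((q - p) / p) *\<^sub>R clip y) = (\<bar>q - p\<bar> / p) * norm (clip y)"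
      using pq by simp
    ultimately show ?thesis by linarith
  qed
  ultimately show "dist (clip x) (clip y) \<le> 2 * dist x y"
    unfolding dist_norm e using norm_triangle_ineq[of "(1 / p) *\<^sub>R (x - y)" "((q - p) / p) *\<^sub>R clip y"]
    by linarith
qed simp

lemma lipschitz_on_bounded_linear:
  assumes "bounded_linear f"
  obtains L where "L-lipschitz_on S f"
proof -
  interpret f: bounded_linear f by (rule assms)
  obtain K where K: "K \<ge> 0" "\<And>x. norm (f x) \<le> norm x * K" using f.nonneg_bounded by blast
  have "K-lipschitz_on S f"
  proof (rule lipschitz_onI)
    show "dist (f x) (f y) \<le> K * dist x y" for x y
      using K(2)[of "x - y"] unfolding dist_norm f.diff[symmetric] by (simp only: mult.commute)
  qed (rule K)
  then show thesis by (rule that)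
qed

lemma lipschitz_on_bounded_bilinear:
  fixes f :: "'a::real_normed_vector \<Rightarrow> 'b::real_normed_vector" and g :: "'a \<Rightarrow> 'c::real_normed_vector"
  assumes h: "bounded_bilinear h" and f: "L-lipschitz_on (cball 0 r) f" and g: "M-lipschitz_on (cball 0 r) g"
    and r: "r \<ge> 0"
  obtains N where "N-lipschitz_on (cball 0 r) (\<lambda>x. h (f x) (g x))"
proof -
  interpret h: bounded_bilinear h by (rule h)
  obtain K where K: "K \<ge> 0" "\<And>a b. norm (h a b) \<le> norm a * norm b * K"
    using h.nonneg_bounded by blast
  have L: "L \<ge> 0" and M: "M \<ge> 0" using f g by (auto dest: lipschitz_on_nonneg)
  have Lf: "norm (f x - f y) \<le> L * norm (x - y)" if "x \<in> cball 0 r" "y \<in> cball 0 r" for x y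
    using lipschitz_onD[OF f that] by (simp add: dist_norm)
  have Mg: "norm (g x - g y) \<le> M * norm (x - y)" if "x \<in> cball 0 r" "y \<in> cball 0 r" for x y
    using lipschitz_onD[OF g that] by (simp add: dist_norm)
  define B where "B = norm (f 0) + L * r"
  define C where "C = norm (g 0) + M * r"
  have B: "norm (f x) \<le> B" if "x \<in> cball 0 r" for x
  proof -
    have "norm (f x) \<le> norm (f 0) + norm (f x - f 0)"
      by (rule norm_triangle_sub)
    also have "norm (f x - f 0) \<le> L * norm (x - 0)" using that r by (intro Lf) auto
    also have "\<dots> \<le> L * r" using that L by (intro mult_left_mono) auto
    finally show ?thesis by (simp add: B_def)
  qed
  have C: "norm (g x) \<le> C" if "x \<in> cball 0 r" for x
  proof -
    have "norm (g x) \<le> norm (g 0) + norm (g x - g 0)"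
      by (rule norm_triangle_sub)
    also have "norm (g x - g 0) \<le> M * norm (x - 0)" using that r by (intro Mg) auto
    also have "\<dots> \<le> M * r" using that M by (intro mult_left_mono) auto
    finally show ?thesis by (simp add: C_def)
  qed
  have BC: "B \<ge> 0" "C \<ge> 0" using L M r by (auto simp: B_def C_def)
  have "(L * C * K + B * M * K)-lipschitz_on (cball 0 r) (\<lambda>x. h (f x) (g x))"
  proof (rule lipschitz_onI)
    fix x y :: 'a assume xy: "x \<in> cball 0 r" "y \<in> cball 0 r"
    have "h (f x) (g x) - h (f y) (g y) = h (f x - f y) (g x) + h (f y) (g x - g y)"
      by (simp add: h.diff_left h.diff_right)
    also have "norm \<dots> \<le> norm (f x - f y) * norm (g x) * K + norm (f y) * norm (g x - g y) * K"
      by (intro norm_triangle_le add_mono K)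
    also have "\<dots> \<le> (L * norm (x - y)) * C * K + B * (M * norm (x - y)) * K"
      using xy K(1) L M BC by (intro add_mono mult_right_mono mult_mono Lf Mg B C) auto
    finally show "dist (h (f x) (g x)) (h (f y) (g y)) \<le> (L * C * K + B * M * K) * dist x y"
      by (simp add: dist_norm algebra_simps)
  qed (use L M BC K in auto)
  then show thesis by (rule that)
qed

lemma trunc_rodrigues_lipschitz:
  assumes "\<mu> > 0"
  obtains L where "L-lipschitz_on (cball 0 3) (trunc_rodrigues \<mu>)"
proof -
  have "bounded_linear (\<lambda>X :: real^3^3. trace X / 4)"
    using bounded_linear_compose[OF bounded_linear_divide bounded_linear_trace] .
  then obtain M where M: "M-lipschitz_on (cball 0 3) (\<lambda>X :: real^3^3. trace X / 4)"
    using lipschitz_on_bounded_linear by blast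
  have "(1 / (2 * \<mu>\<^sup>2) * M)-lipschitz_on (cball 0 3) (\<lambda>X. inverse (2 * max (cos2_half X) \<mu>))"
  proof (rule lipschitz_onI)
    fix X Y :: "real^3^3" assume XY: "X \<in> cball 0 3" "Y \<in> cball 0 3"
    define p q where "p = max (cos2_half X) \<mu>" and "q = max (cos2_half Y) \<mu>"
    have pq: "p \<ge> \<mu>" "q \<ge> \<mu>" by (auto simp: p_def q_def)
    have "\<bar>q - p\<bar> \<le> \<bar>cos2_half X - cos2_half Y\<bar>"
      by (auto simp: p_def q_def max_def)
    also have "\<dots> \<le> M * dist X Y"
      using lipschitz_onD[OF M XY] by (simp add: cos2_half_def dist_real_def flip: diff_divide_distrib)
    finally have qp: "\<bar>q - p\<bar> \<le> M * dist X Y" .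
    have "inverse (2 * p) - inverse (2 * q) = (q - p) / (2 * (p * q))"
      using pq assms by (simp add: field_simps)
    also have "\<bar>\<dots>\<bar> = \<bar>q - p\<bar> / (2 * (p * q))"
      using pq assms by (simp add: abs_mult)
    also have "\<dots> \<le> (M * dist X Y) / (2 * \<mu>\<^sup>2)"
      using pq assms qp by (intro frac_le) (auto simp: power2_eq_square intro!: mult_mono)
    finally show "dist (inverse (2 * p)) (inverse (2 * q)) \<le> 1 / (2 * \<mu>\<^sup>2) * M * dist X Y"
      by (simp add: dist_real_def)
  qed (use lipschitz_on_nonneg[OF M] in simp)
  note inv = this
  obtain N where N: "N-lipschitz_on (cball 0 3) psi"
    using lipschitz_on_bounded_linear[OF bounded_linear_psi] .
  obtain L where "L-lipschitz_on (cball 0 3) (\<lambda>X. inverse (2 * max (cos2_half X) \<mu>) *\<^sub>R psi X)"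
    by (rule lipschitz_on_bounded_bilinear[OF bounded_bilinear_scaleR inv N]) simp
  then show thesis
    by (intro that[of L]) (simp add: trunc_rodrigues_def[abs_def])
qed

lemma closed_loop_field_lipschitz:
  assumes "\<mu> > 0"
  obtains L where "L-lipschitz_on UNIV (closed_loop_field a \<mu>)"
proof -
  obtain M where M: "M-lipschitz_on (cball 0 3) (trunc_rodrigues \<mu>)"
    using trunc_rodrigues_lipschitz[OF assms] .
  have "bounded_linear (\<lambda>z. skew (- (2 * a) *\<^sub>R z))"
    by (rule bounded_linear_compose[OF bounded_linear_skew bounded_linear_scaleR_right])
  then obtain K where K: "K-lipschitz_on UNIV (\<lambda>z. skew (- (2 * a) *\<^sub>R z))"
    using lipschitz_on_bounded_linear by blast
  have "(K * M)-lipschitz_on (cball 0 3) (\<lambda>X. skew (- (2 * a) *\<^sub>R trunc_rodrigues \<mu> X))"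
    by (rule lipschitz_on_compose2[OF M lipschitz_on_subset[OF K]]) simp
  then obtain N where N: "N-lipschitz_on (cball 0 3) (\<lambda>X. X ** skew (- (2 * a) *\<^sub>R trunc_rodrigues \<mu> X))"
    by (rule lipschitz_on_bounded_bilinear[OF bounded_bilinear_matrix_mult lipschitz_on_id]) simp_all
  have "(N * 2)-lipschitz_on UNIV (\<lambda>X. clip X ** skew (- (2 * a) *\<^sub>R trunc_rodrigues \<mu> (clip X)))"
    using norm_clip_le
    by (intro lipschitz_on_compose2[OF clip_lipschitz lipschitz_on_subset[OF N]]) auto
  then show thesis
    by (intro that[of "N * 2"]) (simp add: closed_loop_field_def[abs_def])
qed

lemma closed_loop_rhs_lipschitz:
  assumes "\<mu> > 0" "D \<ge> 0"
  obtains K where "K \<ge> 0"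
    "\<And>d X Y. norm d \<le> D \<Longrightarrow> norm ((closed_loop_field a \<mu> X - skew d ** X) - (closed_loop_field a \<mu> Y - skew d ** Y))
      \<le> K * norm (X - Y)"
proof -
  obtain L where L: "L-lipschitz_on UNIV (closed_loop_field a \<mu>)"
    using closed_loop_field_lipschitz[OF assms(1)] .
  have "bounded_bilinear (\<lambda>d X. skew d ** (X :: real^3^3))"
    by (rule bounded_bilinear.comp1[OF bounded_bilinear_matrix_mult bounded_linear_skew])
  then obtain C where C: "C \<ge> 0" "\<And>d (X :: real^3^3). norm (skew d ** X) \<le> norm d * norm X * C"
    using bounded_bilinear.nonneg_bounded by blast
  show thesis
  proof (rule that[of "L + D * C"])
    show "L + D * C \<ge> 0" using lipschitz_on_nonneg[OF L] C assms by simp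
    fix d :: "real^3" and X Y :: "real^3^3" assume d: "norm d \<le> D"
    have "(closed_loop_field a \<mu> X - skew d ** X) - (closed_loop_field a \<mu> Y - skew d ** Y)
        = (closed_loop_field a \<mu> X - closed_loop_field a \<mu> Y) - skew d ** (X - Y)"
      by (simp add: matrix_mult.diff_right)
    also have "norm \<dots> \<le> norm (closed_loop_field a \<mu> X - closed_loop_field a \<mu> Y) + norm (skew d ** (X - Y))"
      by (rule norm_triangle_ineq4)
    also have "norm (closed_loop_field a \<mu> X - closed_loop_field a \<mu> Y) \<le> L * norm (X - Y)"
      using lipschitz_onD[OF L] by (simp add: dist_norm)
    also have "norm (skew d ** (X - Y)) \<le> norm d * norm (X - Y) * C" by (rule C)
    also have "\<dots> \<le> D * norm (X - Y) * C"
      using d C(1) by (intro mult_right_mono) auto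
    finally show "norm ((closed_loop_field a \<mu> X - skew d ** X) - (closed_loop_field a \<mu> Y - skew d ** Y))
        \<le> (L + D * C) * norm (X - Y)"
      by (simp add: algebra_simps)
  qed
qed

lemma closed_loop_field_SO3:
  assumes "Q \<in> SO3" "Q \<notin> Pi_set" "\<mu> \<le> cos2_half Q"
  shows "closed_loop_field a \<mu> Q = Q ** skew (- (2 * a) *\<^sub>R rodrigues Q)"
  by (simp add: closed_loop_field_def clip_SO3 trunc_rodrigues_eq assms)

text \<open>
  On the compact interval both solutions keep a positive distance from \<open>\<Pi>\<close>, so they solve the same
  globally Lipschitz truncated equation.
\<close>

lemma closed_loop_error_unique:
  assumes Q: "has_rate_on T Q (\<lambda>t. Q t ** skew (- (2 * a) *\<^sub>R rodrigues (Q t)) - skew (d t) ** Q t)"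
      "\<And>t. t \<in> {0..T} \<Longrightarrow> Q t \<in> SO3" "\<And>t. t \<in> {0..T} \<Longrightarrow> Q t \<notin> Pi_set"
    and P: "has_rate_on T P (\<lambda>t. P t ** skew (- (2 * a) *\<^sub>R rodrigues (P t)) - skew (d t) ** P t)"
      "\<And>t. t \<in> {0..T} \<Longrightarrow> P t \<in> SO3" "\<And>t. t \<in> {0..T} \<Longrightarrow> P t \<notin> Pi_set"
    and init: "Q 0 = P 0" and D: "D \<ge> 0" "\<And>t. t \<in> {0..T} \<Longrightarrow> norm (d t) \<le> D" and t: "t \<in> {0..T}"
  shows "Q t = P t"
proof -
  obtain \<mu>1 where \<mu>1: "\<mu>1 > 0" "\<And>t. t \<in> {0..T} \<Longrightarrow> \<mu>1 \<le> cos2_half (Q t)"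
    using cos2_half_uniformly_pos[OF has_rate_on_continuous[OF Q(1)] Q(2,3)] by blast
  obtain \<mu>2 where \<mu>2: "\<mu>2 > 0" "\<And>t. t \<in> {0..T} \<Longrightarrow> \<mu>2 \<le> cos2_half (P t)"
    using cos2_half_uniformly_pos[OF has_rate_on_continuous[OF P(1)] P(2,3)] by blast
  define \<mu> where "\<mu> = min \<mu>1 \<mu>2"
  have \<mu>: "\<mu> > 0" "\<mu> \<le> cos2_half (Q t)" "\<mu> \<le> cos2_half (P t)" if "t \<in> {0..T}" for t
    using \<mu>1(1) \<mu>2(1) \<mu>1(2)[OF that] \<mu>2(2)[OF that] by (auto simp: \<mu>_def)
  obtain K where K: "K \<ge> 0"
    "\<And>d X Y. norm d \<le> D \<Longrightarrow> norm ((closed_loop_field a \<mu> X - skew d ** X) - (closed_loop_field a \<mu> Y - skew d ** Y))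
      \<le> K * norm (X - Y)"
    using closed_loop_rhs_lipschitz[of \<mu> D a] \<mu>(1)[OF t] D(1) by blast
  show ?thesis
  proof (rule has_rate_on_unique[OF Q(1) P(1) init K(1) _ t])
    fix t assume t: "t \<in> {0..T}"
    show "norm ((Q t ** skew (- (2 * a) *\<^sub>R rodrigues (Q t)) - skew (d t) ** Q t)
        - (P t ** skew (- (2 * a) *\<^sub>R rodrigues (P t)) - skew (d t) ** P t)) \<le> K * norm (Q t - P t)"
      using K(2)[OF D(2)[OF t], of "Q t" "P t"]
      by (simp only: closed_loop_field_SO3[OF Q(2)[OF t] Q(3)[OF t] \<mu>(2)[OF t]]
          closed_loop_field_SO3[OF P(2)[OF t] P(3)[OF t] \<mu>(3)[OF t]])
  qed
qed

text \<open>
  The matrix \<open>P = Q Q\<^sup>T\<close> solves the linear equation \<open>P' = P [d] - [d] P\<close>, which the identity solves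
  too; by uniqueness \<open>P = I\<close>. The determinant then takes only the values \<open>1\<close> and \<open>- 1\<close> and cannot jump.
\<close>

lemma rate_in_SO3:
  assumes T: "T \<ge> 0" and Q: "has_rate_on T Q (\<lambda>t. Q t ** skew (s t) - skew (d t) ** Q t)"
    and Q0: "Q 0 \<in> SO3" and D: "D \<ge> 0" "\<And>t. t \<in> {0..T} \<Longrightarrow> norm (d t) \<le> D" and t: "t \<in> {0..T}"
  shows "Q t \<in> SO3"
proof -
  let ?P = "\<lambda>t. Q t ** transpose (Q t)"
  have P: "has_rate_on T ?P (\<lambda>t. ?P t ** skew (d t) - skew (d t) ** ?P t)"
    by (rule has_rate_on_cong[OF has_rate_on_bilinear[OF bounded_bilinear_matrix_mult Q
            has_rate_on_linear[OF bounded_linear_transpose Q]]])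
      (simp_all add: transpose_diff matrix_transpose_mul transpose_skew matrix_mult.diff_left matrix_mult.diff_right
        matrix_mult.minus_left matrix_mult.minus_right matrix_mul_assoc)
  have "bounded_bilinear (\<lambda>d X. skew d ** (X :: real^3^3))"
    by (rule bounded_bilinear.comp1[OF bounded_bilinear_matrix_mult bounded_linear_skew])
  then obtain C where C: "C \<ge> 0" "\<And>d (X :: real^3^3). norm (skew d ** X) \<le> norm d * norm X * C"
    using bounded_bilinear.nonneg_bounded by blast
  have "bounded_bilinear (\<lambda>d X. (X :: real^3^3) ** skew d)"
    using bounded_bilinear.comp1[OF bounded_bilinear.flip[OF bounded_bilinear_matrix_mult] bounded_linear_skew] .
  then obtain C' where C': "C' \<ge> 0" "\<And>d (X :: real^3^3). norm (X ** skew d) \<le> norm d * norm X * C'"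
    using bounded_bilinear.nonneg_bounded by blast
  have orth: "?P t = mat 1" if t: "t \<in> {0..T}" for t
  proof (rule has_rate_on_unique[OF P has_rate_on_const _ _ _ t, where K = "D * C' + D * C"])
    show "Q 0 ** transpose (Q 0) = mat 1" using Q0 by (rule SO3_mult_trans)
    fix r assume r: "r \<in> {0..T}"
    let ?E = "?P r - mat 1"
    have "(?P r ** skew (d r) - skew (d r) ** ?P r) - 0 = ?E ** skew (d r) - skew (d r) ** ?E"
      by (simp add: matrix_mult.diff_left matrix_mult.diff_right)
    also have "norm \<dots> \<le> norm (?E ** skew (d r)) + norm (skew (d r) ** ?E)"
      by (rule norm_triangle_ineq4)
    also have "\<dots> \<le> norm (d r) * norm ?E * C' + norm (d r) * norm ?E * C"
      by (intro add_mono C C')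
    also have "\<dots> \<le> D * norm ?E * C' + D * norm ?E * C"
      using D(2)[OF r] C(1) C'(1) by (intro add_mono mult_right_mono) auto
    finally show "norm ((?P r ** skew (d r) - skew (d r) ** ?P r) - 0) \<le> (D * C' + D * C) * norm ?E"
      by (simp add: algebra_simps)
  qed (use D C C' in simp)
  have sq: "det (Q r) * det (Q r) = 1" if "r \<in> {0..T}" for r
    using arg_cong[OF orth[OF that], of det] by (simp add: det_mul det_transpose)
  have "continuous_on {0..T} (\<lambda>r. det (Q r))"
    unfolding det_3 by (intro continuous_intros has_rate_on_continuous[OF Q])
  then have c: "continuous_on {0..t} (\<lambda>r. det (Q r))"
    using t by (auto elim: continuous_on_subset)
  have "det (Q t) = 1"
  proof (rule ccontr)
    assume "det (Q t) \<noteq> 1"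
    then have "det (Q t) = -1" using sq[OF t] by (simp add: square_eq_1_iff)
    then have "\<exists>r. 0 \<le> r \<and> r \<le> t \<and> det (Q r) = 0"
      using Q0 t c by (intro IVT2') (auto simp: SO3_def)
    then show False using sq t by force
  qed
  then show ?thesis using orth[OF t] by (simp add: SO3_def)
qed

text \<open>
  For the truncated equation the potential has the rate
  \<open>- 4 a |\<zeta>|\<^sup>2 - 2 (\<zeta> \<bullet> Q\<^sup>T d) \<le> D\<^sup>2 / (4 a)\<close>, hence it is at most \<open>C\<close> up to the time \<open>T\<close>. The level
  \<open>\<mu>\<close> is chosen such that the potential exceeds \<open>C\<close> wherever \<open>cos2_half\<close> is below \<open>\<mu>\<close>. Thus the
  solution never enters the truncated region and solves the original equation.
\<close>

lemma closed_loop_error_exists: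
  assumes T: "T \<ge> 0" and a: "a > 0" and d: "d absolutely_integrable_on {0..T}"
    and D: "D \<ge> 0" "\<And>t. t \<in> {0..T} \<Longrightarrow> norm (d t) \<le> D" and Q0: "Q0 \<in> SO3" "Q0 \<notin> Pi_set"
  obtains Q where "Q 0 = Q0" "\<And>t. t \<in> {0..T} \<Longrightarrow> Q t \<in> SO3" "\<And>t. t \<in> {0..T} \<Longrightarrow> Q t \<notin> Pi_set"
    "has_rate_on T Q (\<lambda>t. Q t ** skew (- (2 * a) *\<^sub>R rodrigues (Q t)) - skew (d t) ** Q t)"
proof -
  define C where "C = - 2 * ln (cos2_half Q0) + D\<^sup>2 / (4 * a) * T"
  define \<mu> where "\<mu> = exp (- C / 2)"
  have \<mu>: "\<mu> > 0" and ln_\<mu>: "- 2 * ln \<mu> = C" by (simp_all add: \<mu>_def)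
  have m0: "cos2_half Q0 > 0" using Q0 by (rule cos2_half_pos)
  have "- 2 * ln (cos2_half Q0) \<le> C" using T a by (simp add: C_def)
  then have "ln \<mu> \<le> ln (cos2_half Q0)" using ln_\<mu> by simp
  then have \<mu>_le: "\<mu> \<le> cos2_half Q0" using \<mu> m0 by simp
  obtain K where K: "K \<ge> 0"
    "\<And>d X Y. norm d \<le> D \<Longrightarrow> norm ((closed_loop_field a \<mu> X - skew d ** X) - (closed_loop_field a \<mu> Y - skew d ** Y))
      \<le> K * norm (X - Y)"
    using closed_loop_rhs_lipschitz[of \<mu> D a] \<mu> D(1) by blast
  obtain L where L: "L-lipschitz_on UNIV (closed_loop_field a \<mu>)"
    using closed_loop_field_lipschitz[OF \<mu>] .
  have bil: "bounded_bilinear (\<lambda>(X :: real^3^3) d. skew d ** X)"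
    using bounded_bilinear.flip[OF bounded_bilinear.comp1[OF bounded_bilinear_matrix_mult bounded_linear_skew]] .
  obtain Q where Q: "Q 0 = Q0" "has_rate_on T Q (\<lambda>t. closed_loop_field a \<mu> (Q t) - skew (d t) ** Q t)"
  proof (rule picard_lindelof_caratheodory[of T K "\<lambda>t X. closed_loop_field a \<mu> X - skew (d t) ** X" Q0])
    fix x :: "real \<Rightarrow> real^3^3" assume x: "continuous_on {0..T} x"
    have "continuous_on {0..T} (\<lambda>t. closed_loop_field a \<mu> (x t))"
      using continuous_on_compose2[OF lipschitz_on_continuous_on[OF L] x] by simp
    then have "(\<lambda>t. closed_loop_field a \<mu> (x t)) absolutely_integrable_on {0..T}"
      by (rule absolutely_integrable_continuous_real)
    moreover have "(\<lambda>t. skew (d t) ** x t) absolutely_integrable_on {0..T}"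
      by (rule absolutely_integrable_bilinear_continuous[OF bil x d])
    ultimately show "(\<lambda>t. closed_loop_field a \<mu> (x t) - skew (d t) ** x t) absolutely_integrable_on {0..T}"
      by (rule set_integral_diff)
  qed (use T K D in auto)
  \<comment> \<open>Radial clipping only rescales the rate \<open>s\<close>, so \<open>Q\<close> stays in \<open>SO(3)\<close>.\<close>
  define s where "s t = (1 / max 1 (norm (Q t) / 3)) *\<^sub>R (- (2 * a) *\<^sub>R trunc_rodrigues \<mu> (clip (Q t)))" for t
  have "closed_loop_field a \<mu> (Q t) = Q t ** skew (s t)" for t
    unfolding closed_loop_field_def s_def linear_cmul[OF linear_skew] matrix_mult.scaleR_right
    by (simp add: clip_def matrix_mult.scaleR_left matrix_mult.scaleR_right inverse_eq_divide)
  then have "has_rate_on T Q (\<lambda>t. Q t ** skew (s t) - skew (d t) ** Q t)"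
    using Q(2) by simp
  then have SO3: "Q t \<in> SO3" if "t \<in> {0..T}" for t
    using rate_in_SO3[OF T] Q(1) Q0(1) D that by blast
  define \<zeta> where "\<zeta> t = trunc_rodrigues \<mu> (Q t)" for t
  define u where "u t = - (2 * a) *\<^sub>R \<zeta> t - transpose (Q t) *v d t" for t
  have Qu: "has_rate_on T Q (\<lambda>t. Q t ** skew (u t))"
  proof (rule has_rate_on_cong[OF Q(2) refl])
    fix t assume t: "t \<in> {0..T}"
    have "skew (d t) ** Q t = Q t ** skew (transpose (Q t) *v d t)"
      by (simp add: SO3_mult_skew[OF SO3[OF t]] matrix_vector_mul_assoc SO3_mult_trans[OF SO3[OF t]]
          del: transpose_matrix_vector)
    then show "Q t ** skew (u t) = closed_loop_field a \<mu> (Q t) - skew (d t) ** Q t"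
      by (simp add: u_def skew_diff matrix_mult.diff_right closed_loop_field_def clip_SO3[OF SO3[OF t]] \<zeta>_def
          del: transpose_matrix_vector)
  qed
  note rate = trunc_potential_rate[OF Qu \<mu>, folded \<zeta>_def]
  have low: "\<mu> \<le> cos2_half (Q t)" if t: "t \<in> {0..T}" for t
  proof (rule ccontr)
    assume neg: "\<not> \<mu> \<le> cos2_half (Q t)"
    have "trunc_potential \<mu> (cos2_half (Q t)) = trunc_potential \<mu> (cos2_half (Q 0)) + integral {0..t} (\<lambda>r. 2 * (\<zeta> r \<bullet> u r))"
      by (rule has_rate_on_initial[OF rate t])
    also have "trunc_potential \<mu> (cos2_half (Q 0)) = - 2 * ln (cos2_half Q0)"
      using \<mu> \<mu>_le by (simp add: Q trunc_potential_eq)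
    also have "integral {0..t} (\<lambda>r. 2 * (\<zeta> r \<bullet> u r)) \<le> integral {0..t} (\<lambda>r. D\<^sup>2 / (4 * a))"
    proof (rule integral_le)
      show "(\<lambda>r. 2 * (\<zeta> r \<bullet> u r)) integrable_on {0..t}"
        using has_rate_on_integrable[OF has_rate_on_subinterval[OF rate, of t]] t
        by (simp add: absolutely_integrable_on_def)
      fix r assume r: "r \<in> {0..t}"
      define e where "e = transpose (Q r) *v d r"
      have "norm e = norm (d r)"
        using r t by (simp add: e_def norm_SO3_mult transpose_SO3 SO3 del: transpose_matrix_vector)
      then have "norm e \<le> D" using D(2)[of r] r t by simp
      then have "(norm e)\<^sup>2 \<le> D\<^sup>2" by (rule power_mono) simp
      then have "e \<bullet> e / (4 * a) \<le> D\<^sup>2 / (4 * a)"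
        using a by (intro divide_right_mono) (simp_all add: power2_norm_eq_inner)
      moreover have "2 * (\<zeta> r \<bullet> u r) = e \<bullet> e / (4 * a) - a * (norm ((1 / (2 * a)) *\<^sub>R e + 2 *\<^sub>R \<zeta> r))\<^sup>2"
        using a unfolding power2_norm_eq_inner
        by (simp add: u_def e_def[symmetric] inner_simps inner_commute field_simps del: transpose_matrix_vector)
      ultimately show "2 * (\<zeta> r \<bullet> u r) \<le> D\<^sup>2 / (4 * a)"
        using mult_nonneg_nonneg[OF less_imp_le[OF a] zero_le_power2[of "norm ((1 / (2 * a)) *\<^sub>R e + 2 *\<^sub>R \<zeta> r)"]]
        by linarith
    qed (rule integrable_const_ivl)
    also have "integral {0..t} (\<lambda>r. D\<^sup>2 / (4 * a)) \<le> D\<^sup>2 / (4 * a) * T"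
      using t a by (simp add: mult.commute mult_right_mono divide_right_mono)
    finally have "trunc_potential \<mu> (cos2_half (Q t)) \<le> C" by (simp add: C_def)
    moreover have "trunc_potential \<mu> (cos2_half (Q t)) > - 2 * ln \<mu>"
      using neg \<mu> by (simp add: trunc_potential_def max_def pos_divide_less_eq)
    ultimately show False using ln_\<mu> by simp
  qed
  have nPi: "Q t \<notin> Pi_set" if "t \<in> {0..T}" for t
    using low[OF that] \<mu> by (auto simp: Pi_set_iff)
  have "has_rate_on T Q (\<lambda>t. Q t ** skew (- (2 * a) *\<^sub>R rodrigues (Q t)) - skew (d t) ** Q t)"
    by (rule has_rate_on_cong[OF Q(2) refl]) (simp only: closed_loop_field_SO3[OF SO3 nPi low])
  with Q(1) SO3 nPi show thesis by (rule that)
qed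

section \<open>Limits and integrals over the half-line\<close>

lemma antimono_tendsto_ereal:
  fixes f :: "real \<Rightarrow> real"
  assumes "\<And>s t. 0 \<le> s \<Longrightarrow> s \<le> t \<Longrightarrow> f t \<le> f s"
  shows "((\<lambda>t. ereal (f t)) \<longlongrightarrow> (INF t\<in>{0..}. ereal (f t))) at_top"
proof (rule order_tendstoI)
  fix a assume a: "a < (INF t\<in>{0..}. ereal (f t))"
  show "eventually (\<lambda>t. a < ereal (f t)) at_top"
    using eventually_ge_at_top[of 0]
  proof eventually_elim
    case (elim t)
    then have "(INF t\<in>{0..}. ereal (f t)) \<le> ereal (f t)" by (intro INF_lower) simp
    then show ?case using a by (rule less_le_trans[rotated])
  qed
next
  fix a assume "(INF t\<in>{0..}. ereal (f t)) < a"
  then obtain s where s: "s \<ge> 0" "ereal (f s) < a" by (auto simp: INF_less_iff)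
  show "eventually (\<lambda>t. ereal (f t) < a) at_top"
    using eventually_ge_at_top[of s]
  proof eventually_elim
    case (elim t)
    then have "ereal (f t) \<le> ereal (f s)" using assms[OF s(1)] by simp
    then show ?case using s(2) by (rule le_less_trans)
  qed
qed

lemma nn_integral_atLeast_eq_SUP:
  fixes f :: "real \<Rightarrow> real"
  assumes int: "\<And>T. T \<ge> 0 \<Longrightarrow> f absolutely_integrable_on {0..T}" and nonneg: "\<And>t. f t \<ge> 0"
  shows "(\<integral>\<^sup>+t\<in>{0..}. ennreal (f t) \<partial>lebesgue) = (SUP k. ennreal (integral {0..real k} f))"
proof -
  have i: "integrable lebesgue (\<lambda>t. indicator {0..real k} t *\<^sub>R f t)" for k
    using int[of "real k"] by (simp add: set_integrable_def)
  have e: "ennreal (indicator {0..real k} t *\<^sub>R f t) = ennreal (f t) * indicator {0..real k} t" for k t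
    by (simp add: indicator_def)
  have "(\<integral>\<^sup>+t. ennreal (f t) * indicator {0..real k} t \<partial>lebesgue) = ennreal (integral {0..real k} f)" for k
  proof -
    have "(\<integral>\<^sup>+t. ennreal (indicator {0..real k} t *\<^sub>R f t) \<partial>lebesgue)
        = ennreal (integral\<^sup>L lebesgue (\<lambda>t. indicator {0..real k} t *\<^sub>R f t))"
      using i nonneg by (intro nn_integral_eq_integral) (auto simp: indicator_def)
    also have "integral\<^sup>L lebesgue (\<lambda>t. indicator {0..real k} t *\<^sub>R f t) = integral {0..real k} f"
      using set_lebesgue_integral_eq_integral(2)[OF int[of "real k"]] by (simp add: set_lebesgue_integral_def)
    finally show ?thesis unfolding e .
  qed
  moreover have "(\<integral>\<^sup>+t. (SUP k. ennreal (f t) * indicator {0..real k} t) \<partial>lebesgue)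
      = (SUP k. \<integral>\<^sup>+t. ennreal (f t) * indicator {0..real k} t \<partial>lebesgue)"
  proof (rule nn_integral_monotone_convergence_SUP)
    show "incseq (\<lambda>k t. ennreal (f t) * indicator {0..real k} t)"
      by (auto simp: incseq_def le_fun_def indicator_def)
    show "(\<lambda>t. ennreal (f t) * indicator {0..real k} t) \<in> borel_measurable lebesgue" for k
      using borel_measurable_integrable[OF i[of k]] unfolding e[symmetric] by measurable
  qed
  moreover have "(SUP k. ennreal (f t) * indicator {0..real k} t) = ennreal (f t) * indicator {0..} t" for t
  proof (rule antisym)
    show "(SUP k. ennreal (f t) * indicator {0..real k} t) \<le> ennreal (f t) * indicator {0..} t"
      by (intro SUP_least) (auto simp: indicator_def)
    obtain k :: nat where "t \<le> real k" using real_arch_simple by blast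
    then have "ennreal (f t) * indicator {0..} t \<le> ennreal (f t) * indicator {0..real k} t"
      by (auto simp: indicator_def)
    also have "\<dots> \<le> (SUP k. ennreal (f t) * indicator {0..real k} t)"
      by (intro SUP_upper) simp
    finally show "ennreal (f t) * indicator {0..} t \<le> (SUP k. ennreal (f t) * indicator {0..real k} t)" .
  qed
  ultimately show ?thesis by simp
qed

lemma bounded_bilinear_matrix_vector_mult:
  "bounded_bilinear ((*v) :: real^'n^'m \<Rightarrow> real^'n \<Rightarrow> real^'m)"
  unfolding bilinear_conv_bounded_bilinear[symmetric] bilinear_def
  by (auto intro!: linearI simp: vec_eq_iff matrix_vector_mult_def algebra_simps sum.distrib sum_distrib_left)

section \<open>The disturbance attenuation game\<close>

locale attitude_observer =
  fixes a \<gamma> :: real and \<omega> :: "real \<Rightarrow> real^3" and R :: "real \<Rightarrow> real^3^3" and Rh0 :: "real^3^3"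
  assumes a: "a > 0" and gain: "\<gamma>\<^sup>2 > 1 / (2 * a)"
    and kin: "attitude_kinematics \<omega> R"
    and Rh0: "Rh0 \<in> SO3" and err0: "R 0 ** transpose Rh0 \<in> SO3 - Pi_set"
begin

abbreviation "Q0 \<equiv> R 0 ** transpose Rh0"
abbreviation "V0 \<equiv> 2 * ln (1 + (norm (rodrigues Q0))\<^sup>2)"
abbreviation "opt \<equiv> innov (a *\<^sub>R mat 1)"

lemma gamma_sq_pos: "\<gamma>\<^sup>2 > 0"
  using gain a by (meson divide_pos_pos less_trans mult_pos_pos zero_less_numeral zero_less_one)

lemma gamma_nz: "\<gamma> \<noteq> 0"
  using gamma_sq_pos by auto

lemma weight_pos: "2 * a - 1 / \<gamma>\<^sup>2 > 0"
  using gain a gamma_sq_pos by (simp add: field_simps)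

lemma R_SO3: "t \<ge> 0 \<Longrightarrow> R t \<in> SO3"
  using kin by (simp add: attitude_kinematics_def)

lemma R_rate: "has_rate_on T R (\<lambda>t. R t ** skew (\<omega> t))"
proof (cases "T \<ge> 0")
  case True
  then show ?thesis using kin by (simp add: attitude_kinematics_def)
next
  case False
  then show ?thesis by (intro has_rate_onI) auto
qed

lemma V0_eq: "V0 = - 2 * ln (cos2_half Q0)"
  using log_cost_eq[of Q0] err0 by simp

lemma V0_nonneg: "V0 \<ge> 0"
  by simp

context
  fixes T \<sigma> n Rh
  assumes obs: "observer_on T \<sigma> \<omega> R Rh0 n Rh"
begin

lemma Rh_SO3: "t \<in> {0..T} \<Longrightarrow> Rh t \<in> SO3"
  using obs by (simp add: observer_on_def)

lemma error_SO3: "t \<in> {0..T} \<Longrightarrow> att_err R Rh t \<in> SO3"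
  using Rh_SO3[of t] R_SO3[of t] by (simp add: att_err_SO3)

lemma error_not_Pi: "t \<in> {0..T} \<Longrightarrow> att_err R Rh t \<notin> Pi_set"
  using obs by (simp add: observer_on_def)

lemma error_0: "att_err R Rh 0 = Q0"
  using obs by (simp add: observer_on_def att_err_def)

lemma Rh_rate:
  "has_rate_on T Rh (\<lambda>t. Rh t ** skew (\<omega> t + n t) - skew (sigma_signal \<sigma> \<omega> R n Rh t) ** Rh t)"
  using obs by (simp add: observer_on_def)

lemma error_rate:
  "has_rate_on T (att_err R Rh) (\<lambda>t. att_err R Rh t ** skew (sigma_signal \<sigma> \<omega> R n Rh t - Rh t *v n t))"
  by (rule att_err_rate[OF R_rate Rh_rate Rh_SO3])

lemma error_continuous: "continuous_on {0..T} (att_err R Rh)"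
  using error_rate by (rule has_rate_on_continuous)

text \<open>
  The true terminal cost is bounded below by the truncated potential at the final time, and the rate
  of the latter plus the running cost is bounded below pointwise by \<open>game_identity\<close>. The
  estimate is uniform in the innovation term.
\<close>

lemma cost_lower_bound:
  assumes T: "T \<ge> 0" and run: "running_cost a \<gamma> \<sigma> \<omega> R n Rh absolutely_integrable_on {0..T}"
    and near: "\<And>t. t \<in> {0..T} \<Longrightarrow> norm (n t + (1 / \<gamma>\<^sup>2) *\<^sub>R
        (transpose (Rh t) *v trunc_rodrigues (cos2_half Q0) (att_err R Rh t))) \<le> \<epsilon> t"
    and eps: "(\<lambda>t. (\<epsilon> t)\<^sup>2) integrable_on {0..T}"
  shows "V0 - \<gamma>\<^sup>2 * integral {0..T} (\<lambda>t. (\<epsilon> t)\<^sup>2) \<le> cost_upto a \<gamma> \<sigma> \<omega> R n Rh T"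
proof -
  let ?Q = "att_err R Rh" and ?\<mu> = "cos2_half Q0" and ?run = "running_cost a \<gamma> \<sigma> \<omega> R n Rh"
  let ?\<zeta> = "\<lambda>t. trunc_rodrigues ?\<mu> (?Q t)" and ?s = "sigma_signal \<sigma> \<omega> R n Rh"
  let ?r = "\<lambda>t. 2 * (?\<zeta> t \<bullet> (?s t - Rh t *v n t))"
  have T': "T \<in> {0..T}" using T by simp
  have \<mu>: "?\<mu> > 0" using err0 by (intro cos2_half_pos) auto
  note rate = trunc_potential_rate[OF error_rate \<mu>]
  have ir: "?r integrable_on {0..T}"
    using has_rate_on_integrable[OF rate] by (simp add: absolutely_integrable_on_def)
  have irun: "?run integrable_on {0..T}"
    using run by (simp add: absolutely_integrable_on_def)
  have "- \<gamma>\<^sup>2 * integral {0..T} (\<lambda>t. (\<epsilon> t)\<^sup>2) = integral {0..T} (\<lambda>t. - \<gamma>\<^sup>2 * (\<epsilon> t)\<^sup>2)"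
    by simp
  also have "\<dots> \<le> integral {0..T} (\<lambda>t. ?r t + ?run t)"
  proof (rule integral_le)
    show "(\<lambda>t. - \<gamma>\<^sup>2 * (\<epsilon> t)\<^sup>2) integrable_on {0..T}" using eps by (rule integrable_on_mult_right)
    show "(\<lambda>t. ?r t + ?run t) integrable_on {0..T}" using ir irun by (rule integrable_add)
    fix t assume t: "t \<in> {0..T}"
    let ?z = "rodrigues (?Q t)"
    let ?e = "norm (n t + (1 / \<gamma>\<^sup>2) *\<^sub>R (transpose (Rh t) *v ?\<zeta> t))"
    have "norm (?\<zeta> t) \<le> norm ?z"
      by (rule norm_trunc_rodrigues_le[OF error_SO3[OF t] error_not_Pi[OF t] \<mu>])
    then have "(norm (?\<zeta> t))\<^sup>2 \<le> (norm ?z)\<^sup>2" by (rule power_mono) simp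
    then have "(2 * a - 1 / \<gamma>\<^sup>2) * ((norm ?z)\<^sup>2 - (norm (?\<zeta> t))\<^sup>2) \<ge> 0"
      using weight_pos by simp
    moreover have "1 / (2 * a) * (norm (?s t + (2 * a) *\<^sub>R ?\<zeta> t))\<^sup>2 \<ge> 0"
      using a by simp
    moreover have "?e\<^sup>2 \<le> (\<epsilon> t)\<^sup>2"
      using near[OF t] by (rule power_mono) simp
    then have "\<gamma>\<^sup>2 * ?e\<^sup>2 \<le> \<gamma>\<^sup>2 * (\<epsilon> t)\<^sup>2"
      by (rule mult_left_mono) simp
    moreover have "?r t + ?run t = 1 / (2 * a) * (norm (?s t + (2 * a) *\<^sub>R ?\<zeta> t))\<^sup>2
        + (2 * a - 1 / \<gamma>\<^sup>2) * ((norm ?z)\<^sup>2 - (norm (?\<zeta> t))\<^sup>2) - \<gamma>\<^sup>2 * ?e\<^sup>2"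
      unfolding running_cost_def Let_def by (rule game_identity[OF a gamma_nz Rh_SO3[OF t]])
    ultimately show "- \<gamma>\<^sup>2 * (\<epsilon> t)\<^sup>2 \<le> ?r t + ?run t"
      by linarith
  qed
  also have "\<dots> = integral {0..T} ?r + integral {0..T} ?run"
    using ir irun by (rule integral_add)
  finally have main: "- \<gamma>\<^sup>2 * integral {0..T} (\<lambda>t. (\<epsilon> t)\<^sup>2) \<le> integral {0..T} ?r + integral {0..T} ?run" .
  have "trunc_potential ?\<mu> (cos2_half (?Q T)) = trunc_potential ?\<mu> (cos2_half (?Q 0)) + integral {0..T} ?r"
    by (rule has_rate_on_initial[OF rate T'])
  moreover have "trunc_potential ?\<mu> (cos2_half (?Q 0)) = V0"
    unfolding error_0 V0_eq using \<mu> by (simp add: trunc_potential_eq)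
  moreover have "trunc_potential ?\<mu> (cos2_half (?Q T)) \<le> 2 * ln (1 + (norm (rodrigues (?Q T)))\<^sup>2)"
    unfolding log_cost_eq[OF error_SO3[OF T'] error_not_Pi[OF T']]
    by (rule trunc_potential_le[OF \<mu> cos2_half_pos[OF error_SO3[OF T'] error_not_Pi[OF T']]])
  ultimately show ?thesis
    using main unfolding cost_upto_def by linarith
qed

end

context
  fixes T n Rh
  assumes obs: "observer_on T opt \<omega> R Rh0 n Rh" and n: "n \<in> disturbances"
begin

lemma opt_signal: "t \<in> {0..T} \<Longrightarrow> sigma_signal opt \<omega> R n Rh t = - (2 * a) *\<^sub>R rodrigues (att_err R Rh t)"
  unfolding sigma_signal_def by (rule innov_scaled_id[OF error_SO3[OF obs] error_not_Pi[OF obs]])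

lemma rodrigues_continuous: "continuous_on {0..T} (\<lambda>t. rodrigues (att_err R Rh t))"
  using error_continuous[OF obs] error_SO3[OF obs] error_not_Pi[OF obs]
  by (rule continuous_on_rodrigues)

lemma rodrigues_square_integrable:
  "(\<lambda>t. rodrigues (att_err R Rh t) \<bullet> rodrigues (att_err R Rh t)) absolutely_integrable_on {0..T}"
  by (intro absolutely_integrable_continuous_real continuous_intros rodrigues_continuous)

lemma opt_running_cost:
  assumes t: "t \<in> {0..T}"
  shows "running_cost a \<gamma> opt \<omega> R n Rh t
    = (4 * a - 1 / \<gamma>\<^sup>2) * (rodrigues (att_err R Rh t) \<bullet> rodrigues (att_err R Rh t)) - \<gamma>\<^sup>2 * (n t \<bullet> n t)"
proof -
  have "1 / (2 * a) * ((- (2 * a) *\<^sub>R z) \<bullet> (- (2 * a) *\<^sub>R z)) = 2 * a * (z \<bullet> z)" for z :: "real^3"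
    using a by simp
  then show ?thesis
    unfolding running_cost_def Let_def opt_signal[OF t] by (simp only: left_diff_distrib)
qed

lemma opt_running_integrable: "running_cost a \<gamma> opt \<omega> R n Rh absolutely_integrable_on {0..T}"
proof -
  have "(\<lambda>t. (4 * a - 1 / \<gamma>\<^sup>2) * (rodrigues (att_err R Rh t) \<bullet> rodrigues (att_err R Rh t)) - \<gamma>\<^sup>2 * (n t \<bullet> n t))
      absolutely_integrable_on {0..T}"
    by (intro set_integral_diff set_integrable_mult_right rodrigues_square_integrable disturbance_square_integrable n)
  then show ?thesis
    by (rule absolutely_integrable_spike[of _ _ "{}"]) (simp_all add: opt_running_cost)
qed

text \<open>
  Against \<open>\<sigma> = - 2 a z\<close> the cost is the initial value minus what the disturbance loses by deviating
  from its optimal feedback.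
\<close>

lemma opt_cost_eq:
  assumes T: "T \<ge> 0"
  defines "e \<equiv> \<lambda>t. (norm (n t + (1 / \<gamma>\<^sup>2) *\<^sub>R (transpose (Rh t) *v rodrigues (att_err R Rh t))))\<^sup>2"
  shows "e integrable_on {0..T}" "cost_upto a \<gamma> opt \<omega> R n Rh T = V0 - \<gamma>\<^sup>2 * integral {0..T} e"
proof -
  let ?Q = "att_err R Rh" and ?run = "running_cost a \<gamma> opt \<omega> R n Rh"
  let ?r = "\<lambda>t. 2 * (rodrigues (?Q t) \<bullet> (sigma_signal opt \<omega> R n Rh t - Rh t *v n t))"
  have T': "T \<in> {0..T}" using T unfolding atLeastAtMost_iff by simp
  note rate = log_cost_rate[OF error_rate[OF obs] error_SO3[OF obs] error_not_Pi[OF obs]]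
  have ir: "?r integrable_on {0..T}"
    using has_rate_on_integrable[OF rate] by (simp add: absolutely_integrable_on_def)
  have irun: "?run integrable_on {0..T}"
    using opt_running_integrable by (simp add: absolutely_integrable_on_def)
  have id: "?r t + ?run t = - \<gamma>\<^sup>2 * e t" if t: "t \<in> {0..T}" for t
    using game_identity[OF a gamma_nz Rh_SO3[OF obs t], of "rodrigues (?Q t)" "sigma_signal opt \<omega> R n Rh t" "n t" "rodrigues (?Q t)"]
    unfolding running_cost_def Let_def e_def opt_signal[OF t] by simp
  have i: "(\<lambda>t. ?r t + ?run t) integrable_on {0..T}" using ir irun by (rule integrable_add)
  then have "(\<lambda>t. (- 1 / \<gamma>\<^sup>2) * (?r t + ?run t)) integrable_on {0..T}"
    by (rule integrable_on_mult_right)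
  then show "e integrable_on {0..T}"
    by (rule integrable_eq) (simp only: id, simp add: gamma_nz)
  have "integral {0..T} ?r + integral {0..T} ?run = integral {0..T} (\<lambda>t. ?r t + ?run t)"
    using ir irun by (rule integral_add[symmetric])
  also have "\<dots> = integral {0..T} (\<lambda>t. - \<gamma>\<^sup>2 * e t)"
    by (rule integral_cong) (rule id)
  also have "\<dots> = - \<gamma>\<^sup>2 * integral {0..T} e"
    by simp
  finally have "integral {0..T} ?r + integral {0..T} ?run = - \<gamma>\<^sup>2 * integral {0..T} e" .
  moreover have "2 * ln (1 + (norm (rodrigues (?Q T)))\<^sup>2) = 2 * ln (1 + (norm (rodrigues (?Q 0)))\<^sup>2) + integral {0..T} ?r"
    by (rule has_rate_on_initial[OF rate T'])
  ultimately show "cost_upto a \<gamma> opt \<omega> R n Rh T = V0 - \<gamma>\<^sup>2 * integral {0..T} e"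
    unfolding cost_upto_def error_0[OF obs] by linarith
qed

text \<open>
  Since \<open>V \<ge> 0\<close>, the inequality \<open>cost \<le> V (0)\<close> bounds the integral of the running cost, in which
  \<open>|\<sigma>|\<^sup>2 / (2 a) = 2 a |z|\<^sup>2\<close> raises the weight of \<open>|z|\<^sup>2\<close> from \<open>2 a - 1 / \<gamma>\<^sup>2\<close> to \<open>4 a - 1 / \<gamma>\<^sup>2\<close>.
\<close>

lemma opt_attenuation:
  assumes T: "T \<ge> 0"
  shows "(4 * a - 1 / \<gamma>\<^sup>2) * integral {0..T} (\<lambda>t. rodrigues (att_err R Rh t) \<bullet> rodrigues (att_err R Rh t))
    \<le> \<gamma>\<^sup>2 * integral {0..T} (\<lambda>t. n t \<bullet> n t) + V0"
proof -
  let ?z = "\<lambda>t. rodrigues (att_err R Rh t)"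
  let ?e = "\<lambda>t. (norm (n t + (1 / \<gamma>\<^sup>2) *\<^sub>R (transpose (Rh t) *v ?z t)))\<^sup>2"
  have iz: "(\<lambda>t. ?z t \<bullet> ?z t) integrable_on {0..T}" and ni: "(\<lambda>t. n t \<bullet> n t) integrable_on {0..T}"
    using rodrigues_square_integrable disturbance_square_integrable[OF n, of T]
    by (simp_all add: absolutely_integrable_on_def)
  have "integral {0..T} ?e \<ge> 0"
    by (rule integral_nonneg[OF opt_cost_eq(1)[OF T]]) simp
  then have "cost_upto a \<gamma> opt \<omega> R n Rh T \<le> V0"
    unfolding opt_cost_eq(2)[OF T] using gamma_sq_pos by simp
  moreover have "integral {0..T} (running_cost a \<gamma> opt \<omega> R n Rh)
      = integral {0..T} (\<lambda>t. (4 * a - 1 / \<gamma>\<^sup>2) * (?z t \<bullet> ?z t) - \<gamma>\<^sup>2 * (n t \<bullet> n t))"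
    by (rule integral_cong) (rule opt_running_cost)
  moreover have "\<dots> = (4 * a - 1 / \<gamma>\<^sup>2) * integral {0..T} (\<lambda>t. ?z t \<bullet> ?z t) - \<gamma>\<^sup>2 * integral {0..T} (\<lambda>t. n t \<bullet> n t)"
    using iz ni by (subst integral_diff) (auto intro: integrable_on_mult_right)
  moreover have "2 * ln (1 + (norm (?z T))\<^sup>2) \<ge> 0" by simp
  ultimately show ?thesis unfolding cost_upto_def by linarith
qed

lemma opt_error_rate:
  "has_rate_on T (att_err R Rh) (\<lambda>t. att_err R Rh t ** skew (- (2 * a) *\<^sub>R rodrigues (att_err R Rh t))
      - skew (R t *v n t) ** att_err R Rh t)"
proof (rule has_rate_on_cong[OF error_rate[OF obs] refl])
  fix t assume t: "t \<in> {0..T}"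
  have "att_err R Rh t *v (Rh t *v n t) = R t *v n t"
    by (simp add: att_err_def matrix_vector_mul_assoc SO3_trans_mult[OF Rh_SO3[OF obs t]] flip: matrix_mul_assoc)
  then have "att_err R Rh t ** skew (Rh t *v n t) = skew (R t *v n t) ** att_err R Rh t"
    by (simp add: SO3_mult_skew[OF error_SO3[OF obs t]])
  then show "att_err R Rh t ** skew (- (2 * a) *\<^sub>R rodrigues (att_err R Rh t)) - skew (R t *v n t) ** att_err R Rh t
      = att_err R Rh t ** skew (sigma_signal opt \<omega> R n Rh t - Rh t *v n t)"
    unfolding opt_signal[OF t] skew_diff matrix_mult.diff_right by simp
qed

end

lemma disturbance_bound:
  assumes "n \<in> disturbances"
  obtains D where "D \<ge> 0" "\<And>t. t \<in> {0..T} \<Longrightarrow> norm (R t *v n t) \<le> D"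
proof (cases "T \<ge> 0")
  case True
  then obtain D where D: "\<forall>t\<in>{0..T}. norm (n t) \<le> D"
    using assms by (auto simp: disturbances_def bounded_iff)
  then have "0 \<le> D" using True norm_ge_zero[of "n 0"] by (meson atLeastAtMost_iff order_refl order_trans)
  then show thesis using D R_SO3 by (intro that[of D]) (auto simp: norm_SO3_mult)
qed (use that[of 0] in auto)

lemma opt_unique:
  assumes n: "n \<in> disturbances" and Rh: "observer_on T opt \<omega> R Rh0 n Rh" and Rh': "observer_on T opt \<omega> R Rh0 n Rh'"
    and t: "t \<in> {0..T}"
  shows "Rh t = Rh' t"
proof -
  obtain D where D: "D \<ge> 0" "\<And>t. t \<in> {0..T} \<Longrightarrow> norm (R t *v n t) \<le> D"
    using disturbance_bound[OF n] by blast
  have "att_err R Rh t = att_err R Rh' t"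
    by (rule closed_loop_error_unique[OF opt_error_rate[OF Rh n] error_SO3[OF Rh] error_not_Pi[OF Rh]
          opt_error_rate[OF Rh' n] error_SO3[OF Rh'] error_not_Pi[OF Rh'] _ D t])
      (simp_all add: error_0[OF Rh] error_0[OF Rh'])
  then have "transpose (R t) ** (R t ** transpose (Rh t)) = transpose (R t) ** (R t ** transpose (Rh' t))"
    by (simp add: att_err_def)
  then have "transpose (Rh t) = transpose (Rh' t)"
    using t by (simp add: matrix_mul_assoc SO3_trans_mult R_SO3)
  then show ?thesis by (metis transpose_transpose)
qed

text \<open>
  The error equation does not involve the angular velocity, so it can be solved first; the estimate
  is then recovered from the error and the known attitude.
\<close>

lemma opt_exists_on:
  assumes n: "n \<in> disturbances" and T: "T \<ge> 0"
  shows "\<exists>Rh. observer_on T opt \<omega> R Rh0 n Rh"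
proof -
  obtain D where D: "D \<ge> 0" "\<And>t. t \<in> {0..T} \<Longrightarrow> norm (R t *v n t) \<le> D"
    using disturbance_bound[OF n] by blast
  have d: "(\<lambda>t. R t *v n t) absolutely_integrable_on {0..T}"
    by (rule absolutely_integrable_bilinear_continuous[OF bounded_bilinear_matrix_vector_mult
          has_rate_on_continuous[OF R_rate] disturbance_integrable[OF n]])
  obtain Q where Q: "Q 0 = Q0" "\<And>t. t \<in> {0..T} \<Longrightarrow> Q t \<in> SO3" "\<And>t. t \<in> {0..T} \<Longrightarrow> Q t \<notin> Pi_set"
    "has_rate_on T Q (\<lambda>t. Q t ** skew (- (2 * a) *\<^sub>R rodrigues (Q t)) - skew (R t *v n t) ** Q t)"
    using closed_loop_error_exists[OF T a d D, of Q0] err0 by blast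
  define Rh where "Rh t = transpose (Q t) ** R t" for t
  have err: "att_err R Rh t = Q t" if "t \<in> {0..T}" for t
    using that by (simp add: att_err_def Rh_def matrix_transpose_mul matrix_mul_assoc SO3_mult_trans R_SO3)
  have "has_rate_on T Rh (\<lambda>t. Rh t ** skew (\<omega> t + n t) - skew (sigma_signal opt \<omega> R n Rh t) ** Rh t)"
  proof (rule has_rate_on_cong[OF has_rate_on_bilinear[OF bounded_bilinear_matrix_mult
          has_rate_on_linear[OF bounded_linear_transpose Q(4)] R_rate] Rh_def])
    fix t assume t: "t \<in> {0..T}"
    have s: "sigma_signal opt \<omega> R n Rh t = - (2 * a) *\<^sub>R rodrigues (Q t)"
      using innov_scaled_id[of R Rh t a] Q(2,3)[OF t] by (simp add: sigma_signal_def err[OF t])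
    have "transpose (Q t) ** skew (R t *v n t) ** R t = Rh t ** skew (n t)"
      using t by (simp add: Rh_def SO3_mult_skew R_SO3 flip: matrix_mul_assoc)
    then show "Rh t ** skew (\<omega> t + n t) - skew (sigma_signal opt \<omega> R n Rh t) ** Rh t
        = transpose (Q t ** skew (- (2 * a) *\<^sub>R rodrigues (Q t)) - skew (R t *v n t) ** Q t) ** R t
          + transpose (Q t) ** (R t ** skew (\<omega> t))"
      unfolding s
      by (simp add: Rh_def transpose_diff matrix_transpose_mul transpose_skew skew_add matrix_mult.diff_left
          matrix_mult.add_right matrix_mult.minus_left matrix_mult.minus_right matrix_mul_assoc)
  qed
  moreover have "Rh 0 = Rh0"
  proof -
    have "Rh 0 = Rh0 ** (transpose (R 0) ** R 0)"
      by (simp add: Rh_def Q(1) matrix_transpose_mul matrix_mul_assoc)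
    then show ?thesis by (simp add: SO3_trans_mult R_SO3)
  qed
  moreover have "Rh t \<in> SO3" if "t \<in> {0..T}" for t
    using that by (simp add: Rh_def mult_SO3 transpose_SO3 Q R_SO3)
  ultimately have "observer_on T opt \<omega> R Rh0 n Rh"
    unfolding observer_on_def using Q(3) err by simp
  then show ?thesis by blast
qed

lemma observer_on_subinterval:
  "observer_on T \<sigma> \<omega> R Rh0 n Rh \<Longrightarrow> S \<le> T \<Longrightarrow> observer_on S \<sigma> \<omega> R Rh0 n Rh"
  unfolding observer_on_def by (auto intro: has_rate_on_subinterval)

text \<open>
  Solutions on \<open>{0..T}\<close> for different \<open>T\<close> agree by uniqueness, so the diagonal is a global solution.
\<close>

lemma opt_exists:
  assumes n: "n \<in> disturbances"
  shows "\<exists>Rh. observer opt \<omega> R Rh0 n Rh"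
proof -
  obtain X where X: "\<And>T. T \<ge> 0 \<Longrightarrow> observer_on T opt \<omega> R Rh0 n (X T)"
    using opt_exists_on[OF n] by metis
  define Rh where "Rh t = X t t" for t
  have "observer_on T opt \<omega> R Rh0 n Rh" if T: "T \<ge> 0" for T
  proof -
    have eq: "Rh t = X T t" if "t \<in> {0..T}" for t
      unfolding Rh_def using that
      by (intro opt_unique[OF n X observer_on_subinterval[OF X]]) auto
    have "sigma_signal opt \<omega> R n Rh t = sigma_signal opt \<omega> R n (X T) t" if "t \<in> {0..T}" for t
      using eq[OF that] by (simp add: sigma_signal_def innov_def att_err_def)
    then have "has_rate_on T Rh (\<lambda>t. Rh t ** skew (\<omega> t + n t) - skew (sigma_signal opt \<omega> R n Rh t) ** Rh t)"
      by (intro has_rate_on_cong[OF Rh_rate[OF X[OF T]]]) (simp_all add: eq)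
    moreover have "Rh 0 = Rh0" "\<And>t. t \<in> {0..T} \<Longrightarrow> Rh t \<in> SO3 \<and> att_err R Rh t \<notin> Pi_set"
      using X[OF T] eq T by (auto simp: observer_on_def att_err_def)
    ultimately show ?thesis by (simp add: observer_on_def)
  qed
  then show ?thesis by (auto simp: observer_def)
qed

lemma opt_cost_antimono:
  assumes n: "n \<in> disturbances" and obs: "observer opt \<omega> R Rh0 n Rh" and st: "0 \<le> s" "s \<le> t"
  shows "cost_upto a \<gamma> opt \<omega> R n Rh t \<le> cost_upto a \<gamma> opt \<omega> R n Rh s"
proof -
  let ?e = "\<lambda>t. (norm (n t + (1 / \<gamma>\<^sup>2) *\<^sub>R (transpose (Rh t) *v rodrigues (att_err R Rh t))))\<^sup>2"
  have o: "observer_on r opt \<omega> R Rh0 n Rh" if "0 \<le> r" for r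
    using obs that by (simp add: observer_def)
  have t: "0 \<le> t" using st by simp
  have "integral {0..s} ?e \<le> integral {0..t} ?e"
    using opt_cost_eq(1)[OF o n] st t by (intro integral_subset_le) auto
  then have "\<gamma>\<^sup>2 * integral {0..s} ?e \<le> \<gamma>\<^sup>2 * integral {0..t} ?e"
    by (rule mult_left_mono) simp
  then show ?thesis
    unfolding opt_cost_eq(2)[OF o[OF t] n t] opt_cost_eq(2)[OF o[OF st(1)] n st(1)] by linarith
qed

lemma opt_cost_0:
  assumes n: "n \<in> disturbances" and obs: "observer opt \<omega> R Rh0 n Rh"
  shows "cost_upto a \<gamma> opt \<omega> R n Rh 0 = V0"
proof -
  have "observer_on 0 opt \<omega> R Rh0 n Rh"
    using obs by (simp add: observer_def)
  from error_0[OF this] show ?thesis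
    by (simp add: cost_upto_def)
qed

lemma opt_cost_limit:
  assumes "n \<in> disturbances" "observer opt \<omega> R Rh0 n Rh"
  obtains L where "((\<lambda>t. ereal (cost_upto a \<gamma> opt \<omega> R n Rh t)) \<longlongrightarrow> L) at_top" "L \<le> ereal V0"
proof
  show "((\<lambda>t. ereal (cost_upto a \<gamma> opt \<omega> R n Rh t)) \<longlongrightarrow>
      (INF t\<in>{0..}. ereal (cost_upto a \<gamma> opt \<omega> R n Rh t))) at_top"
    by (rule antimono_tendsto_ereal) (rule opt_cost_antimono[OF assms])
  have "(INF t\<in>{0..}. ereal (cost_upto a \<gamma> opt \<omega> R n Rh t)) \<le> ereal (cost_upto a \<gamma> opt \<omega> R n Rh 0)"
    by (rule INF_lower) simp
  then show "(INF t\<in>{0..}. ereal (cost_upto a \<gamma> opt \<omega> R n Rh t)) \<le> ereal V0"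
    unfolding opt_cost_0[OF assms] .
qed

lemma opt_well_defined: "J_well_defined a \<gamma> \<omega> R Rh0 opt"
  unfolding J_well_defined_def
proof (intro conjI ballI)
  show "causal opt"
    unfolding causal_def innov_def att_err_def
  proof (intro allI impI)
    fix t :: real and R R' Rh Rh' :: "real \<Rightarrow> real^3^3" and wy wy' :: "real \<Rightarrow> real^3"
    assume "0 \<le> t" "\<forall>s\<in>{0..t}. R s = R' s \<and> Rh s = Rh' s \<and> wy s = wy' s"
    then have "R t = R' t" "Rh t = Rh' t" by simp_all
    then show "- (psi (a *\<^sub>R mat 1 ** (R t ** transpose (Rh t))) /\<^sub>R (1 - (att_norm (R t ** transpose (Rh t)))\<^sup>2))
       = - (psi (a *\<^sub>R mat 1 ** (R' t ** transpose (Rh' t))) /\<^sub>R (1 - (att_norm (R' t ** transpose (Rh' t)))\<^sup>2))"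
      by simp
  qed
  fix n assume n: "n \<in> disturbances"
  show "\<exists>Rh. observer opt \<omega> R Rh0 n Rh" by (rule opt_exists[OF n])
  show "\<forall>T\<ge>0. \<forall>Rh Rh'. observer_on T opt \<omega> R Rh0 n Rh \<longrightarrow> observer_on T opt \<omega> R Rh0 n Rh' \<longrightarrow>
      (\<forall>t\<in>{0..T}. Rh t = Rh' t)"
    using opt_unique[OF n] by blast
  show "\<forall>Rh. observer opt \<omega> R Rh0 n Rh \<longrightarrow>
      (\<forall>T\<ge>0. running_cost a \<gamma> opt \<omega> R n Rh absolutely_integrable_on {0..T}) \<and>
      (\<exists>L. ((\<lambda>t. ereal (cost_upto a \<gamma> opt \<omega> R n Rh t)) \<longlongrightarrow> L) at_top)"
  proof (intro allI impI conjI)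
    fix Rh assume obs: "observer opt \<omega> R Rh0 n Rh"
    show "running_cost a \<gamma> opt \<omega> R n Rh absolutely_integrable_on {0..T}" if "T \<ge> 0" for T
      using obs that by (intro opt_running_integrable[OF _ n]) (simp add: observer_def)
    show "\<exists>L. ((\<lambda>t. ereal (cost_upto a \<gamma> opt \<omega> R n Rh t)) \<longlongrightarrow> L) at_top"
      using opt_cost_limit[OF n obs] by blast
  qed
qed

lemma J_opt_le: "J a \<gamma> \<omega> R Rh0 opt \<le> ereal V0"
  unfolding J_def
proof (intro SUP_least)
  fix n Rh assume n: "n \<in> disturbances" and "Rh \<in> {Rh. observer opt \<omega> R Rh0 n Rh}"
  then have obs: "observer opt \<omega> R Rh0 n Rh" by simp
  obtain L where L: "((\<lambda>t. ereal (cost_upto a \<gamma> opt \<omega> R n Rh t)) \<longlongrightarrow> L) at_top" "L \<le> ereal V0"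
    using opt_cost_limit[OF n obs] .
  then show "Lim at_top (\<lambda>t. ereal (cost_upto a \<gamma> opt \<omega> R n Rh t)) \<le> ereal V0"
    by (subst tendsto_Lim[OF trivial_limit_at_top_linorder L(1)])
qed

lemma observer_causal:
  assumes wd: "J_well_defined a \<gamma> \<omega> R Rh0 \<sigma>" and n: "n \<in> disturbances"
    and t: "t \<ge> 0" and eq: "\<And>s. 0 \<le> s \<Longrightarrow> s < t \<Longrightarrow> n s = n' s"
    and obs: "observer_on t \<sigma> \<omega> R Rh0 n Rh" and obs': "observer_on t \<sigma> \<omega> R Rh0 n' Rh'"
  shows "Rh t = Rh' t"
proof -
  have "causal \<sigma>" using wd by (simp add: J_well_defined_def)
  \<comment> \<open>Before the time \<open>t\<close> the innovation cannot distinguish \<open>n\<close> from \<open>n'\<close>, so \<open>Rh'\<close> is a trajectory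
    for \<open>n\<close> as well.\<close>
  have sig: "sigma_signal \<sigma> \<omega> R n Rh' s = sigma_signal \<sigma> \<omega> R n' Rh' s" if "0 \<le> s" "s < t" for s
  proof -
    have "\<forall>r\<in>{0..s}. R r = R r \<and> Rh' r = Rh' r \<and> (\<lambda>t. \<omega> t + n t) r = (\<lambda>t. \<omega> t + n' t) r"
      using eq that by auto
    with \<open>causal \<sigma>\<close>[unfolded causal_def, THEN spec, THEN mp, OF that(1), THEN spec, THEN spec,
        THEN spec, THEN spec, THEN spec, THEN spec]
    show ?thesis unfolding sigma_signal_def by (rule mp)
  qed
  have "has_rate_on t Rh' (\<lambda>s. Rh' s ** skew (\<omega> s + n s) - skew (sigma_signal \<sigma> \<omega> R n Rh' s) ** Rh' s)"
    by (rule has_rate_on_cong_initial[OF Rh_rate[OF obs']]) (simp add: sig eq)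
  then have "observer_on t \<sigma> \<omega> R Rh0 n Rh'"
    using obs' unfolding observer_on_def by blast
  moreover have "t \<in> {0..t}" using t by simp
  ultimately show ?thesis
    using wd n obs t unfolding J_well_defined_def by blast
qed

text \<open>
  The map from disturbances to trajectories is strictly causal, so the truncated worst-case feedback
  can be followed up to a square-integrable error of any prescribed size.
\<close>

lemma near_worst_disturbance:
  assumes wd: "J_well_defined a \<gamma> \<omega> R Rh0 \<sigma>" and c: "c > 0"
  obtains n Rh where "n \<in> disturbances" "observer \<sigma> \<omega> R Rh0 n Rh"
    "\<And>t. t \<ge> 0 \<Longrightarrow> norm (n t + (1 / \<gamma>\<^sup>2) *\<^sub>R
        (transpose (Rh t) *v trunc_rodrigues (cos2_half Q0) (att_err R Rh t))) \<le> c * exp (- t)"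
proof -
  let ?\<mu> = "cos2_half Q0"
  have \<mu>: "?\<mu> > 0" using err0 by (intro cos2_half_pos) auto
  define X where "X n = (SOME Rh. observer \<sigma> \<omega> R Rh0 n Rh)" for n
  have X: "observer \<sigma> \<omega> R Rh0 n (X n)" if "n \<in> disturbances" for n
  proof -
    have "\<exists>Rh. observer \<sigma> \<omega> R Rh0 n Rh"
      using wd that unfolding J_well_defined_def by blast
    then show ?thesis unfolding X_def by (rule someI_ex)
  qed
  then have XT: "observer_on T \<sigma> \<omega> R Rh0 n (X n)" if "n \<in> disturbances" "T \<ge> 0" for n T
    using that by (simp add: observer_def)
  define G where "G n t = - ((1 / \<gamma>\<^sup>2) *\<^sub>R (transpose (X n t) *v trunc_rodrigues ?\<mu> (att_err R (X n) t)))" for n t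
  obtain n where n: "n \<in> disturbances" "\<And>t. t \<ge> 0 \<Longrightarrow> norm (n t - G n t) \<le> c * exp (- t)"
  proof (rule approximate_fixed_point_of_causal_operator[of G "1 / \<gamma>\<^sup>2 * (1 / (2 * ?\<mu>))" "\<lambda>t. c * exp (- t)"])
    fix n assume n: "n \<in> disturbances"
    show "continuous_on {0..} (G n)"
    proof (rule continuous_on_atLeastI)
      fix T :: real assume "T \<ge> 0"
      note o = XT[OF n this]
      have "continuous_on {0..T} (\<lambda>t. transpose (X n t) *v trunc_rodrigues ?\<mu> (att_err R (X n) t))"
        by (intro bounded_bilinear.continuous_on[OF bounded_bilinear_matrix_vector_mult]
          bounded_linear.continuous_on[OF bounded_linear_transpose]
          has_rate_on_continuous[OF Rh_rate[OF o]] continuous_on_trunc_rodrigues error_continuous[OF o] \<mu>)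
      then show "continuous_on {0..T} (G n)"
        unfolding G_def[abs_def] by (intro continuous_intros)
    qed
    show "norm (G n t) \<le> 1 / \<gamma>\<^sup>2 * (1 / (2 * ?\<mu>))" if t: "t \<ge> 0" for t
    proof -
      have t': "t \<in> {0..t}" using t by simp
      note o = XT[OF n t]
      have "norm (G n t) = 1 / \<gamma>\<^sup>2 * norm (trunc_rodrigues ?\<mu> (att_err R (X n) t))"
        unfolding G_def norm_minus_cancel norm_scaleR norm_SO3_mult[OF transpose_SO3[OF Rh_SO3[OF o t']]]
        by (simp only: abs_of_nonneg divide_nonneg_nonneg zero_le_one zero_le_power2)
      also have "\<dots> \<le> 1 / \<gamma>\<^sup>2 * (1 / (2 * ?\<mu>))"
        by (intro mult_left_mono norm_trunc_rodrigues_bound[OF error_SO3[OF o t'] \<mu>]) simp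
      finally show ?thesis .
    qed
  next
    fix n n' t assume n: "n \<in> disturbances" "n' \<in> disturbances" and t: "(0::real) \<le> t"
      and eq: "\<And>s. 0 \<le> s \<Longrightarrow> s < t \<Longrightarrow> n s = n' s"
    have "X n t = X n' t"
      by (rule observer_causal[OF wd n(1) t eq XT[OF n(1) t] XT[OF n(2) t]])
    then show "G n t = G n' t"
      by (simp only: G_def att_err_def)
  qed (use c in \<open>auto intro!: continuous_intros\<close>)
  show thesis
  proof (rule that[OF n(1) X[OF n(1)]])
    fix t :: real assume t: "t \<ge> 0"
    show "norm (n t + (1 / \<gamma>\<^sup>2) *\<^sub>R (transpose (X n t) *v trunc_rodrigues ?\<mu> (att_err R (X n) t))) \<le> c * exp (- t)"
      using n(2)[OF t] unfolding G_def diff_minus_eq_add .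
  qed
qed

text \<open>
  The disturbance that follows the truncated feedback up to the error \<open>c exp (- t)\<close> loses at most
  \<open>\<gamma>\<^sup>2 c\<^sup>2\<close>, and \<open>c\<close> is arbitrary.
\<close>

lemma J_ge:
  assumes wd: "J_well_defined a \<gamma> \<omega> R Rh0 \<sigma>"
  shows "ereal V0 \<le> J a \<gamma> \<omega> R Rh0 \<sigma>"
proof (rule ereal_le_epsilon2)
  fix e :: real assume e: "e > 0"
  define c where "c = sqrt (e / \<gamma>\<^sup>2)"
  have c: "c > 0" "\<gamma>\<^sup>2 * c\<^sup>2 = e"
    using e gamma_sq_pos by (simp_all add: c_def)
  obtain n Rh where n: "n \<in> disturbances" and obs: "observer \<sigma> \<omega> R Rh0 n Rh"
    and near: "\<And>t. t \<ge> 0 \<Longrightarrow> norm (n t + (1 / \<gamma>\<^sup>2) *\<^sub>R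
        (transpose (Rh t) *v trunc_rodrigues (cos2_half Q0) (att_err R Rh t))) \<le> c * exp (- t)"
    using near_worst_disturbance[OF wd c(1)] by blast
  have low: "V0 - e \<le> cost_upto a \<gamma> \<sigma> \<omega> R n Rh T" if T: "T \<ge> 0" for T
  proof -
    have I: "((\<lambda>t. (c * exp (- t))\<^sup>2) has_integral - (c\<^sup>2 / 2) * exp (- 2 * T) - (- (c\<^sup>2 / 2) * exp (- 2 * 0))) {0..T}"
    proof (rule fundamental_theorem_of_calculus[OF T])
      fix t
      have "((\<lambda>t. - (c\<^sup>2 / 2) * exp (- 2 * t)) has_real_derivative - (c\<^sup>2 / 2) * (exp (- 2 * t) * (- 2))) (at t within {0..T})"
        by (auto intro!: derivative_eq_intros)
      moreover have "- (c\<^sup>2 / 2) * (exp (- 2 * t) * (- 2)) = (c * exp (- t))\<^sup>2"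
        by (simp add: power_mult_distrib flip: exp_double)
      ultimately show "((\<lambda>t. - (c\<^sup>2 / 2) * exp (- 2 * t)) has_vector_derivative (c * exp (- t))\<^sup>2) (at t within {0..T})"
        by (simp add: has_real_derivative_iff_has_vector_derivative)
    qed
    have "integral {0..T} (\<lambda>t. (c * exp (- t))\<^sup>2) = c\<^sup>2 / 2 - c\<^sup>2 / 2 * exp (- 2 * T)"
      using integral_unique[OF I] by simp
    also have "\<dots> \<le> c\<^sup>2"
      using zero_le_power2[of c] by (auto intro: order_trans[of _ "c\<^sup>2 / 2"])
    finally have "\<gamma>\<^sup>2 * integral {0..T} (\<lambda>t. (c * exp (- t))\<^sup>2) \<le> \<gamma>\<^sup>2 * c\<^sup>2"
      by (rule mult_left_mono) simp
    moreover have "V0 - \<gamma>\<^sup>2 * integral {0..T} (\<lambda>t. (c * exp (- t))\<^sup>2) \<le> cost_upto a \<gamma> \<sigma> \<omega> R n Rh T"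
    proof (rule cost_lower_bound[OF _ T])
      show "observer_on T \<sigma> \<omega> R Rh0 n Rh" using obs T by (simp add: observer_def)
      show "running_cost a \<gamma> \<sigma> \<omega> R n Rh absolutely_integrable_on {0..T}"
        using wd n obs T by (simp add: J_well_defined_def)
      show "(\<lambda>t. (c * exp (- t))\<^sup>2) integrable_on {0..T}" by (rule has_integral_integrable[OF I])
    qed (rule near, simp)
    ultimately show ?thesis using c(2) by linarith
  qed
  obtain L where L: "((\<lambda>t. ereal (cost_upto a \<gamma> \<sigma> \<omega> R n Rh t)) \<longlongrightarrow> L) at_top"
    using wd n obs unfolding J_well_defined_def by blast
  have "ereal (V0 - e) \<le> L"
  proof (rule tendsto_lowerbound[OF L])
    show "eventually (\<lambda>t. ereal (V0 - e) \<le> ereal (cost_upto a \<gamma> \<sigma> \<omega> R n Rh t)) at_top"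
      using eventually_ge_at_top[of 0] by eventually_elim (simp only: ereal_less_eq, rule low)
  qed simp
  also have "L = Lim at_top (\<lambda>t. ereal (cost_upto a \<gamma> \<sigma> \<omega> R n Rh t))"
    by (rule tendsto_Lim[OF trivial_limit_at_top_linorder L, symmetric])
  also have "\<dots> \<le> J a \<gamma> \<omega> R Rh0 \<sigma>"
    unfolding J_def using n obs by (intro SUP_upper2[of n] SUP_upper) auto
  finally have "ereal (V0 - e) + ereal e \<le> J a \<gamma> \<omega> R Rh0 \<sigma> + ereal e"
    by (rule add_right_mono)
  then show "ereal V0 \<le> J a \<gamma> \<omega> R Rh0 \<sigma> + ereal e" by simp
qed

lemma J_opt: "J a \<gamma> \<omega> R Rh0 opt = ereal V0"
  using J_opt_le J_ge[OF opt_well_defined] by (rule antisym)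

lemma opt_minimizes: "is_arg_min (J a \<gamma> \<omega> R Rh0) (J_well_defined a \<gamma> \<omega> R Rh0) opt"
  unfolding is_arg_min_def J_opt using opt_well_defined J_ge by (auto simp: not_less)

lemma opt_L2_gain:
  assumes n: "n \<in> disturbances" and obs: "observer opt \<omega> R Rh0 n Rh"
  shows "ennreal (4 * a - 1 / \<gamma>\<^sup>2) *
      (\<integral>\<^sup>+t\<in>{0..}. ennreal (rodrigues (att_err R Rh t) \<bullet> rodrigues (att_err R Rh t)) \<partial>lebesgue)
    \<le> ennreal (\<gamma>\<^sup>2) * (\<integral>\<^sup>+t\<in>{0..}. ennreal (n t \<bullet> n t) \<partial>lebesgue) + ennreal V0"
proof -
  let ?z = "\<lambda>t. rodrigues (att_err R Rh t) \<bullet> rodrigues (att_err R Rh t)" and ?n = "\<lambda>t. n t \<bullet> n t"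
  have o: "observer_on T opt \<omega> R Rh0 n Rh" if "T \<ge> 0" for T
    using obs that by (simp add: observer_def)
  have z: "(\<integral>\<^sup>+t\<in>{0..}. ennreal (?z t) \<partial>lebesgue) = (SUP k. ennreal (integral {0..real k} ?z))"
    by (rule nn_integral_atLeast_eq_SUP) (use rodrigues_square_integrable[OF o n] in auto)
  have nn: "(\<integral>\<^sup>+t\<in>{0..}. ennreal (?n t) \<partial>lebesgue) = (SUP k. ennreal (integral {0..real k} ?n))"
    by (rule nn_integral_atLeast_eq_SUP) (use disturbance_square_integrable[OF n] in auto)
  have pos: "4 * a - 1 / \<gamma>\<^sup>2 \<ge> 0" using weight_pos a by linarith
  have "ennreal (4 * a - 1 / \<gamma>\<^sup>2) * (SUP k. ennreal (integral {0..real k} ?z))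
      = (SUP k. ennreal (4 * a - 1 / \<gamma>\<^sup>2) * ennreal (integral {0..real k} ?z))"
    by (simp add: SUP_mult_left_ennreal)
  also have "\<dots> \<le> ennreal (\<gamma>\<^sup>2) * (SUP k. ennreal (integral {0..real k} ?n)) + ennreal V0"
  proof (rule SUP_least)
    fix k :: nat
    have k: "real k \<ge> 0" by simp
    have "(\<lambda>t. n t \<bullet> n t) integrable_on {0..real k}"
      using disturbance_square_integrable[OF n] by (simp add: absolutely_integrable_on_def)
    then have i: "integral {0..real k} ?n \<ge> 0"
      by (rule integral_nonneg) simp
    have "ennreal (4 * a - 1 / \<gamma>\<^sup>2) * ennreal (integral {0..real k} ?z)
        = ennreal ((4 * a - 1 / \<gamma>\<^sup>2) * integral {0..real k} ?z)"
      using pos by (simp add: ennreal_mult')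
    also have "\<dots> \<le> ennreal (\<gamma>\<^sup>2 * integral {0..real k} ?n + V0)"
      by (rule ennreal_leI) (rule opt_attenuation[OF o[OF k] n k])
    also have "\<dots> = ennreal (\<gamma>\<^sup>2) * ennreal (integral {0..real k} ?n) + ennreal V0"
      using i V0_nonneg by (simp add: ennreal_plus ennreal_mult' del: V0_nonneg)
    also have "\<dots> \<le> ennreal (\<gamma>\<^sup>2) * (SUP k. ennreal (integral {0..real k} ?n)) + ennreal V0"
      by (intro add_right_mono mult_left_mono SUP_upper) auto
    finally show "ennreal (4 * a - 1 / \<gamma>\<^sup>2) * ennreal (integral {0..real k} ?z)
        \<le> ennreal (\<gamma>\<^sup>2) * (SUP k. ennreal (integral {0..real k} ?n)) + ennreal V0" .
  qed
  finally show ?thesis unfolding z nn .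
qed

end

theorem theorem5:
  fixes a \<gamma> :: real
    and \<omega> :: "real \<Rightarrow> real^3" and R :: "real \<Rightarrow> real^3^3" and Rh0 :: "real^3^3"
  assumes "a > 0" and "\<gamma>^2 > 1 / (2 * a)"
    and "attitude_kinematics \<omega> R"
    and "Rh0 \<in> SO3"
    and "R 0 ** transpose Rh0 \<in> SO3 - Pi_set"
  shows "is_arg_min (J a \<gamma> \<omega> R Rh0) (J_well_defined a \<gamma> \<omega> R Rh0) (innov (a *\<^sub>R mat 1))
    \<and> J a \<gamma> \<omega> R Rh0 (innov (a *\<^sub>R mat 1))
        = ereal (2 * ln (1 + (norm (rodrigues (R 0 ** transpose Rh0)))^2))
    \<and> (\<forall>n\<in>disturbances. \<forall>Rh. observer (innov (a *\<^sub>R mat 1)) \<omega> R Rh0 n Rh \<longrightarrow>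
         ennreal (4 * a - 1 / \<gamma>^2) *
           (\<integral>\<^sup>+t\<in>{0..}. ennreal (rodrigues (att_err R Rh t) \<bullet> rodrigues (att_err R Rh t)) \<partial>lebesgue)
         \<le> ennreal (\<gamma>^2) * (\<integral>\<^sup>+t\<in>{0..}. ennreal (n t \<bullet> n t) \<partial>lebesgue)
           + ennreal (2 * ln (1 + (norm (rodrigues (R 0 ** transpose Rh0)))^2)))"
proof -
  interpret attitude_observer a \<gamma> \<omega> R Rh0
    using assms by unfold_locales
  show ?thesis
    using opt_minimizes J_opt opt_L2_gain by blast
qed

end
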